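(* The satisfiability problem (over the class of all frames) for modal formulas without propositional variables, i.e. formulas built from the constants $\mathit{true}$ and $\mathit{false}$ using $\neg$, $\wedge$, $\vee$, $\Box$, $\Diamond$, is PSPACE-complete.
   Context: Semantics is standard Kripke semantics: a model $\langle W,R\rangle$ with $W$ non-empty and $R\subseteq W\times W$ (no valuation is needed); $\mathit{true}$ holds everywhere, $\mathit{false}$ nowhere, Boolean connectives as usual, $\Box\phi$ holds at $w$ iff $\phi$ holds at all $R$-successors of $w$, $\Diamond\phi$ iff $\phi$ holds at some $R$-successor. A formula is satisfiable if it holds at some world of some such model. *)

theory Defs
  imports "HOL-Computational_Algebra.Polynomial"
begin

section \<open>Turing machines, polynomial space, polynomial-time reductions\<close>

text \<open>
  Deterministic multi-tape machines.  States and tape symbols are coded as natural numbers below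
  \<open>num_states\<close> and \<open>num_symbols\<close>.  Tape symbol 0 is the blank, 1 marks the left end of each tape
  initially, and the input letter \<open>a\<close> is written as \<open>a + 2\<close>.  Tapes are infinite to the right only.
  The transition function is given on all of \<open>nat\<close>, but on a well-formed machine only its finitely
  many values at genuine states and symbol tuples are ever used.
\<close>

datatype move = MoveLeft | Stay | MoveRight

record tm =
  num_tapes :: nat
  num_states :: nat
  num_symbols :: nat
  start_state :: nat
  accept_state :: nat
  reject_state :: nat
  trans_fun :: "nat \<Rightarrow> nat list \<Rightarrow> nat \<times> (nat \<times> move) list"

definition wf_tm :: "tm \<Rightarrow> bool" where
  "wf_tm M \<longleftrightarrow>
     0 < num_tapes M \<and>
     start_state M < num_states M \<and> accept_state M < num_states M \<and>
     reject_state M < num_states M \<and> accept_state M \<noteq> reject_state M \<and>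
     (\<forall>q < num_states M. \<forall>xs. length xs = num_tapes M \<and> set xs \<subseteq> {..<num_symbols M} \<longrightarrow>
        (case trans_fun M q xs of (q', acts) \<Rightarrow>
           q' < num_states M \<and> length acts = num_tapes M \<and>
           (\<forall>(s, d) \<in> set acts. s < num_symbols M)))"

text \<open>A tape is its head position together with its contents.\<close>

type_synonym tape = "nat \<times> (nat \<Rightarrow> nat)"
type_synonym config = "nat \<times> tape list"

definition tape_of :: "nat list \<Rightarrow> nat \<Rightarrow> nat" where
  "tape_of w j = (if j = 0 then 1 else if j \<le> length w then w ! (j - 1) + 2 else 0)"

definition init_config :: "tm \<Rightarrow> nat list \<Rightarrow> config" where
  "init_config M w =
     (start_state M, (0, tape_of w) # replicate (num_tapes M - 1) (0, tape_of []))"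

text \<open>By truncated subtraction, a head that moves left from cell 0 stays there.\<close>

fun act :: "nat \<times> move \<Rightarrow> tape \<Rightarrow> tape" where
  "act (s, d) (h, t) =
     ((case d of MoveLeft \<Rightarrow> h - 1 | Stay \<Rightarrow> h | MoveRight \<Rightarrow> h + 1), t(h := s))"

definition halting_state :: "tm \<Rightarrow> nat \<Rightarrow> bool" where
  "halting_state M q \<longleftrightarrow> q = accept_state M \<or> q = reject_state M"

text \<open>Halting configurations are fixed points of \<open>step\<close>.\<close>

fun step :: "tm \<Rightarrow> config \<Rightarrow> config" where
  "step M (q, ts) =
     (if halting_state M q then (q, ts)
      else case trans_fun M q (map (\<lambda>(h, t). t h) ts) of
             (q', acts) \<Rightarrow> (q', map2 act acts ts))"

definition config_at :: "tm \<Rightarrow> nat list \<Rightarrow> nat \<Rightarrow> config" where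
  "config_at M w i = (step M ^^ i) (init_config M w)"

text \<open>
  A language over the alphabet \<open>{..<n}\<close> is a subset of \<open>lists {..<n}\<close>.  The bound \<open>s\<close> restricts the
  cells visited on each tape, the input tape included.
\<close>

definition decides_in_space :: "tm \<Rightarrow> nat \<Rightarrow> nat list set \<Rightarrow> (nat \<Rightarrow> nat) \<Rightarrow> bool" where
  "decides_in_space M n A s \<longleftrightarrow>
     wf_tm M \<and> n + 2 \<le> num_symbols M \<and>
     (\<forall>w \<in> lists {..<n}.
        (\<exists>i. fst (config_at M w i) = (if w \<in> A then accept_state M else reject_state M)) \<and>
        (\<forall>i. \<forall>(h, t) \<in> set (snd (config_at M w i)). h < s (length w)))"

definition in_PSPACE :: "nat \<Rightarrow> nat list set \<Rightarrow> bool" where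
  "in_PSPACE n A \<longleftrightarrow>
     A \<subseteq> lists {..<n} \<and> (\<exists>M (p :: nat poly). decides_in_space M n A (poly p))"

text \<open>
  The output is read off the last tape.  As halting configurations persist, looking at time
  \<open>T (length w)\<close> means that the machine has halted after at most that many steps.
\<close>

definition computes_in_time ::
  "tm \<Rightarrow> nat \<Rightarrow> (nat list \<Rightarrow> nat list) \<Rightarrow> (nat \<Rightarrow> nat) \<Rightarrow> bool" where
  "computes_in_time M n f T \<longleftrightarrow>
     wf_tm M \<and> n + 2 \<le> num_symbols M \<and>
     (\<forall>w \<in> lists {..<n}. case config_at M w (T (length w)) of (q, ts) \<Rightarrow>
        halting_state M q \<and> snd (last ts) = tape_of (f w))"

text \<open>Polynomial-time many-one reducibility of \<open>A\<close> over \<open>{..<n}\<close> to \<open>B\<close> over \<open>{..<m}\<close>.\<close>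

definition poly_reducible :: "nat \<Rightarrow> nat list set \<Rightarrow> nat \<Rightarrow> nat list set \<Rightarrow> bool" where
  "poly_reducible n A m B \<longleftrightarrow>
     (\<exists>f. (\<exists>M (p :: nat poly). computes_in_time M n f (poly p)) \<and>
          (\<forall>w \<in> lists {..<n}. f w \<in> lists {..<m} \<and> (w \<in> A \<longleftrightarrow> f w \<in> B)))"

definition PSPACE_hard :: "nat \<Rightarrow> nat list set \<Rightarrow> bool" where
  "PSPACE_hard m B \<longleftrightarrow> (\<forall>n A. in_PSPACE n A \<longrightarrow> poly_reducible n A m B)"

definition PSPACE_complete :: "nat \<Rightarrow> nat list set \<Rightarrow> bool" where
  "PSPACE_complete m B \<longleftrightarrow> in_PSPACE m B \<and> PSPACE_hard m B"


section \<open>Modal formulas without propositional variables\<close>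

datatype fm = Tru | Fls | Neg fm | Conj fm fm | Disj fm fm | Box fm | Dia fm

primrec holds :: "('w \<times> 'w) set \<Rightarrow> 'w \<Rightarrow> fm \<Rightarrow> bool" where
  "holds R w Tru \<longleftrightarrow> True"
| "holds R w Fls \<longleftrightarrow> False"
| "holds R w (Neg \<phi>) \<longleftrightarrow> \<not> holds R w \<phi>"
| "holds R w (Conj \<phi> \<psi>) \<longleftrightarrow> holds R w \<phi> \<and> holds R w \<psi>"
| "holds R w (Disj \<phi> \<psi>) \<longleftrightarrow> holds R w \<phi> \<or> holds R w \<psi>"
| "holds R w (Box \<phi>) \<longleftrightarrow> (\<forall>v. (w, v) \<in> R \<longrightarrow> holds R v \<phi>)"
| "holds R w (Dia \<phi>) \<longleftrightarrow> (\<exists>v. (w, v) \<in> R \<and> holds R v \<phi>)"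

text \<open>
  HOL cannot quantify over all types of worlds inside a formula, so the type is a parameter.  Any
  infinite type gives the same notion; see \<open>satisfiable_infinite_type\<close> below.
\<close>

definition satisfiable :: "'w itself \<Rightarrow> fm \<Rightarrow> bool" where
  "satisfiable (_ :: 'w itself) \<phi> \<longleftrightarrow>
     (\<exists>(W :: 'w set) R. W \<noteq> {} \<and> R \<subseteq> W \<times> W \<and> (\<exists>w \<in> W. holds R w \<phi>))"

text \<open>Formulas are written as words over a seven-letter alphabet in prefix (Polish) notation.\<close>

primrec encode :: "fm \<Rightarrow> nat list" where
  "encode Tru = [0]"
| "encode Fls = [1]"
| "encode (Neg \<phi>) = 2 # encode \<phi>"
| "encode (Conj \<phi> \<psi>) = 3 # encode \<phi> @ encode \<psi>"
| "encode (Disj \<phi> \<psi>) = 4 # encode \<phi> @ encode \<psi>"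
| "encode (Box \<phi>) = 5 # encode \<phi>"
| "encode (Dia \<phi>) = 6 # encode \<phi>"

definition SAT :: "'w itself \<Rightarrow> nat list set" where
  "SAT T = encode ` {\<phi>. satisfiable T \<phi>}"


subsection \<open>The encoding is unambiguous\<close>

lemma encode_lists: "encode \<phi> \<in> lists {..<7}"
  by (induction \<phi>) auto

lemma encode_prefix_free: "encode \<phi> @ xs = encode \<psi> @ ys \<Longrightarrow> \<phi> = \<psi> \<and> xs = ys"
proof (induction \<phi> arbitrary: \<psi> xs ys)
  case Tru then show ?case by (cases \<psi>) auto
next
  case Fls then show ?case by (cases \<psi>) auto
next
  case (Neg \<phi>) then show ?case by (cases \<psi>) auto
next
  case (Conj \<phi>1 \<phi>2)
  from Conj.prems show ?case by (cases \<psi>) (auto dest!: Conj.IH)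
next
  case (Disj \<phi>1 \<phi>2)
  from Disj.prems show ?case by (cases \<psi>) (auto dest!: Disj.IH)
next
  case (Box \<phi>) then show ?case by (cases \<psi>) auto
next
  case (Dia \<phi>) then show ?case by (cases \<psi>) auto
qed

lemma inj_encode: "inj encode"
  using encode_prefix_free[of _ "[]" _ "[]"] by (auto intro: injI)


subsection \<open>Satisfiability does not depend on the infinite type of worlds\<close>

primrec subfms :: "fm \<Rightarrow> fm set" where
  "subfms Tru = {Tru}"
| "subfms Fls = {Fls}"
| "subfms (Neg \<phi>) = insert (Neg \<phi>) (subfms \<phi>)"
| "subfms (Conj \<phi> \<psi>) = insert (Conj \<phi> \<psi>) (subfms \<phi> \<union> subfms \<psi>)"
| "subfms (Disj \<phi> \<psi>) = insert (Disj \<phi> \<psi>) (subfms \<phi> \<union> subfms \<psi>)"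
| "subfms (Box \<phi>) = insert (Box \<phi>) (subfms \<phi>)"
| "subfms (Dia \<phi>) = insert (Dia \<phi>) (subfms \<phi>)"

lemma finite_subfms: "finite (subfms \<phi>)"
  by (induction \<phi>) auto

lemma self_in_subfms: "\<phi> \<in> subfms \<phi>"
  by (cases \<phi>) auto

lemma satisfiable_infinite_type:
  assumes inf: "infinite (UNIV :: 'w set)"
    and sat: "satisfiable TYPE('v) \<phi>"
  shows "satisfiable TYPE('w) \<phi>"
proof -
  from sat obtain W :: "'v set" and R w
    where W: "R \<subseteq> W \<times> W" "w \<in> W" "holds R w \<phi>"
    unfolding satisfiable_def by blast
  define th where "th u = {\<psi> \<in> subfms \<phi>. holds R u \<psi>}" for u
  have fin: "finite (Pow (subfms \<phi>))" by (simp add: finite_subfms)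
  obtain B :: "'w set" where B: "finite B" "card B = card (Pow (subfms \<phi>))"
    using infinite_arbitrarily_large[OF inf] by blast
  obtain g :: "fm set \<Rightarrow> 'w" where g: "inj_on g (Pow (subfms \<phi>))"
    using finite_same_card_bij[OF fin B(1)] B(2) by (auto simp: bij_betw_def)
  define e where "e u = g (th u)" for u
  have e: "th u = th v" if "e u = e v" for u v
    using that g unfolding e_def by (auto simp: inj_on_def th_def)
  have same: "holds R u \<psi> = holds R v \<psi>" if "e u = e v" "\<psi> \<in> subfms \<phi>" for u v \<psi>
    using e[OF that(1)] that(2) by (auto simp: th_def)
  define R' where "R' = (\<lambda>(u, v). (e u, e v)) ` R"
  have filt: "holds R' (e u) \<psi> = holds R u \<psi>" if "subfms \<psi> \<subseteq> subfms \<phi>" for u \<psi>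
    using that
  proof (induction \<psi> arbitrary: u)
    case (Box \<psi>)
    have sub: "\<psi> \<in> subfms \<phi>" "Box \<psi> \<in> subfms \<phi>"
      using Box.prems self_in_subfms by auto
    have IH: "holds R' (e v) \<psi> = holds R v \<psi>" for v using Box by auto
    show ?case
    proof
      assume "holds R' (e u) (Box \<psi>)"
      then show "holds R u (Box \<psi>)" using IH by (force simp: R'_def)
    next
      assume u: "holds R u (Box \<psi>)"
      have "holds R' x \<psi>" if "(e u, x) \<in> R'" for x
      proof -
        from that obtain u' v' where "(u', v') \<in> R" "e u = e u'" "x = e v'"
          by (auto simp: R'_def)
        then show ?thesis using same[of u u' "Box \<psi>"] sub u IH by auto
      qed
      then show "holds R' (e u) (Box \<psi>)" by simp
    qed
  next
    case (Dia \<psi>)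
    have sub: "\<psi> \<in> subfms \<phi>" "Dia \<psi> \<in> subfms \<phi>"
      using Dia.prems self_in_subfms by auto
    have IH: "holds R' (e v) \<psi> = holds R v \<psi>" for v using Dia by auto
    show ?case
    proof
      assume "holds R u (Dia \<psi>)"
      then show "holds R' (e u) (Dia \<psi>)" using IH by (force simp: R'_def)
    next
      assume "holds R' (e u) (Dia \<psi>)"
      then obtain u' v' where "(u', v') \<in> R" "e u = e u'" "holds R' (e v') \<psi>"
        by (auto simp: R'_def)
      then show "holds R u (Dia \<psi>)" using same[of u u' "Dia \<psi>"] sub IH by auto
    qed
  qed auto
  have "R' \<subseteq> (e ` W) \<times> (e ` W)" using W(1) by (auto simp: R'_def)
  moreover have "holds R' (e w) \<phi>" using filt W(3) by simp
  ultimately show ?thesis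
    unfolding satisfiable_def using W(2) by blast
qed

end

(*
  Membership.  Reading a formula in Polish notation from right to left with a stack of truth values, one bit
  per modal position - does some successor witness this position? - determines the truth values of all
  subformulas at a world.  Satisfiability is a game: in every round one player names such bits for a world,
  and the opponent picks a claimed witness, which the world of the next round has to realize.  The modal depth
  bounds the number of rounds, and the game tree is searched by counting through the strings of moves.

  Hardness.  As in Savitch's theorem, a world of level l describes the first, middle and last configuration of
  a computation of 2^l steps, and two kinds of successors describe its halves; level 0 checks a single step.
  The machine is deterministic, so the first configuration forces the last one.  The h-th propositional
  variable becomes "some successor has depth exactly h", and the genuine worlds are those deeper than all
  chains attached for variables.  In Polish notation the formula is printed by nested loops whose counters are
  head positions; the input head itself runs over the cells and so supplies the initial configuration.
*)

theory Submission
  imports Defs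
begin

section \<open>Structured programs for Turing machines\<close>

text \<open>An unclaimed bit is a statement about all successors, a claimed one about some
  successor. Passing on a prohibition for every unclaimed bit and a requirement for a single claimed
  bit makes the claims exact, while the searching machine stores only one constraint per position of
  the formula. The opponent also moves by naming a bit string, of which the first claimed position
  counts; thus a complete play is a bit string with a fixed alternation pattern, and winning is the
  truth of a quantified Boolean formula whose matrix is a single evaluation run. For hardness, the
  space bound is weakened to \<open>S = C * (m + 1) ^ d\<close>, a number that \<open>d\<close>
  nested loops over heads standing at \<open>m + 1\<close> can count, and the time bound to
  \<open>2 ^ L\<close> with \<open>L\<close> a constant of the machine times \<open>S + 1\<close>,
  so that a loop over a counter can print the \<open>L\<close> levels. Both algorithms are written
  in a small while language. Its judgement \<open>exec\<close> carries a step count and a condition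
  \<open>H\<close> on the heads, so that one compilation theorem yields the space bound of the
  decision procedure and the time bound of the reduction.\<close>

type_synonym st = "nat \<Rightarrow> tape"

text \<open>The default 0 is itself a legal symbol, so a reading on all of \<open>nat\<close> stays
  within the alphabet, as \<open>wf_com\<close> assumes.\<close>

definition rd :: "nat \<Rightarrow> st \<Rightarrow> nat \<Rightarrow> nat" where
  "rd k s i = (if i < k then snd (s i) (fst (s i)) else 0)"

definition upd :: "nat \<Rightarrow> (nat \<Rightarrow> nat \<times> move) \<Rightarrow> st \<Rightarrow> st" where
  "upd k a s = (\<lambda>i. if i < k then act (a i) (s i) else s i)"

datatype com =
    Do "(nat \<Rightarrow> nat) \<Rightarrow> nat \<Rightarrow> nat \<times> move"
  | Seq com com
  | Cond "(nat \<Rightarrow> nat) \<Rightarrow> bool" com com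
  | While "(nat \<Rightarrow> nat) \<Rightarrow> bool" com

text \<open>\<open>t\<close> is the exact number of steps of the compiled machine, with one step for
  each test and each unfolded sequence. \<open>H\<close> is demanded after every action on the
  tapes: it is \<open>h < B\<close> where space matters and trivial where only time does.\<close>

inductive exec :: "nat \<Rightarrow> (nat \<Rightarrow> bool) \<Rightarrow> com \<Rightarrow> st \<Rightarrow> nat \<Rightarrow> st \<Rightarrow> bool"
  for k :: nat and H :: "nat \<Rightarrow> bool" where
  Do: "\<forall>i<k. H (fst (upd k (f (rd k s)) s i)) \<Longrightarrow> exec k H (Do f) s 1 (upd k (f (rd k s)) s)"
| Seq: "exec k H a s t u \<Longrightarrow> exec k H b u t' v \<Longrightarrow> exec k H (Seq a b) s (Suc (t + t')) v"
| Cond: "exec k H (if p (rd k s) then c else d) s t u \<Longrightarrow> exec k H (Cond p c d) s (Suc t) u"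
| While_end: "\<not> p (rd k s) \<Longrightarrow> exec k H (While p c) s 1 s"
| While_step: "p (rd k s) \<Longrightarrow> exec k H c s t u \<Longrightarrow> exec k H (While p c) u t' v \<Longrightarrow>
    exec k H (While p c) s (Suc (t + t')) v"

primrec wf_com :: "nat \<Rightarrow> nat \<Rightarrow> com \<Rightarrow> bool" where
  "wf_com k G (Do f) \<longleftrightarrow> (\<forall>r. (\<forall>i. r i < G) \<longrightarrow> (\<forall>i<k. fst (f r i) < G))"
| "wf_com k G (Seq a b) \<longleftrightarrow> wf_com k G a \<and> wf_com k G b"
| "wf_com k G (Cond p c d) \<longleftrightarrow> wf_com k G c \<and> wf_com k G d"
| "wf_com k G (While p c) \<longleftrightarrow> wf_com k G c"

definition idle :: "(nat \<Rightarrow> nat) \<Rightarrow> nat \<Rightarrow> nat \<times> move" where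
  "idle r i = (r i, Stay)"

lemma upd_idle [simp]: "upd k (idle (rd k s)) s = s"
proof
  show "upd k (idle (rd k s)) s i = s i" for i
    by (cases "s i") (simp add: upd_def idle_def rd_def)
qed

text \<open>The stack of pending commands plays the role of a program counter. A loop waits below
  its body instead of being copied, so only finitely many stacks arise from a program.\<close>

fun cstep :: "(nat \<Rightarrow> nat) \<Rightarrow> com list \<Rightarrow> com list \<times> (nat \<Rightarrow> nat \<times> move)" where
  "cstep r [] = ([], idle r)"
| "cstep r (Do f # cs) = (cs, f r)"
| "cstep r (Seq a b # cs) = (a # b # cs, idle r)"
| "cstep r (Cond p c d # cs) = ((if p r then c else d) # cs, idle r)"
| "cstep r (While p c # cs) = (if p r then c # While p c # cs else cs, idle r)"

definition astep :: "nat \<Rightarrow> com list \<times> st \<Rightarrow> com list \<times> st" where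
  "astep k = (\<lambda>(cs, s). (fst (cstep (rd k s) cs), upd k (snd (cstep (rd k s) cs)) s))"

lemma astep_simps [simp]:
  "astep k ([], s) = ([], s)"
  "astep k (Do f # cs, s) = (cs, upd k (f (rd k s)) s)"
  "astep k (Seq a b # cs, s) = (a # b # cs, s)"
  "astep k (Cond p c d # cs, s) = ((if p (rd k s) then c else d) # cs, s)"
  "astep k (While p c # cs, s) = (if p (rd k s) then c # While p c # cs else cs, s)"
  by (auto simp: astep_def)

definition aiter :: "nat \<Rightarrow> nat \<Rightarrow> com list \<times> st \<Rightarrow> com list \<times> st" where
  "aiter k n = astep k ^^ n"

lemma aiter_0 [simp]: "aiter k 0 x = x" by (simp add: aiter_def)

lemma aiter_Suc [simp]: "aiter k (Suc n) x = aiter k n (astep k x)"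
  by (simp add: aiter_def funpow_swap1)

lemma aiter_add: "aiter k (m + n) x = aiter k n (aiter k m x)"
  by (induction m arbitrary: x) auto

definition heads_in :: "nat \<Rightarrow> (nat \<Rightarrow> bool) \<Rightarrow> st \<Rightarrow> bool" where
  "heads_in k H s \<longleftrightarrow> (\<forall>i<k. H (fst (s i)))"

text \<open>The last conjunct says that the stack is not emptied before time \<open>t\<close>. Since
  the compiled machine halts on the empty stack, this rules out an early halt.\<close>

lemma exec_aiter:
  assumes "exec k H c s t s'" "heads_in k H s"
  shows "aiter k t (c # cs, s) = (cs, s') \<and> heads_in k H s' \<and>
    (\<forall>i\<le>t. heads_in k H (snd (aiter k i (c # cs, s)))) \<and>
    (\<forall>i<t. fst (aiter k i (c # cs, s)) \<noteq> [])"
  using assms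
proof (induction arbitrary: cs rule: exec.induct)
  case (Do f s)
  then show ?case by (auto simp: heads_in_def le_Suc_eq less_Suc_eq)
next
  case (Seq a s t u b t' v)
  note a = Seq.IH(1)[OF Seq.prems, of "b # cs"]
  then have b: "aiter k t' (b # cs, u) = (cs, v)" "heads_in k H v"
      "\<forall>i\<le>t'. heads_in k H (snd (aiter k i (b # cs, u)))"
      "\<forall>i<t'. fst (aiter k i (b # cs, u)) \<noteq> []"
    using Seq.IH(2)[of cs] by auto
  have mid: "aiter k i (a # b # cs, s) = aiter k (i - t) (b # cs, u)" if "t \<le> i" for i
    using a aiter_add[of k t "i - t" "(a # b # cs, s)"] that by simp
  show ?case
  proof (intro conjI allI impI)
    show "aiter k (Suc (t + t')) (Seq a b # cs, s) = (cs, v)" using a b by (simp add: aiter_add)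
    show "heads_in k H v" by fact
    show "heads_in k H (snd (aiter k i (Seq a b # cs, s)))" if "i \<le> Suc (t + t')" for i
    proof (cases i)
      case (Suc j)
      then show ?thesis using that a b(3) mid[of j] by (cases "t \<le> j") auto
    qed (use Seq.prems in simp)
    show "fst (aiter k i (Seq a b # cs, s)) \<noteq> []" if "i < Suc (t + t')" for i
    proof (cases i)
      case (Suc j)
      then show ?thesis using that a b(4) mid[of j] by (cases "t \<le> j") auto
    qed simp
  qed
next
  case (Cond p s c d t u)
  note a = Cond.IH[OF Cond.prems, of cs]
  show ?case
  proof (intro conjI allI impI)
    show "aiter k (Suc t) (Cond p c d # cs, s) = (cs, u)" using a by simp
    show "heads_in k H u" using a by simp
    show "heads_in k H (snd (aiter k i (Cond p c d # cs, s)))" if "i \<le> Suc t" for i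
      using that a Cond.prems by (cases i) auto
    show "fst (aiter k i (Cond p c d # cs, s)) \<noteq> []" if "i < Suc t" for i
      using that a by (cases i) auto
  qed
next
  case (While_end p s c)
  then show ?case by (auto simp: le_Suc_eq less_Suc_eq)
next
  case (While_step p s c t u t' v)
  note a = While_step.IH(1)[OF While_step.prems, of "While p c # cs"]
  then have b: "aiter k t' (While p c # cs, u) = (cs, v)" "heads_in k H v"
      "\<forall>i\<le>t'. heads_in k H (snd (aiter k i (While p c # cs, u)))"
      "\<forall>i<t'. fst (aiter k i (While p c # cs, u)) \<noteq> []"
    using While_step.IH(2)[of cs] by auto
  have mid: "aiter k i (c # While p c # cs, s) = aiter k (i - t) (While p c # cs, u)" if "t \<le> i" for i
    using a aiter_add[of k t "i - t" "(c # While p c # cs, s)"] that by simp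
  show ?case
  proof (intro conjI allI impI)
    show "aiter k (Suc (t + t')) (While p c # cs, s) = (cs, v)"
      using a b While_step.hyps(1) by (simp add: aiter_add)
    show "heads_in k H v" by fact
    show "heads_in k H (snd (aiter k i (While p c # cs, s)))" if "i \<le> Suc (t + t')" for i
    proof (cases i)
      case (Suc j)
      then show ?thesis using that a b(3) mid[of j] While_step.hyps(1) by (cases "t \<le> j") auto
    qed (use While_step.prems in simp)
    show "fst (aiter k i (While p c # cs, s)) \<noteq> []" if "i < Suc (t + t')" for i
    proof (cases i)
      case (Suc j)
      then show ?thesis using that a b(4) mid[of j] While_step.hyps(1) by (cases "t \<le> j") auto
    qed simp
  qed
qed

section \<open>Finite control and the compilation theorem\<close>

text \<open>The control states of the compiled machine are the stacks of pending commands.\<close>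

primrec pts :: "com \<Rightarrow> com list \<Rightarrow> com list set" where
  "pts (Do f) cs = {Do f # cs}"
| "pts (Seq a b) cs = insert (Seq a b # cs) (pts a (b # cs) \<union> pts b cs)"
| "pts (Cond p c d) cs = insert (Cond p c d # cs) (pts c cs \<union> pts d cs)"
| "pts (While p c) cs = insert (While p c # cs) (pts c (While p c # cs))"

lemma finite_pts: "finite (pts c cs)"
  by (induction c arbitrary: cs) auto

lemma pts_self: "c # cs \<in> pts c cs"
  by (cases c) auto

lemma pts_step: "x \<in> pts c cs \<Longrightarrow> fst (cstep r x) \<in> insert cs (pts c cs)"
proof (induction c arbitrary: cs)
  case (Seq a b)
  then show ?case using pts_self[of b cs] by (fastforce intro: pts_self)
next
  case (While p c)
  then show ?case by (fastforce intro: pts_self)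
next
  case (Cond p a b)
  have "fst (cstep r x) \<in> insert cs (pts a cs)" if "x \<in> pts a cs" using Cond that by blast
  moreover have "fst (cstep r x) \<in> insert cs (pts b cs)" if "x \<in> pts b cs" using Cond that by blast
  ultimately show ?case using Cond.prems pts_self[of a cs] pts_self[of b cs] by auto
qed (auto intro: pts_self)

lemma pts_wf:
  "x \<in> pts c cs \<Longrightarrow> wf_com k G c \<Longrightarrow> (\<forall>d \<in> set cs. wf_com k G d) \<Longrightarrow> \<forall>d \<in> set x. wf_com k G d"
proof (induction c arbitrary: cs)
  case (Seq a b)
  show ?case using Seq.prems Seq.IH(1)[of "b # cs"] Seq.IH(2)[of cs] by auto
next
  case (Cond p a b)
  show ?case using Cond.prems Cond.IH(1)[of cs] Cond.IH(2)[of cs] by auto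
next
  case (While p a)
  show ?case using While.prems While.IH[of "While p a # cs"] by auto
qed auto

lemma cstep_symbols:
  assumes "\<forall>d \<in> set cs. wf_com k G d" "\<forall>i. r i < G" "i < k"
  shows "fst (snd (cstep r cs) i) < G"
proof (cases "(r, cs)" rule: cstep.cases)
  case (2 r' f cs')
  then show ?thesis using assms by simp
qed (use assms in \<open>auto simp: idle_def\<close>)

definition init_st :: "nat list \<Rightarrow> st" where
  "init_st w i = (0, tape_of (if i = 0 then w else []))"

lemma map_init_st:
  assumes "0 < k"
  shows "map (init_st w) [0..<k] = (0, tape_of w) # replicate (k - 1) (0, tape_of [])"
proof -
  have "[0..<k] = 0 # [1..<k]" using assms by (simp add: upt_conv_Cons)
  moreover have "map (init_st w) [1..<k] = replicate (k - 1) (0, tape_of [])"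
    by (rule nth_equalityI) (auto simp: init_st_def)
  ultimately show ?thesis by (simp add: init_st_def)
qed

lemma map2_act_upd: "map2 act (map a [0..<k]) (map s [0..<k]) = map (upd k a s) [0..<k]"
  by (rule nth_equalityI) (auto simp: upd_def)

text \<open>The step after time \<open>t\<close> is the one in which the empty stack evaluates
  \<open>acc\<close> and enters a halting state. \<open>H 0\<close> covers the initial head
  positions, which no action has produced.\<close>

theorem compile:
  assumes k: "0 < k" and wf: "wf_com k G c" and G: "0 < G"
  obtains M where "wf_tm M" "num_symbols M = G"
    "\<And>w t s' H. exec k H c (init_st w) t s' \<Longrightarrow> H 0 \<Longrightarrow>
       config_at M w (Suc t) = (if acc (rd k s') then accept_state M else reject_state M, map s' [0..<k])"
    "\<And>w t s' H i. exec k H c (init_st w) t s' \<Longrightarrow> H 0 \<Longrightarrow>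
       \<forall>(h, _) \<in> set (snd (config_at M w i)). H h"
proof -
  define F where "F = insert [] (pts c [])"
  have finF: "finite F" by (simp add: F_def finite_pts)
  obtain e where e: "bij_betw e F {0..<card F}"
    using ex_bij_betw_finite_nat[OF finF] by blast
  \<comment> \<open>The states 0 and 1 are kept for acceptance and rejection.\<close>
  define code where "code x = e x + 2" for x
  define decd where "decd q = inv_into F e (q - 2)" for q
  have code: "code x < card F + 2" "code x \<ge> 2" "decd (code x) = x" if "x \<in> F" for x
    using e that by (auto simp: code_def decd_def bij_betw_def)
  have decd: "decd q \<in> F" if "2 \<le> q" "q < card F + 2" for q
  proof -
    have "q - 2 \<in> e ` F" using e that by (auto simp: bij_betw_def)
    then show ?thesis unfolding decd_def by (rule inv_into_into)
  qed
  define rl where "rl xs i = (if i < k then xs ! i else (0::nat))" for xs i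
  define tr where "tr q xs = (let r = rl xs in
     if q < 2 \<or> q \<ge> card F + 2 then (0, map (idle r) [0..<k])
     else if decd q = [] then (if acc r then 0 else 1, map (idle r) [0..<k])
     else (code (fst (cstep r (decd q))), map (snd (cstep r (decd q))) [0..<k]))" for q xs
  define M where "M = \<lparr>num_tapes = k, num_states = card F + 2, num_symbols = G,
    start_state = code [c], accept_state = 0, reject_state = 1, trans_fun = tr\<rparr>"
  have cF: "[c] \<in> F" using pts_self[of c "[]"] by (simp add: F_def)
  have stepF: "fst (cstep r x) \<in> F" if "x \<in> F" for x r
    using that pts_step[of x c "[]" r] by (auto simp: F_def)
  have "wf_tm M"
  proof -
    have "case tr q xs of (q', acts) \<Rightarrow> q' < card F + 2 \<and> length acts = k \<and> (\<forall>(s, d) \<in> set acts. s < G)"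
      if q: "q < card F + 2" and xs: "length xs = k" "set xs \<subseteq> {..<G}" for q xs
    proof -
      have rl: "\<forall>i. rl xs i < G" using xs G by (auto simp: rl_def subset_iff)
      consider "q < 2" | "q \<ge> 2" "decd q = []" | "q \<ge> 2" "decd q \<noteq> []" by linarith
      then show ?thesis
      proof cases
        case 3
        then have d: "decd q \<in> F" using decd q by simp
        have "\<forall>d \<in> set (decd q). wf_com k G d"
          using d 3 pts_wf[of "decd q" c "[]" k G] wf by (auto simp: F_def)
        then have "fst (snd (cstep (rl xs) (decd q)) i) < G" if "i < k" for i
          using cstep_symbols that rl by blast
        then have "\<forall>(s, d) \<in> set (map (snd (cstep (rl xs) (decd q))) [0..<k]). s < G"
          by (auto simp del: upt_Suc) (metis fst_conv)
        moreover have "tr q xs = (code (fst (cstep (rl xs) (decd q))), map (snd (cstep (rl xs) (decd q))) [0..<k])"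
          using 3 q by (simp add: tr_def Let_def)
        ultimately show ?thesis using code(1)[OF stepF[OF d]] by simp
      qed (use q rl in \<open>auto simp: tr_def Let_def idle_def\<close>)
    qed
    then show ?thesis using k code[OF cF] by (simp add: wf_tm_def M_def)
  qed
  define emb :: "com list \<times> st \<Rightarrow> config" where "emb = (\<lambda>(cs, s). (code cs, map s [0..<k]))"
  have rl_map: "rl (map (\<lambda>(h, t). t h) (map s [0..<k])) = rd k s" for s
    by (rule ext) (auto simp: rl_def rd_def split: prod.splits)
  have sim: "step M (emb x) = emb (astep k x)" if "fst x \<in> F" "fst x \<noteq> []" for x
  proof -
    obtain cs s where x: "x = (cs, s)" by (cases x)
    show ?thesis
      using that code[of cs] rl_map[of s] k
      by (simp add: x emb_def M_def halting_state_def tr_def Let_def astep_def map2_act_upd)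
  qed
  have halt: "step M (emb ([], s)) = (if acc (rd k s) then 0 else 1, map s [0..<k])" for s
    using code[of "[]"] rl_map[of s] k map2_act_upd[of "idle (rd k s)" k s]
    by (simp add: F_def emb_def M_def halting_state_def tr_def Let_def)
  have stay: "(step M ^^ n) (q, ts) = (q, ts)" if "q < 2" for q ts n
    by (induction n) (use that in \<open>auto simp: M_def halting_state_def\<close>)
  have init: "init_config M w = emb ([c], init_st w)" for w
    using map_init_st[OF k, of w] by (simp add: init_config_def emb_def M_def)
  have F_iter: "fst (aiter k i ([c], s)) \<in> F" for i s
  proof -
    have "fst x \<in> F \<Longrightarrow> fst (aiter k i x) \<in> F" for x
      by (induction i arbitrary: x) (auto simp: astep_def stepF split: prod.splits)
    then show ?thesis using cF by simp
  qed
  have run: "(step M ^^ i) (emb ([c], s)) = emb (aiter k i ([c], s))"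
    if "\<forall>j<i. fst (aiter k j ([c], s)) \<noteq> []" for i s
    using that
  proof (induction i)
    case (Suc i)
    have "aiter k (Suc i) ([c], s) = astep k (aiter k i ([c], s))"
      using aiter_add[of k i 1 "([c], s)"] by simp
    then show ?case using Suc sim[OF F_iter, of i s] by simp
  qed simp
  have in_map: "heads_in k P s \<Longrightarrow> \<forall>(h, _) \<in> set (map s [0..<k]). P h" for P s
    unfolding heads_in_def by (auto simp: case_prod_beta)
  show thesis
  proof (rule that[of M])
    show "wf_tm M" by fact
    show "num_symbols M = G" by (simp add: M_def)
    fix w t s' H assume ex: "exec k H c (init_st w) t s'" and H: "H (0::nat)"
    have wi: "heads_in k H (init_st w)" using H by (simp add: heads_in_def init_st_def)
    note x = exec_aiter[OF ex wi, of "[]"]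
    have t: "config_at M w t = emb ([], s')"
      using run[of t "init_st w"] x by (simp add: config_at_def init)
    have t': "config_at M w (Suc t) = (if acc (rd k s') then 0 else 1, map s' [0..<k])"
      using t halt by (simp add: config_at_def)
    then show "config_at M w (Suc t) =
        (if acc (rd k s') then accept_state M else reject_state M, map s' [0..<k])"
      by (simp add: M_def)
    show "\<forall>(h, _) \<in> set (snd (config_at M w i)). H h" for i
    proof (cases "i \<le> t")
      case True
      have "config_at M w i = emb (aiter k i ([c], init_st w))"
        using run[of i "init_st w"] x True by (simp add: config_at_def init)
      moreover have "heads_in k H (snd (aiter k i ([c], init_st w)))" using x True by simp
      ultimately show ?thesis using in_map[of H "snd (aiter k i ([c], init_st w))"]
        unfolding emb_def case_prod_beta by (metis snd_conv)
    next
      case False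
      then obtain n where n: "i = n + Suc t" by (metis add.commute le_iff_add not_less_eq_eq)
      have "config_at M w i = (step M ^^ n) (config_at M w (Suc t))"
        unfolding n config_at_def funpow_add by (simp only: o_apply)
      also have "\<dots> = config_at M w (Suc t)" unfolding t' by (rule stay) simp
      finally show ?thesis using t' in_map[of H s'] x by (metis snd_conv)
    qed
  qed
qed

section \<open>Satisfiability as a game\<close>

definition build :: "nat \<Rightarrow> fm list \<Rightarrow> fm list option" where
  "build a fs =
     (if a = 0 then Some (Tru # fs)
      else if a = 1 then Some (Fls # fs)
      else case fs of [] \<Rightarrow> None | f # gs \<Rightarrow>
        (if a = 2 then Some (Neg f # gs)
         else if a = 5 then Some (Box f # gs)
         else if a = 6 then Some (Dia f # gs)
         else case gs of [] \<Rightarrow> None | g # hs \<Rightarrow>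
           (if a = 3 then Some (Conj f g # hs)
            else if a = 4 then Some (Disj f g # hs)
            else None)))"

primrec parse :: "nat list \<Rightarrow> fm list option" where
  "parse [] = Some []"
| "parse (a # xs) = Option.bind (parse xs) (build a)"

lemma parse_encode: "parse xs = Some fs \<Longrightarrow> parse (encode \<phi> @ xs) = Some (\<phi> # fs)"
  by (induction \<phi> arbitrary: xs fs) (auto simp: build_def)

lemma build_Some:
  assumes "build a fs = Some gs"
  shows "concat (map encode gs) = a # concat (map encode fs)"
  using assms by (auto simp: build_def split: if_splits list.splits)

lemma parse_Some: "parse xs = Some fs \<Longrightarrow> concat (map encode fs) = xs"
proof (induction xs arbitrary: fs)
  case (Cons a xs)
  then show ?case using build_Some by (fastforce split: bind_splits)
qed simp

lemma parse_single: "parse xs = Some [\<phi>] \<longleftrightarrow> xs = encode \<phi>"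
  using parse_encode[of "[]" "[]" \<phi>] parse_Some[of xs "[\<phi>]"] by auto

lemma parse_drop: "parse xs \<noteq> None \<Longrightarrow> parse (drop i xs) \<noteq> None"
proof (induction xs arbitrary: i)
  case (Cons a xs)
  then show ?case by (cases i) (auto split: bind_splits)
qed simp

section \<open>Truth values at a world from its modal bits\<close>

definition modal :: "nat \<Rightarrow> bool" where
  "modal a \<longleftrightarrow> a = 5 \<or> a = 6"

definition op_val :: "nat \<Rightarrow> bool \<Rightarrow> bool list \<Rightarrow> bool list" where
  "op_val a b st =
     (if a = 0 then True # st
      else if a = 1 then False # st
      else if a = 2 then (\<not> hd st) # tl st
      else if a = 3 then (hd st \<and> hd (tl st)) # tl (tl st)
      else if a = 4 then (hd st \<or> hd (tl st)) # tl (tl st)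
      else if a = 5 then (\<not> b) # tl st
      else b # tl st)"

text \<open>A bit at a modal position claims that some successor falsifies (Box) or satisfies (Dia) the argument.\<close>

fun ev :: "nat list \<Rightarrow> bool list \<Rightarrow> bool list" where
  "ev (a # xs) (b # bs) = op_val a b (ev xs bs)"
| "ev _ _ = []"

text \<open>One condition serves both modalities: the argument has to be true for a diamond (letter
  6) and false for a box (letter 5).\<close>

definition wit :: "('w \<times> 'w) set \<Rightarrow> 'w \<Rightarrow> nat list \<Rightarrow> nat \<Rightarrow> bool" where
  "wit R w xs j \<longleftrightarrow> (\<exists>f fs. parse (drop (Suc j) xs) = Some (f # fs) \<and> holds R w f = (xs ! j = 6))"

text \<open>Every position, however deeply nested, is evaluated at the one world \<open>w\<close>. A
  modal operator is settled by its bit alone, so no truth values at successors have to be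
  computed.\<close>

lemma ev_correct:
  assumes "parse xs = Some fs" "length bs = length xs"
    and "\<And>j. j < length xs \<Longrightarrow> modal (xs ! j) \<Longrightarrow> bs ! j = (\<exists>c. (w, c) \<in> R \<and> wit R c xs j)"
  shows "ev xs bs = map (holds R w) fs"
  using assms
proof (induction xs arbitrary: fs bs)
  case (Cons a xs)
  obtain b bs' where bs: "bs = b # bs'" using Cons.prems(2) by (cases bs) auto
  obtain gs where gs: "parse xs = Some gs" "build a gs = Some fs"
    using Cons.prems(1) by (auto split: bind_splits)
  have IH: "ev xs bs' = map (holds R w) gs"
  proof (rule Cons.IH[OF gs(1)])
    show "length bs' = length xs" using Cons.prems(2) bs by simp
    show "bs' ! j = (\<exists>c. (w, c) \<in> R \<and> wit R c xs j)" if "j < length xs" "modal (xs ! j)" for j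
      using Cons.prems(3)[of "Suc j"] that bs by (simp add: wit_def)
  qed
  have b: "b = (\<exists>c. (w, c) \<in> R \<and> (\<exists>f hs. gs = f # hs \<and> holds R c f = (a = 6)))" if "modal a"
    using Cons.prems(3)[of 0] that bs gs(1) by (simp add: wit_def)
  show ?case using gs(2) IH b
    by (auto simp: bs op_val_def modal_def build_def split: if_splits list.splits)
qed simp

text \<open>The counterpart of \<open>wit\<close> computed from guessed bits: when the letters to
  the right of \<open>j\<close> have been read, the argument of position \<open>j\<close> is the
  formula completed last, hence the top of the stack.\<close>

definition hit :: "nat list \<Rightarrow> bool list \<Rightarrow> nat \<Rightarrow> bool" where
  "hit u e j \<longleftrightarrow> hd (ev (drop (Suc j) u) (drop (Suc j) e)) = (u ! j = 6)"

text \<open>Information passed to a successor world: 2 = no constraint, 3 = hit forbidden, 4 = hit required.\<close>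

definition chk_at :: "nat list \<Rightarrow> nat list \<Rightarrow> bool list \<Rightarrow> nat \<Rightarrow> bool" where
  "chk_at u p e j \<longleftrightarrow> (modal (u ! j) \<longrightarrow> (p ! j = 4 \<longrightarrow> hit u e j) \<and> (p ! j = 3 \<longrightarrow> \<not> hit u e j))"

definition chk :: "nat list \<Rightarrow> nat list \<Rightarrow> bool list \<Rightarrow> bool" where
  "chk u p e \<longleftrightarrow> (\<forall>j < length u. chk_at u p e j)"

definition chosen :: "bool list \<Rightarrow> bool list \<Rightarrow> nat \<Rightarrow> bool" where
  "chosen e v j \<longleftrightarrow> e ! j \<and> v ! j"

text \<open>Only the first chosen position becomes a requirement. The other claimed positions are
  left to other successors, whereas an unclaimed position is forbidden to every successor.\<close>

definition mark :: "bool list \<Rightarrow> bool list \<Rightarrow> nat list" where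
  "mark e v = map (\<lambda>j. if \<not> e ! j then 3
      else if chosen e v j \<and> (\<forall>i<j. \<not> chosen e v i) then 4 else 2) [0..<length e]"

text \<open>A round in which nothing is chosen is won by the first player, and running out of rounds
  is a loss for him; hence a world with \<open>k\<close> levels below it needs \<open>Suc k\<close>
  rounds.\<close>

fun wins :: "nat list \<Rightarrow> nat \<Rightarrow> nat list \<Rightarrow> bool" where
  "wins u 0 p = False"
| "wins u (Suc k) p = (\<exists>e. length e = length u \<and> chk u p e \<and>
     (\<forall>v. length v = length u \<longrightarrow> (\<exists>j < length u. chosen e v j) \<longrightarrow> wins u k (mark e v)))"

definition meets :: "('w \<times> 'w) set \<Rightarrow> 'w \<Rightarrow> nat list \<Rightarrow> nat list \<Rightarrow> bool" where
  "meets R w u p \<longleftrightarrow> (\<forall>j < length u. modal (u ! j) \<longrightarrow>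
     (p ! j = 4 \<longrightarrow> wit R w u j) \<and> (p ! j = 3 \<longrightarrow> \<not> wit R w u j))"

lemma build_None_modal: "modal a \<Longrightarrow> build a fs \<noteq> None \<Longrightarrow> fs \<noteq> []"
  by (auto simp: modal_def build_def)

lemma parse_arg:
  assumes "parse u \<noteq> None" "j < length u" "modal (u ! j)"
  obtains f fs where "parse (drop (Suc j) u) = Some (f # fs)"
proof -
  have "parse (u ! j # drop (Suc j) u) \<noteq> None"
    using parse_drop[OF assms(1), of j] assms(2) by (simp add: Cons_nth_drop_Suc)
  then obtain gs where gs: "parse (drop (Suc j) u) = Some gs" "build (u ! j) gs \<noteq> None"
    by (auto split: bind_splits)
  then obtain f fs where "gs = f # fs" using build_None_modal[OF assms(3)] by (meson neq_Nil_conv)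
  then show thesis using that gs(1) by simp
qed

lemma hit_wit:
  assumes u: "parse u \<noteq> None" "length e = length u" "j < length u" "modal (u ! j)"
    and e: "\<And>j. j < length u \<Longrightarrow> modal (u ! j) \<Longrightarrow> e ! j = (\<exists>c. (w, c) \<in> R \<and> wit R c u j)"
  shows "hit u e j = wit R w u j"
proof -
  obtain f fs where f: "parse (drop (Suc j) u) = Some (f # fs)" using parse_arg[OF u(1,3,4)] .
  have "ev (drop (Suc j) u) (drop (Suc j) e) = map (holds R w) (f # fs)"
  proof (rule ev_correct[OF f])
    show "length (drop (Suc j) e) = length (drop (Suc j) u)" using u by simp
    show "drop (Suc j) e ! i = (\<exists>c. (w, c) \<in> R \<and> wit R c (drop (Suc j) u) i)"
      if "i < length (drop (Suc j) u)" "modal (drop (Suc j) u ! i)" for i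
      using that e[of "Suc j + i"] u by (simp add: wit_def add.commute)
  qed
  then show ?thesis using f by (simp add: hit_def wit_def)
qed

section \<open>Winning strategies and models\<close>

text \<open>A single frame contains all finite trees, so worlds obtained from different parts of a
  strategy live in the same model and can be joined under a new node.\<close>

datatype tree = Node "tree list"

definition child :: "(tree \<times> tree) set" where
  "child = {(Node ts, t) | ts t. t \<in> set ts}"

text \<open>Each claimed position receives a child of its own, namely the one obtained when the
  opponent chooses that position alone. The prohibitions at unclaimed positions are shared by all
  children, so the guessed bits are exactly the true ones.\<close>

lemma wins_sound:
  assumes u: "parse u \<noteq> None"
  shows "wins u k p \<Longrightarrow> \<exists>t. meets child t u p"
proof (induction k arbitrary: p)
  case (Suc k)
  then obtain e where e: "length e = length u" "chk u p e"
    and win: "\<And>v. length v = length u \<Longrightarrow> \<exists>j < length u. chosen e v j \<Longrightarrow> wins u k (mark e v)"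
    by auto
  define v where "v i = map (\<lambda>j. j = i) [0..<length u]" for i
  have mark_v: "mark e (v i) ! j = (if \<not> e ! j then 3 else if i = j then 4 else 2)"
    if "i < length u" "e ! i" "j < length u" for i j
    using that e(1) by (auto simp: mark_def chosen_def v_def)
  have "\<exists>t. meets child t u (mark e (v i))" if "i < length u" "e ! i" for i
    by (rule Suc.IH, rule win) (use that in \<open>auto simp: v_def chosen_def\<close>)
  then obtain T where T: "\<And>i. i < length u \<Longrightarrow> e ! i \<Longrightarrow> meets child (T i) u (mark e (v i))"
    by metis
  define t where "t = Node (map T (filter (\<lambda>i. e ! i) [0..<length u]))"
  have ch: "(t, c) \<in> child \<longleftrightarrow> (\<exists>i < length u. e ! i \<and> c = T i)" for c
    by (auto simp: child_def t_def)
  have bits: "e ! j = (\<exists>c. (t, c) \<in> child \<and> wit child c u j)" if "j < length u" "modal (u ! j)" for j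
  proof
    assume "e ! j"
    then have "wit child (T j) u j"
      using T[of j] that mark_v[of j j] by (simp add: meets_def)
    then show "\<exists>c. (t, c) \<in> child \<and> wit child c u j" using ch that \<open>e ! j\<close> by blast
  next
    assume "\<exists>c. (t, c) \<in> child \<and> wit child c u j"
    then obtain i where i: "i < length u" "e ! i" "wit child (T i) u j" by (auto simp: ch)
    have "mark e (v i) ! j \<noteq> 3" using T[OF i(1,2)] that i(3) unfolding meets_def by blast
    then show "e ! j" using mark_v[OF i(1,2) that(1)] by presburger
  qed
  have "hit u e j = wit child t u j" if "j < length u" "modal (u ! j)" for j
    by (rule hit_wit[OF u e(1) that bits])
  then show ?case using e(2) unfolding chk_def chk_at_def meets_def by blast
qed simp

text \<open>A truncated unfolding: worlds are paired with the number of steps that may still be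
  made, so no path from rank \<open>k\<close> is longer than \<open>k\<close>.\<close>

definition ranked :: "('w \<times> 'w) set \<Rightarrow> ((nat \<times> 'w) \<times> (nat \<times> 'w)) set" where
  "ranked R = {((Suc k, x), (k, y)) | k x y. (x, y) \<in> R}"

text \<open>The first player names the true bits of the current world and answers a choice by moving
  to a successor that witnesses it. The rank drops in every round, which bounds the play.\<close>

lemma wins_complete:
  assumes u: "parse u \<noteq> None"
  shows "meets (ranked R) (k, w) u p \<Longrightarrow> wins u (Suc k) p"
proof (induction k arbitrary: w p)
  case 0
  define e where "e = map (\<lambda>j. False) [0..<length u]"
  have e: "length e = length u" "\<And>j. j < length u \<Longrightarrow> \<not> e ! j" by (auto simp: e_def)
  have "hit u e j = wit (ranked R) (0, w) u j" if "j < length u" "modal (u ! j)" for j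
    by (rule hit_wit[OF u e(1) that]) (use e(2) in \<open>auto simp: ranked_def\<close>)
  then have "chk u p e" using 0 unfolding chk_def chk_at_def meets_def by blast
  then show ?case using e by (auto simp: chosen_def)
next
  case (Suc k)
  define e where "e = map (\<lambda>j. \<exists>c. ((Suc k, w), c) \<in> ranked R \<and> wit (ranked R) c u j) [0..<length u]"
  have e: "length e = length u"
    "\<And>j. j < length u \<Longrightarrow> e ! j = (\<exists>c. ((Suc k, w), c) \<in> ranked R \<and> wit (ranked R) c u j)"
    by (auto simp: e_def)
  have "hit u e j = wit (ranked R) (Suc k, w) u j" if "j < length u" "modal (u ! j)" for j
    by (rule hit_wit[OF u e(1) that]) (use e(2) in auto)
  then have "chk u p e" using Suc.prems unfolding chk_def chk_at_def meets_def by blast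
  moreover have "wins u (Suc k) (mark e v)" if ex: "\<exists>j < length u. chosen e v j" for v
  proof -
    obtain i where i: "i < length u" "chosen e v i" using ex by blast
    define j where "j = (LEAST j. chosen e v j)"
    have j: "chosen e v j" "\<And>i. i < j \<Longrightarrow> \<not> chosen e v i"
      unfolding j_def using LeastI[of "chosen e v", OF i(2)] not_less_Least by blast+
    have jl: "j < length u" using Least_le[of "chosen e v", OF i(2)] i(1) by (simp add: j_def)
    have "e ! j" using j(1) by (simp add: chosen_def)
    then obtain c where c: "((Suc k, w), c) \<in> ranked R" "wit (ranked R) c u j"
      using e(2)[OF jl] by blast
    obtain y where y: "c = (k, y)" using c(1) by (auto simp: ranked_def)
    have "meets (ranked R) c u (mark e v)"
    proof -
      have "wit (ranked R) c u i" if "i < length u" "mark e v ! i = 4" for i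
      proof -
        have "chosen e v i" "\<forall>i'<i. \<not> chosen e v i'" using that e(1) by (auto simp: mark_def split: if_splits)
        then have "i = j" using j by (metis linorder_neqE_nat)
        then show ?thesis using c by simp
      qed
      moreover have "\<not> wit (ranked R) c u i" if "i < length u" "mark e v ! i = 3" for i
      proof -
        have "\<not> e ! i" using that e(1) by (auto simp: mark_def split: if_splits)
        then show ?thesis using e(2) that c by blast
      qed
      ultimately show ?thesis by (auto simp: meets_def)
    qed
    then show ?thesis using Suc.IH y by blast
  qed
  ultimately show ?case using e(1) by auto
qed

primrec mdepth :: "fm \<Rightarrow> nat" where
  "mdepth Tru = 0"
| "mdepth Fls = 0"
| "mdepth (Neg \<phi>) = mdepth \<phi>"
| "mdepth (Conj \<phi> \<psi>) = max (mdepth \<phi>) (mdepth \<psi>)"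
| "mdepth (Disj \<phi> \<psi>) = max (mdepth \<phi>) (mdepth \<psi>)"
| "mdepth (Box \<phi>) = Suc (mdepth \<phi>)"
| "mdepth (Dia \<phi>) = Suc (mdepth \<phi>)"

lemma mdepth_encode: "mdepth \<phi> < length (encode \<phi>)"
  by (induction \<phi>) auto

text \<open>A formula of modal depth at most \<open>k\<close> cannot notice that paths end after
  \<open>k\<close> steps.\<close>

lemma holds_ranked: "mdepth \<phi> \<le> k \<Longrightarrow> holds (ranked R) (k, w) \<phi> = holds R w \<phi>"
proof (induction \<phi> arbitrary: k w)
  case (Box \<phi>)
  then obtain l where "k = Suc l" "mdepth \<phi> \<le> l" by (cases k) auto
  then show ?case using Box.IH by (auto simp: ranked_def)
next
  case (Dia \<phi>)
  then obtain l where "k = Suc l" "mdepth \<phi> \<le> l" by (cases k) auto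
  then show ?case using Dia.IH by (auto simp: ranked_def)
qed auto

text \<open>The game is played on \<open>6 # encode \<phi>\<close>. A hit required at the leading
  diamond means that the root itself satisfies \<open>\<phi>\<close>, so the initial demand has the
  same form as the constraints of later rounds.\<close>

definition root_info :: "nat list \<Rightarrow> nat list" where
  "root_info u = 4 # replicate (length u - 1) 2"

lemma meets_root:
  assumes "u = 6 # encode \<phi>"
  shows "meets R w u (root_info u) \<longleftrightarrow> holds R w \<phi>"
proof -
  have p: "parse (encode \<phi>) = Some [\<phi>]" by (simp add: parse_single)
  have r: "root_info u ! j = (if j = 0 then 4 else 2)" if "j < length u" for j
    using that assms by (cases j) (auto simp: root_info_def)
  show ?thesis
    unfolding meets_def wit_def using assms r p by (auto simp: modal_def)
qed

text \<open>The modal depth of \<open>\<phi>\<close> is less than the length of its encoding. Rank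
  \<open>length (encode \<phi>)\<close> is therefore enough, and \<open>length u\<close> is one more
  than this rank.\<close>

theorem wins_iff_satisfiable:
  assumes inf: "infinite (UNIV :: 'w set)" and u: "u = 6 # encode \<phi>"
  shows "wins u (length u) (root_info u) \<longleftrightarrow> satisfiable TYPE('w) \<phi>"
proof -
  have pu: "parse u \<noteq> None" using parse_single[of "encode \<phi>" \<phi>] u by (simp add: build_def)
  show ?thesis
  proof
    assume "wins u (length u) (root_info u)"
    then obtain t where "meets child t u (root_info u)" using wins_sound[OF pu] by blast
    then have "holds child t \<phi>" by (simp only: meets_root[OF u])
    then have "\<exists>w \<in> UNIV. holds child w \<phi>" by blast
    then have "satisfiable TYPE(tree) \<phi>"
      unfolding satisfiable_def by (metis UNIV_Times_UNIV empty_not_UNIV top_greatest)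
    then show "satisfiable TYPE('w) \<phi>" by (rule satisfiable_infinite_type[OF inf])
  next
    assume "satisfiable TYPE('w) \<phi>"
    then obtain R and w :: 'w where "holds R w \<phi>" by (auto simp: satisfiable_def)
    then have "holds (ranked R) (length (encode \<phi>), w) \<phi>"
      by (simp add: holds_ranked mdepth_encode less_imp_le)
    then have "meets (ranked R) (length (encode \<phi>), w) u (root_info u)"
      by (simp only: meets_root[OF u])
    then show "wins u (length u) (root_info u)"
      using wins_complete[OF pu] u by (metis length_Cons)
  qed
qed

section \<open>Plays as assignments to a quantified Boolean formula\<close>

text \<open>The truth value of a quantified Boolean formula with matrix \<open>P\<close>; in the
  prefix \<open>qs\<close>, \<open>True\<close> stands for an existential and \<open>False\<close>
  for a universal quantifier.\<close>

fun gval :: "bool list \<Rightarrow> (bool list \<Rightarrow> bool) \<Rightarrow> bool" where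
  "gval [] P = P []"
| "gval (q # qs) P =
     (if q then gval qs (\<lambda>z. P (False # z)) \<or> gval qs (\<lambda>z. P (True # z))
      else gval qs (\<lambda>z. P (False # z)) \<and> gval qs (\<lambda>z. P (True # z)))"

lemma gval_const: "gval qs (\<lambda>_. c) = c"
  by (induction qs) auto

lemma length_Suc_bool: "(\<exists>x. length x = Suc n \<and> P x) \<longleftrightarrow>
    (\<exists>x. length x = n \<and> P (False # x)) \<or> (\<exists>x. length x = n \<and> P (True # x))"
  by (metis (full_types) length_Suc_conv)

lemma gval_exists: "gval (replicate n True @ qs) P \<longleftrightarrow> (\<exists>x. length x = n \<and> gval qs (\<lambda>z. P (x @ z)))"
  by (induction n arbitrary: P) (auto simp: length_Suc_bool)

lemma gval_forall: "gval (replicate n False @ qs) P \<longleftrightarrow> (\<forall>x. length x = n \<longrightarrow> gval qs (\<lambda>z. P (x @ z)))"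
proof (induction n arbitrary: P)
  case (Suc n)
  show ?case using length_Suc_bool[of n "\<lambda>x. \<not> gval qs (\<lambda>z. P (x @ z))"] by (auto simp: Suc)
qed simp

primrec quants :: "nat \<Rightarrow> nat \<Rightarrow> bool list" where
  "quants n 0 = []"
| "quants n (Suc k) = replicate n True @ replicate n False @ quants n k"

text \<open>Outcomes: 2 = undecided, 3 = the existential player has won, 4 = he has lost.\<close>

definition judge :: "nat list \<Rightarrow> nat \<Rightarrow> nat list \<Rightarrow> bool list \<Rightarrow> bool list \<Rightarrow> nat" where
  "judge u r p e v =
     (if r \<noteq> 2 then r else if \<not> chk u p e then 4
      else if \<exists>j < length u. chosen e v j then 2 else 3)"

text \<open>The claims of the first player are stored in reverse order, because the formula is
  evaluated from right to left while the string of moves is read from left to right. The choices of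
  the opponent are read along with the formula from left to right.\<close>

fun outcome :: "nat list \<Rightarrow> nat \<Rightarrow> nat \<Rightarrow> nat list \<Rightarrow> bool list \<Rightarrow> nat" where
  "outcome u 0 r p bs = r"
| "outcome u (Suc k) r p bs =
     (let n = length u; e = rev (take n bs); v = take n (drop n bs)
      in outcome u k (judge u r p e v) (mark e v) (drop (2 * n) bs))"

lemma outcome_decided: "r \<noteq> 2 \<Longrightarrow> outcome u k r p bs = r"
  by (induction k arbitrary: p bs) (auto simp: judge_def Let_def)

text \<open>Once a play is decided, the quantifiers over its remaining moves collapse. A play still
  undecided at the end does not count as won, in accordance with \<open>wins u 0 p\<close>.\<close>

lemma gval_outcome: "gval (quants (length u) k) (\<lambda>bs. outcome u k 2 p bs = 3) = wins u k p"
proof (induction k arbitrary: p)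
  case (Suc k)
  let ?n = "length u"
  have *: "gval (quants ?n k) (\<lambda>z. outcome u (Suc k) 2 p (x @ v @ z) = 3) \<longleftrightarrow>
      chk u p (rev x) \<and> ((\<exists>j < ?n. chosen (rev x) v j) \<longrightarrow> wins u k (mark (rev x) v))"
    if "length x = ?n" "length v = ?n" for x v
  proof -
    have eq: "outcome u (Suc k) 2 p (x @ v @ z) = outcome u k (judge u 2 p (rev x) v) (mark (rev x) v) z" for z
      using that by (simp add: Let_def)
    show ?thesis unfolding eq
      using Suc.IH[of "mark (rev x) v"] by (auto simp: judge_def outcome_decided gval_const)
  qed
  have "gval (quants ?n (Suc k)) (\<lambda>bs. outcome u (Suc k) 2 p bs = 3) \<longleftrightarrow>
      (\<exists>x. length x = ?n \<and> (\<forall>v. length v = ?n \<longrightarrow>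
         chk u p (rev x) \<and> ((\<exists>j < ?n. chosen (rev x) v j) \<longrightarrow> wins u k (mark (rev x) v))))"
    using * by (simp add: gval_exists gval_forall del: outcome.simps cong: conj_cong)
  also have "\<dots> \<longleftrightarrow> (\<exists>x. length (rev x) = ?n \<and> chk u p (rev x) \<and> (\<forall>v. length v = ?n \<longrightarrow>
         (\<exists>j < ?n. chosen (rev x) v j) \<longrightarrow> wins u k (mark (rev x) v)))"
    using Ex_list_of_length[of ?n] by auto
  also have "\<dots> \<longleftrightarrow> wins u (Suc k) p"
    unfolding wins.simps by (metis rev_rev_ident)
  finally show ?case .
qed simp

section \<open>Deciding satisfiability in polynomial space\<close>

text \<open>The running time is quantified away: a decision in polynomial space needs termination
  and the bound on the heads only.\<close>

definition wp :: "nat \<Rightarrow> (nat \<Rightarrow> bool) \<Rightarrow> com \<Rightarrow> st \<Rightarrow> (st \<Rightarrow> bool) \<Rightarrow> bool" where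
  "wp k H c s Q \<longleftrightarrow> (\<exists>t s'. exec k H c s t s' \<and> Q s')"

inductive_cases exec_DoE: "exec k H (Do f) s t s'"
inductive_cases exec_SeqE: "exec k H (Seq a b) s t s'"
inductive_cases exec_CondE: "exec k H (Cond p c d) s t s'"

lemma wp_Do: "wp k H (Do f) s Q \<longleftrightarrow>
    heads_in k H (upd k (f (rd k s)) s) \<and> Q (upd k (f (rd k s)) s)"
  unfolding wp_def heads_in_def by (auto intro: exec.Do elim!: exec_DoE)

lemma wp_Seq: "wp k H (Seq a b) s Q \<longleftrightarrow> wp k H a s (\<lambda>u. wp k H b u Q)"
  unfolding wp_def by (blast intro: exec.Seq elim!: exec_SeqE)

lemma wp_Cond: "wp k H (Cond p c d) s Q \<longleftrightarrow> wp k H (if p (rd k s) then c else d) s Q"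
  unfolding wp_def by (blast intro: exec.Cond elim!: exec_CondE)

lemma wp_mono: "wp k H c s Q \<Longrightarrow> (\<And>u. Q u \<Longrightarrow> Q' u) \<Longrightarrow> wp k H c s Q'"
  unfolding wp_def by blast

lemma wp_While_end: "\<not> p (rd k s) \<Longrightarrow> Q s \<Longrightarrow> wp k H (While p c) s Q"
  unfolding wp_def by (blast intro: exec.While_end)

lemma wp_While_step: "p (rd k s) \<Longrightarrow> wp k H c s (\<lambda>u. wp k H (While p c) u Q) \<Longrightarrow> wp k H (While p c) s Q"
  unfolding wp_def by (blast intro: exec.While_step)

text \<open>For the loops whose length depends on the data, \<open>seek\<close> and
  \<open>search\<close>. The other loops run a number of times known in advance.\<close>

lemma wp_While_wf:
  assumes "wf r" "I s"
    and step: "\<And>u. I u \<Longrightarrow> p (rd k u) \<Longrightarrow> wp k H c u (\<lambda>v. I v \<and> (v, u) \<in> r)"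
    and fin: "\<And>u. I u \<Longrightarrow> \<not> p (rd k u) \<Longrightarrow> Q u"
  shows "wp k H (While p c) s Q"
  using assms(1,2)
proof (induction s rule: wf_induct_rule)
  case (less s)
  show ?case
  proof (cases "p (rd k s)")
    case True
    show ?thesis
      by (rule wp_While_step, rule True, rule wp_mono[OF step[OF less.prems True]]) (use less.IH in blast)
  next
    case False
    then show ?thesis by (rule wp_While_end) (rule fin[OF less.prems False])
  qed
qed

lemma wp_While_count:
  assumes "I 0 s"
    and step: "\<And>i u. i < n \<Longrightarrow> I i u \<Longrightarrow> p (rd k u) \<and> wp k H c u (I (Suc i))"
    and fin: "\<And>u. I n u \<Longrightarrow> \<not> p (rd k u) \<and> Q u"
  shows "wp k H (While p c) s Q"
proof -
  have "I i u \<Longrightarrow> i \<le> n \<Longrightarrow> wp k H (While p c) u Q" for i u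
  proof (induction "n - i" arbitrary: i u)
    case 0
    then show ?case using fin[of u] by (auto intro: wp_While_end)
  next
    case (Suc d)
    then have i: "i < n" by simp
    have "wp k H (While p c) v Q" if "I (Suc i) v" for v
      using Suc.hyps(1)[of "Suc i" v] Suc.hyps(2) that i by simp
    then show ?case
      using step[OF i Suc.prems(1)] by (blast intro: wp_While_step wp_mono)
  qed
  then show ?thesis using assms(1) by blast
qed

section \<open>Seven-tape states and registers\<close>

text \<open>
  The tapes of the decision procedure are 0: input, later a counter of rounds; 1: the formula; 2: the
  constraints on the current world, cell by cell below the formula; 3: the string of moves; 4: the stack of
  truth values; 5, 6: registers, held in cell 0.  Truth values are the symbols 2 and 3, and moves are 2 and 3
  for the first player, 4 and 5 for the opponent.
\<close>

definition st7 :: "tape \<Rightarrow> tape \<Rightarrow> tape \<Rightarrow> tape \<Rightarrow> tape \<Rightarrow> tape \<Rightarrow> tape \<Rightarrow> st" where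
  "st7 a b c d e f g = (\<lambda>i. (0, tape_of []))(0 := a, 1 := b, 2 := c, 3 := d, 4 := e, 5 := f, 6 := g)"

lemma upd_st7: "upd 7 a (st7 x0 x1 x2 x3 x4 x5 x6) =
    st7 (act (a 0) x0) (act (a 1) x1) (act (a 2) x2) (act (a 3) x3) (act (a 4) x4) (act (a 5) x5) (act (a 6) x6)"
proof
  fix i :: nat
  have "i \<in> {0, 1, 2, 3, 4, 5, 6} \<or> 7 \<le> i" by auto
  then show "upd 7 a (st7 x0 x1 x2 x3 x4 x5 x6) i =
    st7 (act (a 0) x0) (act (a 1) x1) (act (a 2) x2) (act (a 3) x3) (act (a 4) x4) (act (a 5) x5) (act (a 6) x6) i"
    by (auto simp: upd_def st7_def)
qed

lemma rd_st7: "rd 7 (st7 x0 x1 x2 x3 x4 x5 x6) =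
    (\<lambda>i. 0)(0 := snd x0 (fst x0), 1 := snd x1 (fst x1), 2 := snd x2 (fst x2), 3 := snd x3 (fst x3),
      4 := snd x4 (fst x4), 5 := snd x5 (fst x5), 6 := snd x6 (fst x6))"
proof
  fix i :: nat
  have "i \<in> {0, 1, 2, 3, 4, 5, 6} \<or> 7 \<le> i" by auto
  then show "rd 7 (st7 x0 x1 x2 x3 x4 x5 x6) i = ((\<lambda>i. 0)(0 := snd x0 (fst x0), 1 := snd x1 (fst x1),
      2 := snd x2 (fst x2), 3 := snd x3 (fst x3), 4 := snd x4 (fst x4), 5 := snd x5 (fst x5),
      6 := snd x6 (fst x6))) i"
    by (auto simp: rd_def st7_def)
qed

lemma heads_in_st7: "heads_in 7 H (st7 x0 x1 x2 x3 x4 x5 x6) \<longleftrightarrow>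
    H (fst x0) \<and> H (fst x1) \<and> H (fst x2) \<and> H (fst x3) \<and> H (fst x4) \<and> H (fst x5) \<and> H (fst x6)"
proof -
  have "i < 7 \<longleftrightarrow> i \<in> {0, 1, 2, 3, 4, 5, 6}" for i :: nat by auto
  then show ?thesis by (auto simp: heads_in_def st7_def)
qed

lemma st7_inject: "st7 x0 x1 x2 x3 x4 x5 x6 = st7 y0 y1 y2 y3 y4 y5 y6 \<longleftrightarrow>
    x0 = y0 \<and> x1 = y1 \<and> x2 = y2 \<and> x3 = y3 \<and> x4 = y4 \<and> x5 = y5 \<and> x6 = y6"
proof
  assume eq: "st7 x0 x1 x2 x3 x4 x5 x6 = st7 y0 y1 y2 y3 y4 y5 y6"
  show "x0 = y0 \<and> x1 = y1 \<and> x2 = y2 \<and> x3 = y3 \<and> x4 = y4 \<and> x5 = y5 \<and> x6 = y6"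
    using fun_cong[OF eq, of 0] fun_cong[OF eq, of 1] fun_cong[OF eq, of 2] fun_cong[OF eq, of 3]
      fun_cong[OF eq, of 4] fun_cong[OF eq, of 5] fun_cong[OF eq, of 6]
    by (simp add: st7_def)
qed simp

lemma init_st7: "init_st w = st7 (0, tape_of w) (0, tape_of []) (0, tape_of []) (0, tape_of [])
    (0, tape_of []) (0, tape_of []) (0, tape_of [])"
  by (rule ext) (simp add: init_st_def st7_def)

lemma tape_of_0 [simp]: "tape_of w 0 = 1" by (simp add: tape_of_def)

lemma tape_of_Suc: "tape_of w (Suc j) = (if j < length w then w ! j + 2 else 0)"
  by (simp add: tape_of_def)

lemma tape_of_append: "(tape_of xs)(Suc (length xs) := Suc (Suc a)) = tape_of (xs @ [a])"
  by (auto simp: tape_of_def nth_append fun_eq_iff)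

lemma tape_of_update:
  "j < length xs \<Longrightarrow> (tape_of xs)(Suc j := Suc (Suc a)) = tape_of (xs[j := a])"
  by (auto simp: tape_of_def fun_eq_iff nth_list_update)

lemma tape_of_same [simp]:
  "(tape_of w)(0 := Suc 0) = tape_of w"
  "j < length w \<Longrightarrow> (tape_of w)(Suc j := Suc (Suc (w ! j))) = tape_of w"
  "length w \<le> j \<Longrightarrow> (tape_of w)(Suc j := 0) = tape_of w"
  by (auto simp: tape_of_def fun_eq_iff)

lemma act_same [simp]: "act (snd x (fst x), Stay) x = x"
  by (cases x) simp

text \<open>The value replaces the end marker of cell 0, so an untouched tape is a register with
  value 1.\<close>

definition reg :: "nat \<Rightarrow> tape" where
  "reg v = (0, (tape_of [])(0 := v))"

lemma reg_simps [simp]: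
  "fst (reg v) = 0" "snd (reg v) 0 = v" "act (x, Stay) (reg v) = reg x" "(reg v = reg x) = (v = x)"
  by (auto simp: reg_def dest: fun_cong[of _ _ 0])

lemma reg_init: "(0, tape_of []) = reg 1"
  by (auto simp: reg_def)

lemmas st7_simps = wp_Do wp_Seq wp_Cond upd_st7 rd_st7 heads_in_st7 st7_inject idle_def

section \<open>Copying the input and checking its syntax\<close>

definition copy_loop :: com where
  "copy_loop = While (\<lambda>r. r 0 \<noteq> 0) (Do (\<lambda>r. (idle r)(0 := (r 0, MoveRight), 1 := (r 0, MoveRight))))"

lemma copy_loop:
  assumes "length w + 2 < B"
    and "fst x2 < B" "fst x3 < B" "fst x4 < B" "fst x5 < B" "fst x6 < B"
    and Q: "Q (st7 (Suc (length w), tape_of w) (Suc (Suc (length w)), tape_of (6 # w)) x2 x3 x4 x5 x6)"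
  shows "wp 7 (\<lambda>h. h < B) copy_loop (st7 (Suc 0, tape_of w) (Suc (Suc 0), tape_of [6]) x2 x3 x4 x5 x6) Q"
  unfolding copy_loop_def
  apply (rule wp_While_count[where n = "length w" and I = "\<lambda>i s. s = st7 (Suc i, tape_of w)
      (i + 2, tape_of (6 # take i w)) x2 x3 x4 x5 x6"])
  using assms apply (simp add: st7_simps)
  subgoal for i u
    using assms tape_of_append[of "6 # take i w" "w ! i"]
    by (simp add: st7_simps tape_of_Suc take_Suc_conv_app_nth)
  using assms apply (simp add: st7_simps tape_of_Suc)
  done

text \<open>With truncated subtraction the new height is 0 exactly when an operand was missing. The
  end marker under the head of the stack therefore detects syntax errors.\<close>

definition height :: "nat \<Rightarrow> nat \<Rightarrow> nat" where
  "height a h = (if a < 2 then Suc h else if a = 3 \<or> a = 4 then h - 1 else h)"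

definition height_move :: "nat \<Rightarrow> move" where
  "height_move a = (if a < 4 then MoveRight else if a = 5 \<or> a = 6 then MoveLeft else Stay)"

lemma height_move: "act (x, height_move (Suc (Suc a))) (h, t) = (height a h, t(h := x))"
  by (auto simp: height_move_def height_def)

lemma build_height:
  assumes "a < 7"
  shows "build a fs = None \<longleftrightarrow> height a (length fs) = 0"
    "build a fs = Some gs \<Longrightarrow> length gs = height a (length fs)"
  using assms by (auto simp: build_def height_def split: list.splits if_splits)

lemma height_le: "height a h \<le> Suc h"
  by (auto simp: height_def)

text \<open>Only the height of the parse stack is kept, as the position of head 4 on a blank tape.
  The error flag 4 is permanent, so heights computed after an error do no harm.\<close>

definition parse_loop :: com where
  "parse_loop = While (\<lambda>r. r 1 \<noteq> 1)
     (Seq (Do (\<lambda>r. (idle r)(4 := (r 4, height_move (r 1)))))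
        (Do (\<lambda>r. (idle r)(1 := (r 1, MoveLeft), 5 := (if r 4 = 1 then 4 else r 5, Stay)))))"

lemma diff_Suc_cases:
  fixes i n :: nat
  assumes "i < n"
  obtains j where "n - i = Suc j" "n - Suc i = j" "j < n"
  using assms that[of "n - Suc i"] by (simp add: Suc_diff_Suc)

lemma drop_last_Suc:
  assumes "i < length u"
  obtains j where "length u - i = Suc j" "length u - Suc i = j" "j < length u"
    "drop j u = u ! j # drop (Suc j) u"
proof (rule that[of "length u - Suc i"])
  show "drop (length u - Suc i) u = u ! (length u - Suc i) # drop (Suc (length u - Suc i)) u"
    using assms by (intro Cons_nth_drop_Suc[symmetric]) simp
qed (use assms in auto)

lemma parse_loop:
  assumes "length u < B" "set u \<subseteq> {..<7}"
    and "fst x0 < B" "fst x2 < B" "fst x3 < B" "fst x6 < B"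
    and Q: "\<And>h. h \<le> length u \<Longrightarrow> (\<And>fs. parse u = Some fs \<Longrightarrow> h = length fs) \<Longrightarrow>
      Q (st7 x0 (0, tape_of u) x2 x3 (h, tape_of []) (reg (if parse u = None then 4 else 2)) x6)"
  shows "wp 7 (\<lambda>h. h < B) parse_loop
    (st7 x0 (length u, tape_of u) x2 x3 (0, tape_of []) (reg 2) x6) Q"
  unfolding parse_loop_def
  apply (rule wp_While_count[where n = "length u" and I = "\<lambda>i s. \<exists>h. s = st7 x0 (length u - i, tape_of u) x2 x3
      (h, tape_of []) (reg (if parse (drop (length u - i) u) = None then 4 else 2)) x6 \<and>
      (\<forall>fs. parse (drop (length u - i) u) = Some fs \<longrightarrow> h = length fs) \<and> h \<le> i"])
  using assms apply (simp add: st7_simps)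
  subgoal premises prems for i s
  proof -
    obtain j where j: "length u - i = Suc j" "length u - Suc i = j" "j < length u"
      "drop j u = u ! j # drop (Suc j) u" using drop_last_Suc[OF prems(1)] .
    obtain h where s: "s = st7 x0 (Suc j, tape_of u) x2 x3 (h, tape_of [])
        (reg (if parse (drop (Suc j) u) = None then 4 else 2)) x6"
      and h: "\<And>fs. parse (drop (Suc j) u) = Some fs \<Longrightarrow> h = length fs" "h \<le> i"
      using prems(2) j(1) by auto
    let ?h = "height (u ! j) h"
    have a: "u ! j < 7" using assms(2) j(3) nth_mem by blast
    have p: "parse (drop j u) = Option.bind (parse (drop (Suc j) u)) (build (u ! j))" using j(4) by simp
    have flag: "(parse (drop j u) = None) = (parse (drop (Suc j) u) = None \<or> tape_of [] ?h = Suc 0)"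
      using build_height(1)[OF a] h(1) p
      by (cases "parse (drop (Suc j) u)") (auto simp: tape_of_def)
    have len: "?h = length fs" if "parse (drop j u) = Some fs" for fs
      using build_height(2)[OF a] h(1) p that by (auto split: bind_splits)
    have b: "?h \<le> Suc i" using height_le[of "u ! j" h] h(2) by linarith
    show ?thesis
      using assms(1,3-6) prems(1) b len h(2) j(1-3) flag
      by (simp add: s st7_simps tape_of_Suc height_move del: act.simps) (auto simp: st7_inject)
  qed
  subgoal for s using Q by (auto simp: st7_simps)
  done

section \<open>The string of moves\<close>

definition cells :: "bool list \<Rightarrow> bool list \<Rightarrow> nat list" where
  "cells qs bs = map2 (\<lambda>q b. (if q then 0 else 2) + (if b then 1 else 0)) qs bs"

lemma length_cells [simp]: "length (cells qs bs) = min (length qs) (length bs)"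
  by (simp add: cells_def)

lemma nth_cells:
  "i < length qs \<Longrightarrow> length bs = length qs \<Longrightarrow>
    cells qs bs ! i = (if qs ! i then 0 else 2) + (if bs ! i then 1 else 0)"
  by (simp add: cells_def)

lemma length_quants [simp]: "length (quants n k) = 2 * n * k"
  by (induction k) (auto simp: algebra_simps)

lemma nth_quants:
  "l < k \<Longrightarrow> i < n \<Longrightarrow> quants n k ! (2 * n * l + i)"
  "l < k \<Longrightarrow> i < n \<Longrightarrow> \<not> quants n k ! (2 * n * l + n + i)"
proof (induction k arbitrary: l)
  case (Suc k)
  {
    case 1
    then show ?case using Suc.IH(1)[of "l - 1"]
      by (cases l) (auto simp: nth_append algebra_simps)
  next
    case 2
    then show ?case using Suc.IH(2)[of "l - 1"]
      by (cases l) (auto simp: nth_append algebra_simps)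
  }
qed auto

definition fresh :: "nat \<Rightarrow> nat \<Rightarrow> nat list" where
  "fresh n k = concat (replicate k (replicate n 0 @ replicate n 2))"

lemma cells_append: "length a = length c \<Longrightarrow> cells (a @ b) (c @ d) = cells a c @ cells b d"
  by (simp add: cells_def)

lemma fresh_cells: "fresh n k = cells (quants n k) (replicate (2 * n * k) False)"
proof (induction k)
  case (Suc k)
  have "replicate (2 * n * Suc k) False = replicate n False @ replicate n False @ replicate (2 * n * k) False"
    by (simp add: replicate_add[symmetric] algebra_simps)
  moreover have "cells (replicate n q) (replicate n False) = replicate n (if q then 0 else 2)" for q
    by (rule nth_equalityI) (auto simp: nth_cells)
  ultimately show ?case using Suc
    by (simp add: cells_append fresh_def)
qed (simp add: fresh_def cells_def)

lemma fresh_Suc: "fresh n (Suc k) = fresh n k @ replicate n 0 @ replicate n 2"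
  unfolding fresh_def replicate_Suc replicate_append_same[symmetric] by simp

lemma length_fresh [simp]: "length (fresh n k) = 2 * n * k"
  by (simp add: fresh_cells)

lemma tape_of_append_0: "length xs = m \<Longrightarrow> (tape_of xs)(Suc m := 2) = tape_of (xs @ [0])"
  using tape_of_append[of xs 0] by (simp add: numeral_2_eq_2)

lemma tape_of_append_2: "length xs = m \<Longrightarrow> (tape_of xs)(Suc m := 4) = tape_of (xs @ [2])"
  using tape_of_append[of xs 2] by (simp add: eval_nat_numeral)

definition fill_right :: com where
  "fill_right = While (\<lambda>r. r 1 \<noteq> 0) (Do (\<lambda>r. (idle r)(3 := (2, MoveRight), 1 := (r 1, MoveRight))))"

lemma fill_right:
  assumes "length u + 1 < B" "Suc (length xs + length u) < B"
    and "fst x0 < B" "fst x2 < B" "fst x4 < B" "fst x5 < B" "fst x6 < B"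
    and Q: "Q (st7 x0 (Suc (length u), tape_of u) x2
      (Suc (length xs + length u), tape_of (xs @ replicate (length u) 0)) x4 x5 x6)"
  shows "wp 7 (\<lambda>h. h < B) fill_right (st7 x0 (Suc 0, tape_of u) x2 (Suc (length xs), tape_of xs) x4 x5 x6) Q"
  unfolding fill_right_def
  apply (rule wp_While_count[where n = "length u" and I = "\<lambda>i s. s = st7 x0 (Suc i, tape_of u) x2
      (Suc (length xs + i), tape_of (xs @ replicate i 0)) x4 x5 x6"])
  using assms apply (simp add: st7_simps)
  subgoal for i s
    using assms by (simp add: st7_simps tape_of_Suc tape_of_append_0 replicate_append_same)
  using assms apply (simp add: st7_simps tape_of_Suc)
  done

definition fill_left :: com where
  "fill_left = While (\<lambda>r. r 1 \<noteq> 1) (Do (\<lambda>r. (idle r)(3 := (4, MoveRight), 1 := (r 1, MoveLeft))))"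

lemma fill_left:
  assumes "length u + 1 < B" "Suc (length xs + length u) < B"
    and "fst x0 < B" "fst x2 < B" "fst x4 < B" "fst x5 < B" "fst x6 < B"
    and Q: "Q (st7 x0 (0, tape_of u) x2
      (Suc (length xs + length u), tape_of (xs @ replicate (length u) 2)) x4 x5 x6)"
  shows "wp 7 (\<lambda>h. h < B) fill_left (st7 x0 (length u, tape_of u) x2 (Suc (length xs), tape_of xs) x4 x5 x6) Q"
  unfolding fill_left_def
  apply (rule wp_While_count[where n = "length u" and I = "\<lambda>i s. s = st7 x0 (length u - i, tape_of u) x2
      (Suc (length xs + i), tape_of (xs @ replicate i 2)) x4 x5 x6"])
  using assms apply (simp add: st7_simps)
  subgoal premises prems for i s
  proof -
    obtain j where j: "length u - i = Suc j" "length u - Suc i = j" "j < length u"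
      using drop_last_Suc[OF prems(1)] .
    show ?thesis
      using assms prems(2) j prems(1)
      by (simp add: st7_simps tape_of_Suc tape_of_append_2 replicate_append_same)
  qed
  using assms apply (simp add: st7_simps)
  done

text \<open>The copy loop leaves head 0 at \<open>length u\<close>, and this head is reused to count
  the rounds. In each round a sweep to the right over the formula lays out the cells of the first
  player, and the sweep back those of the opponent.\<close>

definition fill_levels :: com where
  "fill_levels = While (\<lambda>r. r 0 \<noteq> 1)
     (Seq fill_right (Seq (Do (\<lambda>r. (idle r)(1 := (r 1, MoveLeft))))
       (Seq fill_left (Do (\<lambda>r. (idle r)(1 := (r 1, MoveRight), 0 := (r 0, MoveLeft)))))))"

lemma fill_levels:
  assumes B: "2 * length u * k + 1 < B" "length u + 1 < B" "k < B"
    and "fst x2 < B" "fst x4 < B" "fst x5 < B" "fst x6 < B" and u: "u \<noteq> []"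
    and c: "\<forall>j < k. c (Suc j) \<noteq> 1" "c 0 = 1"
    and Q: "Q (st7 (0, c) (Suc 0, tape_of u) x2
      (Suc (2 * length u * k), tape_of (fresh (length u) k)) x4 x5 x6)"
  shows "wp 7 (\<lambda>h. h < B) fill_levels
    (st7 (k, c) (Suc 0, tape_of u) x2 (Suc 0, tape_of []) x4 x5 x6) Q"
  unfolding fill_levels_def
  apply (rule wp_While_count[where n = k and I = "\<lambda>i s. s = st7 (k - i, c) (Suc 0, tape_of u) x2
      (Suc (2 * length u * i), tape_of (fresh (length u) i)) x4 x5 x6"])
  using assms apply (simp add: st7_simps fresh_def)
  subgoal premises prems for i s
  proof -
    obtain j where j: "k - i = Suc j" "k - Suc i = j" "j < k"
      using diff_Suc_cases[OF prems(1)] .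
    have "2 * length u * Suc i \<le> 2 * length u * k" using prems(1) by (intro mult_le_mono) auto
    then have b: "Suc (2 * length u * i + length u + length u) < B" using B by (simp add: algebra_simps)
    have F: "fresh (length u) (Suc i) = (fresh (length u) i @ replicate (length u) 0) @ replicate (length u) 2"
      by (simp add: fresh_Suc)
    have *: "wp 7 (\<lambda>h. h < B) fill_right (st7 (Suc j, c) (Suc 0, tape_of u) x2
      (Suc (length (fresh (length u) i)), tape_of (fresh (length u) i)) x4 x5 x6) 
      (\<lambda>s. s = st7 (Suc j, c) (Suc (length u), tape_of u) x2 (Suc (length (fresh (length u) i) + length u),
       tape_of (fresh (length u) i @ replicate (length u) 0)) x4 x5 x6)"
      by (rule fill_right) (use assms b j in auto)
    have **: "wp 7 (\<lambda>h. h < B) fill_left (st7 (Suc j, c) (length u, tape_of u) x2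
      (Suc (length (fresh (length u) i @ replicate (length u) 0)), tape_of (fresh (length u) i @ replicate (length u) 0)) x4 x5 x6) 
      (\<lambda>s. s = st7 (Suc j, c) (0, tape_of u) x2 (Suc (length (fresh (length u) i @ replicate (length u) 0) + length u),
       tape_of (fresh (length u) (Suc i))) x4 x5 x6)"
      unfolding F by (rule fill_left) (use assms b j in auto)
    have cj: "c (Suc j) \<noteq> Suc 0" using c(1) j(3) by simp
    have step2: "wp 7 (\<lambda>h. h < B) (Seq (Do (\<lambda>r. (idle r)(1 := (r 1, MoveLeft))))
       (Seq fill_left (Do (\<lambda>r. (idle r)(1 := (r 1, MoveRight), 0 := (r 0, MoveLeft))))))
       (st7 (Suc j, c) (Suc (length u), tape_of u) x2 (Suc (length (fresh (length u) i) + length u),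
       tape_of (fresh (length u) i @ replicate (length u) 0)) x4 x5 x6)
       (\<lambda>s. s = st7 (k - Suc i, c) (Suc 0, tape_of u) x2
      (Suc (2 * length u * Suc i), tape_of (fresh (length u) (Suc i))) x4 x5 x6)"
      using assms b j **
      apply (simp add: st7_simps tape_of_Suc)
      apply (erule wp_mono)
      apply (simp add: st7_simps)
      done
    show ?thesis
      using prems(2) cj j(1) *
      apply (simp add: rd_st7 wp_Seq[of _ _ fill_right])
      apply (erule wp_mono)
      using step2 apply simp
      done
  qed
  using c Q apply (simp add: st7_simps)
  done

definition rewind :: com where
  "rewind = While (\<lambda>r. r 3 \<noteq> 1) (Do (\<lambda>r. (idle r)(3 := (r 3, MoveLeft))))"

lemma rewind:
  assumes "m \<le> length xs" "\<forall>x \<in> set xs. x + 2 \<noteq> 1"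
    and "fst x0 < B" "fst x1 < B" "fst x2 < B" "m < B" "fst x4 < B" "fst x5 < B" "fst x6 < B"
    and Q: "Q (st7 x0 x1 x2 (0, tape_of xs) x4 x5 x6)"
  shows "wp 7 (\<lambda>h. h < B) rewind (st7 x0 x1 x2 (m, tape_of xs) x4 x5 x6) Q"
  unfolding rewind_def
  apply (rule wp_While_count[where n = m and I = "\<lambda>i s. s = st7 x0 x1 x2 (m - i, tape_of xs) x4 x5 x6"])
  using assms apply (simp add: st7_simps)
  subgoal premises prems for i s
  proof -
    obtain j where j: "m - i = Suc j" "m - Suc i = j" "j < m" using diff_Suc_cases[OF prems(1)] .
    then have "j < length xs" using assms(1) by simp
    with j show ?thesis using assms prems(2) j by (simp add: st7_simps tape_of_Suc)
  qed
  using assms apply (simp add: st7_simps)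
  done

section \<open>Constraints on the current world\<close>

text \<open>Only the cells under the formula are described, so a play can start over whatever
  constraints the previous one left behind.\<close>

definition holds_info :: "nat list \<Rightarrow> (nat \<Rightarrow> nat) \<Rightarrow> bool" where
  "holds_info p t \<longleftrightarrow> (\<forall>j < length p. t (Suc j) = p ! j + 2)"

definition init_info_loop :: com where
  "init_info_loop = While (\<lambda>r. r 1 \<noteq> 0) (Do (\<lambda>r. (idle r)(2 := (4, MoveRight), 1 := (r 1, MoveRight))))"

definition init_info :: com where
  "init_info =
     Seq (Do (\<lambda>r. (idle r)(1 := (r 1, MoveRight), 2 := (r 2, MoveRight), 3 := (r 3, MoveRight), 5 := (2, Stay))))
       (Seq (Do (\<lambda>r. (idle r)(1 := (r 1, MoveRight), 2 := (6, MoveRight))))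
         (Seq init_info_loop (Do (\<lambda>r. (idle r)(1 := (r 1, MoveLeft), 2 := (r 2, MoveLeft))))))"

lemma root_info_nth: "j < length u \<Longrightarrow> root_info u ! j = (if j = 0 then 4 else 2)"
  by (cases j) (auto simp: root_info_def)

lemma length_root_info: "u \<noteq> [] \<Longrightarrow> length (root_info u) = length u"
  by (simp add: root_info_def)

lemma init_info_loop:
  assumes u: "u \<noteq> []" and "length u + 1 < B" "t2 (Suc 0) = 6"
    and "fst x0 < B" "fst x3 < B" "fst x4 < B" "fst x5 < B" "fst x6 < B"
    and Q: "\<And>t. holds_info (root_info u) t \<Longrightarrow>
      Q (st7 x0 (Suc (length u), tape_of u) (Suc (length u), t) x3 x4 x5 x6)"
  shows "wp 7 (\<lambda>h. h < B) init_info_loop (st7 x0 (Suc (Suc 0), tape_of u) (Suc (Suc 0), t2) x3 x4 x5 x6) Q"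
  unfolding init_info_loop_def
  apply (rule wp_While_count[where n = "length u - 1" and I = "\<lambda>i s. \<exists>t. s = st7 x0 (Suc (Suc i), tape_of u)
    (Suc (Suc i), t) x3 x4 x5 x6 \<and> (\<forall>j \<le> i. t (Suc j) = root_info u ! j + 2)"])
  using assms apply (simp add: st7_simps root_info_nth)
  subgoal for i s
    using assms by (auto simp: st7_simps tape_of_Suc root_info_nth le_Suc_eq)
  subgoal for s
  proof -
    assume "\<exists>t. s = st7 x0 (Suc (Suc (length u - 1)), tape_of u)
        (Suc (Suc (length u - 1)), t) x3 x4 x5 x6 \<and> (\<forall>j \<le> length u - 1. t (Suc j) = root_info u ! j + 2)"
    then obtain t where t: "s = st7 x0 (Suc (length u), tape_of u) (Suc (length u), t) x3 x4 x5 x6"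
      "\<forall>j \<le> length u - 1. t (Suc j) = root_info u ! j + 2" using u by auto
    have "holds_info (root_info u) t" using t(2) u by (auto simp: holds_info_def length_root_info)
    then show ?thesis using t Q[of t] by (simp add: st7_simps tape_of_Suc)
  qed
  done

lemma init_info:
  assumes u: "u \<noteq> []" and B: "length u + 1 < B"
    and "fst x0 < B" "1 < B" "fst x4 < B" "fst x6 < B"
    and Q: "\<And>t. holds_info (root_info u) t \<Longrightarrow>
      Q (st7 x0 (length u, tape_of u) (length u, t) (1, tape_of xs) x4 (reg 2) x6)"
  shows "wp 7 (\<lambda>h. h < B) init_info (st7 x0 (0, tape_of u) (0, t2) (0, tape_of xs) x4 (reg x5) x6) Q"
proof -
  obtain a u' where ua: "u = a # u'" using u by (cases u) auto
  have st: "tape_of u (Suc 0) = a + 2" "(tape_of u)(Suc 0 := Suc (Suc a)) = tape_of u"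
    using ua by (auto simp: tape_of_Suc fun_eq_iff)
  show ?thesis
    unfolding init_info_def
    using assms(2-6)
    apply (simp add: st7_simps st)
    apply (rule conjI)
    using ua apply simp
    apply (rule init_info_loop[OF u])
    using Q apply (simp_all add: st7_simps tape_of_Suc)
    apply fastforce
    done
qed

section \<open>Evaluation at one world\<close>

text \<open>Cells above the top are unconstrained, so popping is a mere head movement.\<close>

fun stk :: "bool list \<Rightarrow> (nat \<Rightarrow> nat) \<Rightarrow> bool" where
  "stk [] t \<longleftrightarrow> t 0 = 1"
| "stk (b # st) t \<longleftrightarrow> t (Suc (length st)) = (if b then 3 else 2) \<and> stk st t"

lemma stk_upd: "length st < j \<Longrightarrow> stk st (t(j := x)) = stk st t"
  by (induction st) auto

lemma stk_0: "stk st t \<Longrightarrow> t 0 = 1"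
  by (induction st) auto

text \<open>\<open>x\<close> is the symbol at the old top and \<open>y\<close> the symbol under the
  head after it has moved to the new top. For a binary connective these are the two operands;
  otherwise \<open>y\<close> is simply overwritten.\<close>

definition val_sym :: "nat \<Rightarrow> nat \<Rightarrow> nat \<Rightarrow> bool \<Rightarrow> nat" where
  "val_sym a x y e =
     (if (if a = 2 then True else if a = 3 then False else if a = 4 then x \<noteq> 3
          else if a = 5 then x = 3 \<and> y = 3 else if a = 6 then x = 3 \<or> y = 3
          else if a = 7 then \<not> e else e) then 3 else 2)"

lemma stk_step:
  assumes "a < 7" "height a (length st) \<noteq> 0" "stk st t"
  shows "length (op_val a b st) = height a (length st)"
    "stk (op_val a b st) (t(height a (length st) :=
       val_sym (a + 2) (t (length st)) (t (height a (length st))) b))"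
proof -
  have a: "a \<in> {0, 1, 2, 3, 4, 5, 6}" using assms(1) by auto
  show "length (op_val a b st) = height a (length st)"
    using a assms(2) by (cases st; cases "tl st") (auto simp: op_val_def height_def)
  show "stk (op_val a b st) (t(height a (length st) :=
       val_sym (a + 2) (t (length st)) (t (height a (length st))) b))"
    using a assms(2,3) by (cases st; cases "tl st") (auto simp: op_val_def height_def val_sym_def stk_upd)
qed

lemma length_ev: "parse xs = Some fs \<Longrightarrow> length bs = length xs \<Longrightarrow> set xs \<subseteq> {..<7} \<Longrightarrow>
    length (ev xs bs) = length fs"
proof (induction xs arbitrary: fs bs)
  case (Cons a xs)
  then obtain b bs' gs where *: "bs = b # bs'" "parse xs = Some gs" "build a gs = Some fs"
    by (cases bs) (auto split: bind_splits)
  have "length (ev xs bs') = length gs" using Cons * by auto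
  then show ?case using *(1,3) Cons.prems(3)
    by (auto simp: op_val_def build_def split: list.splits if_splits)
qed simp

lemma length_parse: "parse xs = Some fs \<Longrightarrow> length fs \<le> length xs"
proof (induction xs arbitrary: fs)
  case (Cons a xs)
  then show ?case by (fastforce simp: build_def split: bind_splits if_splits list.splits)
qed simp

text \<open>The test \<open>(x = 3) = (a = 8)\<close> is \<open>hit\<close>, with \<open>x\<close>
  the argument found on top before the operator is applied. The symbols 5 and 6 are the constraints
  3 and 4 shifted by 2.\<close>

definition verdict_sym :: "nat \<Rightarrow> nat \<Rightarrow> nat \<Rightarrow> nat \<Rightarrow> nat" where
  "verdict_sym a x p r =
     (if r = 2 \<and> (a = 7 \<or> a = 8) \<and> (if (x = 3) = (a = 8) then p = 5 else p = 6) then 4 else r)"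

lemma act_moves:
  "act (x, MoveLeft) (h, t) = (h - 1, t(h := x))"
  "act (x, Stay) (h, t) = (h, t(h := x))"
  "act (x, MoveRight) (h, t) = (Suc h, t(h := x))"
  by simp_all

definition info_sym :: "nat \<Rightarrow> nat" where
  "info_sym x = (if x = 3 then 4 else 5)"

text \<open>A connective needs the symbols at the old and at the new top, so each letter takes two
  steps, with the old top parked in register 6. A constraint that has been tested is overwritten at
  once by the one for the next world.\<close>

definition eval_loop :: com where
  "eval_loop = While (\<lambda>r. r 1 \<noteq> 1)
     (Seq (Do (\<lambda>r. (idle r)(4 := (r 4, height_move (r 1)), 6 := (r 4, Stay))))
        (Do (\<lambda>r. (idle r)(4 := (val_sym (r 1) (r 6) (r 4) (r 3 = 3), Stay),
           1 := (r 1, MoveLeft), 2 := (info_sym (r 3), MoveLeft), 3 := (r 3, MoveRight),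
           5 := (verdict_sym (r 1) (r 6) (r 2) (r 5), Stay)))))"

definition base :: "bool list \<Rightarrow> nat list" where
  "base e = map (\<lambda>b. if b then 2 else 3) e"

lemma eval_loop:
  assumes u: "parse u \<noteq> None" "set u \<subseteq> {..<7}" and len: "length e = length u" "length p = length u"
    and B: "length u < B" "Suc (b + length u) < B" and fst: "fst x0 < B"
    and cs: "b + length u \<le> length cs"
      "\<And>i. i < length u \<Longrightarrow> cs ! (b + i) = (if e ! (length u - Suc i) then 1 else 0)"
    and t2: "holds_info p t2" and t4: "t4 0 = 1"
    and r: "r = 2 \<or> r = 3 \<or> r = 4"
    and Q: "\<And>t2 h t4 x. \<lbrakk>holds_info (base e) t2; \<And>fs. parse u = Some fs \<Longrightarrow> h = length fs; t4 0 = 1\<rbrakk> \<Longrightarrow>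
      Q (st7 x0 (0, tape_of u) (0, t2) (Suc (b + length u), tape_of cs) (h, t4)
        (reg (if r = 2 \<and> \<not> chk u p e then 4 else r)) (reg x))"
  shows "wp 7 (\<lambda>h. h < B) eval_loop
    (st7 x0 (length u, tape_of u) (length u, t2) (Suc b, tape_of cs) (0, t4) (reg r) (reg x)) Q"
proof -
  define n where "n = length u"
  \<comment> \<open>The verdict once the positions from \<open>i\<close> on have been tested; the
    sweep goes from right to left.\<close>
  define R where "R i = (if r = 2 \<and> \<not> (\<forall>j. i \<le> j \<and> j < n \<longrightarrow> chk_at u p e j) then 4 else r)" for i
  define I where "I i s \<longleftrightarrow> (\<exists>t2 t4 x. s = st7 x0 (n - i, tape_of u) (n - i, t2) (Suc (b + i), tape_of cs)
      (length (ev (drop (n - i) u) (drop (n - i) e)), t4)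
      (reg (R (n - i))) (reg x)
      \<and> stk (ev (drop (n - i) u) (drop (n - i) e)) t4
      \<and> (\<forall>j < n - i. t2 (Suc j) = p ! j + 2)
      \<and> (\<forall>j < n. n - i \<le> j \<longrightarrow> t2 (Suc j) = base e ! j + 2))" for i s
  show ?thesis unfolding eval_loop_def
  proof (rule wp_While_count[where n = n and I = I])
    show "I 0 (st7 x0 (length u, tape_of u) (length u, t2) (Suc b, tape_of cs) (0, t4) (reg r) (reg x))"
      using t2 t4 len unfolding I_def by (auto simp: n_def holds_info_def R_def)
  next
    fix s assume "I n s"
    then obtain t2 t4 x where s: "s = st7 x0 (0, tape_of u) (0, t2) (Suc (b + n), tape_of cs)
      (length (ev u e), t4) (reg (R 0)) (reg x)"
      and *: "stk (ev u e) t4" "\<forall>j<n. t2 (Suc j) = base e ! j + 2"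
      unfolding I_def by auto
    have "holds_info (base e) t2" using *(2) len by (simp add: holds_info_def base_def n_def)
    moreover have "length (ev u e) = length fs" if "parse u = Some fs" for fs
      using length_ev[OF that] len u by simp
    moreover have "R 0 = (if r = 2 \<and> \<not> chk u p e then 4 else r)" by (simp add: R_def chk_def n_def)
    ultimately show "\<not> rd 7 s 1 \<noteq> 1 \<and> Q s"
      using Q[of t2 "length (ev u e)" t4 x] stk_0[OF *(1)] unfolding s by (simp add: rd_st7 n_def)
  next
    fix i s assume i: "i < n" and I: "I i s"
    obtain j where j: "n - i = Suc j" "n - Suc i = j" "j < n"
      and du: "drop j u = u ! j # drop (Suc j) u" using drop_last_Suc[of i u] i unfolding n_def by blast
    have de: "drop j e = e ! j # drop (Suc j) e" using j(3) len by (simp add: n_def Cons_nth_drop_Suc)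
    let ?st = "ev (drop (Suc j) u) (drop (Suc j) e)"
    obtain t2 t4 x where s: "s = st7 x0 (Suc j, tape_of u) (Suc j, t2) (Suc (b + i), tape_of cs)
        (length ?st, t4) (reg (R (Suc j))) (reg x)"
      and inv: "stk ?st t4" "\<forall>j' < Suc j. t2 (Suc j') = p ! j' + 2"
        "\<forall>j' < n. Suc j \<le> j' \<longrightarrow> t2 (Suc j') = base e ! j' + 2"
      using I unfolding I_def j(1) by blast
    have a: "u ! j < 7" using u(2) j(3) nth_mem unfolding n_def by blast
    obtain gs where gs: "parse (drop (Suc j) u) = Some gs" "build (u ! j) gs \<noteq> None"
      using parse_drop[OF u(1), of j] unfolding du by (auto split: bind_splits)
    have lst: "length ?st = length gs"
      by (rule length_ev[OF gs(1)]) (use len u(2) set_drop_subset[of "Suc j" u] in auto)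
    have h: "height (u ! j) (length ?st) \<noteq> 0" using build_height(1)[OF a] gs(2) lst by simp
    have st': "ev (drop j u) (drop j e) = op_val (u ! j) (e ! j) ?st" unfolding du de by simp
    let ?h = "height (u ! j) (length ?st)"
    have le: "?h \<le> n"
      using height_le[of "u ! j" "length ?st"] length_parse[OF gs(1)] lst j(3) by (simp add: n_def)
    have read3: "tape_of cs (Suc (b + i)) = (if e ! j then 3 else 2)"
      using cs(1) cs(2)[of i] i j(2) by (auto simp: tape_of_Suc n_def)
    have read1: "tape_of u (Suc j) = u ! j + 2" using j(3) by (simp add: tape_of_Suc n_def)
    have read2: "t2 (Suc j) = p ! j + 2" using inv(2) by simp
    have top: "t4 (length ?st) = (if hd ?st then 3 else 2)" if "?st \<noteq> []"
      using inv(1) that by (cases ?st) auto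
    have flag: "verdict_sym (u ! j + 2) (t4 (length ?st)) (p ! j + 2) (R (Suc j)) = R j"
    proof -
      have split: "(\<forall>j'. j \<le> j' \<and> j' < n \<longrightarrow> chk_at u p e j') \<longleftrightarrow>
        chk_at u p e j \<and> (\<forall>j'. Suc j \<le> j' \<and> j' < n \<longrightarrow> chk_at u p e j')"
        using j(3) by (metis Suc_leD Suc_leI le_eq_less_or_eq not_less_eq_eq)
      have ne: "?st \<noteq> []" if "modal (u ! j)"
        using h that lst by (auto simp: modal_def height_def)
      show ?thesis
        unfolding R_def split using r top ne
        by (auto simp: verdict_sym_def chk_at_def hit_def modal_def)
    qed
    show "rd 7 s 1 \<noteq> 1 \<and> wp 7 (\<lambda>h. h < B)
       (Seq (Do (\<lambda>r. (idle r)(4 := (r 4, height_move (r 1)), 6 := (r 4, Stay))))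
        (Do (\<lambda>r. (idle r)(4 := (val_sym (r 1) (r 6) (r 4) (r 3 = 3), Stay),
           1 := (r 1, MoveLeft), 2 := (info_sym (r 3), MoveLeft), 3 := (r 3, MoveRight),
           5 := (verdict_sym (r 1) (r 6) (r 2) (r 5), Stay))))) s (I (Suc i))"
    proof
      show "rd 7 s 1 \<noteq> 1" by (simp add: s rd_st7 read1)
      let ?t4 = "t4(?h := val_sym (tape_of u (Suc j)) (t4 (length ?st)) (t4 ?h) (tape_of cs (Suc (b + i)) = 3))"
      let ?t2 = "t2(Suc j := info_sym (tape_of cs (Suc (b + i))))"
      have res: "I (Suc i) (st7 x0 (j, tape_of u) (j, ?t2) (Suc (Suc (b + i)), tape_of cs)
         (?h, ?t4) (reg (R j)) (reg (t4 (length ?st))))"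
      proof -
        have "stk (ev (drop j u) (drop j e)) ?t4" "length (ev (drop j u) (drop j e)) = ?h"
          using stk_step[OF a h inv(1), of "e ! j"] read1 read3 unfolding st' by auto
        moreover have "\<forall>j' < j. ?t2 (Suc j') = p ! j' + 2" using inv(2) by simp
        moreover have "\<forall>j' < n. j \<le> j' \<longrightarrow> ?t2 (Suc j') = base e ! j' + 2"
          using inv(3) j(3) len read3 by (auto simp: base_def n_def Suc_le_eq info_sym_def)
        ultimately show ?thesis unfolding I_def j(2)
          by (intro exI[of _ ?t2] exI[of _ ?t4] exI[of _ "t4 (length ?st)"]) simp
      qed
      have flag': "verdict_sym (tape_of u (Suc j)) (t4 (length ?st)) (t2 (Suc j)) (R (Suc j)) = R j"
        unfolding read1 read2 by (rule flag)
      have hm: "act (x, height_move (tape_of u (Suc j))) (length ?st, t4) = (?h, t4(length ?st := x))" for x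
        unfolding read1 using height_move by simp
      have bound: "0 < B" "Suc j < B" "Suc (Suc (b + i)) < B" "Suc (b + i) < B" "?h < B" "j < B"
        using B i j(3) le by (auto simp: n_def)
      show "wp 7 (\<lambda>h. h < B)
       (Seq (Do (\<lambda>r. (idle r)(4 := (r 4, height_move (r 1)), 6 := (r 4, Stay))))
        (Do (\<lambda>r. (idle r)(4 := (val_sym (r 1) (r 6) (r 4) (r 3 = 3), Stay),
           1 := (r 1, MoveLeft), 2 := (info_sym (r 3), MoveLeft), 3 := (r 3, MoveRight),
           5 := (verdict_sym (r 1) (r 6) (r 2) (r 5), Stay))))) s (I (Suc i))"
        using res bound fst
        by (simp add: s st7_simps hm flag' act_moves del: act.simps)
    qed
  qed
qed

section \<open>Choice of a successor and one complete play\<close>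

definition select_sym :: "nat \<Rightarrow> nat \<Rightarrow> nat \<Rightarrow> nat" where
  "select_sym p v x = (if p = 4 \<and> v = 5 \<and> x = 2 then 6 else p)"

definition select_flag :: "nat \<Rightarrow> nat \<Rightarrow> nat \<Rightarrow> nat" where
  "select_flag p v x = (if p = 4 \<and> v = 5 then 3 else x)"

text \<open>Symbol 4 marks the claimed positions, and register 6 remembers whether one of them has
  already been chosen. So only the first chosen one becomes a requirement, symbol 6.\<close>

definition select_loop :: com where
  "select_loop = While (\<lambda>r. r 1 \<noteq> 0)
     (Do (\<lambda>r. (idle r)(1 := (r 1, MoveRight), 3 := (r 3, MoveRight),
        2 := (select_sym (r 2) (r 3) (r 6), MoveRight), 6 := (select_flag (r 2) (r 3) (r 6), Stay))))"

lemma select_loop: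
  assumes len: "length e = length u" and B: "Suc (length u) < B" "Suc (b + length u) < B"
    and fst: "fst x0 < B" "fst x4 < B" "fst x5 < B"
    and cs: "b + length u \<le> length cs"
      "\<And>i. i < length u \<Longrightarrow> cs ! (b + i) = (if v ! i then 3 else 2)"
    and t2: "holds_info (base e) t2"
    and Q: "\<And>t2. holds_info (mark e v) t2 \<Longrightarrow>
      Q (st7 x0 (Suc (length u), tape_of u) (Suc (length u), t2) (Suc (b + length u), tape_of cs) x4 x5
        (reg (if \<exists>j < length u. chosen e v j then 3 else 2)))"
  shows "wp 7 (\<lambda>h. h < B) select_loop
    (st7 x0 (Suc 0, tape_of u) (Suc 0, t2) (Suc b, tape_of cs) x4 x5 (reg 2)) Q"
proof -
  define n where "n = length u"
  define I where "I i s \<longleftrightarrow> (\<exists>t2. s = st7 x0 (Suc i, tape_of u) (Suc i, t2) (Suc (b + i), tape_of cs) x4 x5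
      (reg (if \<exists>j < i. chosen e v j then 3 else 2))
      \<and> (\<forall>j < i. t2 (Suc j) = mark e v ! j + 2) \<and> (\<forall>j < n. i \<le> j \<longrightarrow> t2 (Suc j) = base e ! j + 2))" for i s
  show ?thesis unfolding select_loop_def
  proof (rule wp_While_count[where n = n and I = I])
    show "I 0 (st7 x0 (Suc 0, tape_of u) (Suc 0, t2) (Suc b, tape_of cs) x4 x5 (reg 2))"
      using t2 len unfolding I_def by (auto simp: n_def holds_info_def base_def)
  next
    fix s assume "I n s"
    then obtain t2 where s: "s = st7 x0 (Suc n, tape_of u) (Suc n, t2) (Suc (b + n), tape_of cs) x4 x5
      (reg (if \<exists>j < n. chosen e v j then 3 else 2))" "\<forall>j < n. t2 (Suc j) = mark e v ! j + 2"
      unfolding I_def by auto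
    then have "holds_info (mark e v) t2" using len by (simp add: holds_info_def mark_def n_def)
    then show "\<not> rd 7 s 1 \<noteq> 0 \<and> Q s" using Q s(1) by (simp add: rd_st7 tape_of_Suc n_def)
  next
    fix i s assume i: "i < n" and I: "I i s"
    then obtain t2 where s: "s = st7 x0 (Suc i, tape_of u) (Suc i, t2) (Suc (b + i), tape_of cs) x4 x5
      (reg (if \<exists>j < i. chosen e v j then 3 else 2))"
      and inv: "\<forall>j < i. t2 (Suc j) = mark e v ! j + 2" "\<forall>j < n. i \<le> j \<longrightarrow> t2 (Suc j) = base e ! j + 2"
      unfolding I_def by auto
    have read3: "tape_of cs (Suc (b + i)) = (if v ! i then 5 else 4)"
      using cs i by (auto simp: tape_of_Suc n_def)
    have read3': "(tape_of cs)(Suc (b + i) := if v ! i then 5 else 4) = tape_of cs"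
      using read3 by auto
    have read1: "tape_of u (Suc i) = u ! i + 2" using i by (simp add: tape_of_Suc n_def)
    have read2: "t2 (Suc i) = (if e ! i then 4 else 5)" using inv(2) i len by (simp add: base_def n_def)
    have ex: "(\<exists>j < Suc i. chosen e v j) \<longleftrightarrow> chosen e v i \<or> (\<exists>j < i. chosen e v j)"
      by (auto simp: less_Suc_eq)
    let ?t2 = "t2(Suc i := mark e v ! i + 2)"
    have m: "select_sym (if e ! i then 4 else 5) (if v ! i then 5 else 4)
        (if \<exists>j < i. chosen e v j then 3 else 2) = mark e v ! i + 2"
      using i len by (auto simp: mark_def chosen_def n_def select_sym_def)
    have m': "select_flag (if e ! i then 4 else 5) (if v ! i then 5 else 4)
        (if \<exists>j < i. chosen e v j then 3 else 2) = (if \<exists>j < Suc i. chosen e v j then 3 else 2)"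
      unfolding ex by (auto simp: chosen_def select_flag_def)
    have "I (Suc i) (st7 x0 (Suc (Suc i), tape_of u) (Suc (Suc i), ?t2) (Suc (Suc (b + i)), tape_of cs) x4 x5
      (reg (if \<exists>j < Suc i. chosen e v j then 3 else 2)))"
      unfolding I_def using inv by (intro exI conjI) (auto simp: less_Suc_eq)
    moreover have "0 < B" "Suc (Suc i) < B" "Suc (Suc (b + i)) < B"
      using B i by (auto simp: n_def)
    ultimately show "rd 7 s 1 \<noteq> 0 \<and> wp 7 (\<lambda>h. h < B)
     (Do (\<lambda>r. (idle r)(1 := (r 1, MoveRight), 3 := (r 3, MoveRight),
        2 := (select_sym (r 2) (r 3) (r 6), MoveRight), 6 := (select_flag (r 2) (r 3) (r 6), Stay)))) s (I (Suc i))"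
      using fst i unfolding s
      by (simp add: st7_simps read1 read2 read3 read3' m m' n_def)
  qed
qed

definition win_sym :: "nat \<Rightarrow> nat \<Rightarrow> nat" where
  "win_sym r x = (if r = 2 \<and> x = 2 then 3 else r)"

definition level_body :: com where
  "level_body = Seq eval_loop
     (Seq (Do (\<lambda>r. (idle r)(1 := (r 1, MoveRight), 2 := (r 2, MoveRight), 4 := (r 4, MoveLeft), 6 := (2, Stay))))
       (Seq select_loop
         (Do (\<lambda>r. (idle r)(1 := (r 1, MoveLeft), 2 := (r 2, MoveLeft),
            5 := (win_sym (r 5) (r 6), Stay))))))"

text \<open>Rounds after the decision are still evaluated, with a frozen verdict, so every play
  consumes the whole string and head 3 always ends at its right end.\<close>

definition level_loop :: com where
  "level_loop = While (\<lambda>r. r 3 \<noteq> 0) level_body"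

lemma chk_judge:
  assumes "length e = length u"
  shows "win_sym (if r = 2 \<and> \<not> chk u p e then 4 else r) (if \<exists>j < length u. chosen e v j then 3 else 2)
    = judge u r p e v"
  by (auto simp: judge_def win_sym_def)

lemma level_body:
  assumes u: "parse u = Some [f]" "set u \<subseteq> {..<7}" "u \<noteq> []" and len: "length e = length u" "length p = length u"
      "length v = length u"
    and B: "Suc (length u) < B" "Suc (b + 2 * length u) < B" and fst: "fst x0 < B"
    and cs: "b + 2 * length u \<le> length cs"
      "\<And>i. i < length u \<Longrightarrow> cs ! (b + i) = (if e ! (length u - Suc i) then 1 else 0)"
      "\<And>i. i < length u \<Longrightarrow> cs ! (b + length u + i) = (if v ! i then 3 else 2)"
    and t2: "holds_info p t2" and t4: "t4 0 = 1"
    and r: "r = 2 \<or> r = 3 \<or> r = 4"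
    and Q: "\<And>t2 t4 x. holds_info (mark e v) t2 \<Longrightarrow> t4 0 = 1 \<Longrightarrow>
      Q (st7 x0 (length u, tape_of u) (length u, t2) (Suc (b + 2 * length u), tape_of cs) (0, t4)
        (reg (judge u r p e v)) (reg x))"
  shows "wp 7 (\<lambda>h. h < B) level_body
    (st7 x0 (length u, tape_of u) (length u, t2) (Suc b, tape_of cs) (0, t4) (reg r) (reg x)) Q"
  unfolding level_body_def
  apply (subst wp_Seq)
  apply (rule eval_loop[where e = e and p = p])
             apply (use u(1,2) len B fst cs t2 t4 r in \<open>simp_all\<close>)[12]
  subgoal premises prems for t2' h t4' x'
  proof -
    \<comment> \<open>The whole formula leaves a single truth value, so one step to the left empties
      the stack for the next round.\<close>
    have h: "h = 1" using prems(2)[OF u(1)] by simp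
    define r' where "r' = (if r = 2 \<and> \<not> chk u p e then 4 else r)"
    define x'' where "x'' = (if \<exists>j < length u. chosen e v j then 3 else (2::nat))"
    have j: "win_sym r' x'' = judge u r p e v"
      unfolding r'_def x''_def by (rule chk_judge[OF len(1)])
    have b: "Suc (b + length u) < B" "0 < B" "Suc 0 < B" using B u(3) by (auto simp: Suc_le_eq)
    note sl = select_loop[where e = e and u = u and v = v and b = "b + length u" and B = B, folded x''_def]
    show ?thesis
      unfolding r'_def[symmetric] h
      using b fst
      apply (simp add: st7_simps)
      apply (rule sl)
      using u len B fst cs prems(1) b apply (simp_all add: add.assoc)
      subgoal for t2''
        using Q[of t2'' "t4'(0 := Suc 0)" x''] prems(3) B
        by (simp add: st7_simps j mult_2 add.assoc)
      done
  qed
  done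

lemma level_loop:
  assumes u: "parse u = Some [f]" "set u \<subseteq> {..<7}" "u \<noteq> []"
    and B: "Suc (length u) < B" "Suc (2 * length u * k) < B" and fst: "fst x0 < B"
    and bs: "length bs = 2 * length u * k"
    and p: "length p = length u"
    and t2: "holds_info p t2" and t4: "t4 0 = 1"
    and Q: "\<And>t2 t4 x. t4 0 = 1 \<Longrightarrow>
      Q (st7 x0 (length u, tape_of u) (length u, t2) (Suc (2 * length u * k), tape_of (cells (quants (length u) k) bs))
         (0, t4) (reg (outcome u k 2 p bs)) (reg x))"
  shows "wp 7 (\<lambda>h. h < B) level_loop
    (st7 x0 (length u, tape_of u) (length u, t2) (Suc 0, tape_of (cells (quants (length u) k) bs)) (0, t4) (reg 2) (reg x)) Q"
proof -
  define n where "n = length u"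
  define cs where "cs = cells (quants n k) bs"
  have lcs: "length cs = 2 * n * k" using bs by (simp add: cs_def n_def)
  define I where "I l s \<longleftrightarrow> (\<exists>t2 t4 x r q. s = st7 x0 (n, tape_of u) (n, t2) (Suc (2 * n * l), tape_of cs) (0, t4) (reg r) (reg x)
    \<and> holds_info q t2 \<and> length q = n \<and> t4 0 = 1 \<and> (r = 2 \<or> r = 3 \<or> r = 4)
    \<and> outcome u k 2 p bs = outcome u (k - l) r q (drop (2 * n * l) bs))" for l s
  show ?thesis unfolding level_loop_def cs_def[symmetric] n_def[symmetric]
  proof (rule wp_While_count[where n = k and I = I])
    show "I 0 (st7 x0 (n, tape_of u) (n, t2) (Suc 0, tape_of cs) (0, t4) (reg 2) (reg x))"
      unfolding I_def using t2 p t4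
      by (intro exI[of _ t2] exI[of _ t4] exI[of _ x] exI[of _ 2] exI[of _ p]) (simp add: n_def)
  next
    fix s assume "I k s"
    then show "\<not> rd 7 s 3 \<noteq> 0 \<and> Q s"
      using Q lcs unfolding I_def by (auto simp: rd_st7 tape_of_Suc n_def cs_def)
  next
    fix l s assume l: "l < k" and "I l s"
    then obtain t2 t4 x r q where s: "s = st7 x0 (n, tape_of u) (n, t2) (Suc (2 * n * l), tape_of cs) (0, t4) (reg r) (reg x)"
      and inv: "holds_info q t2" "length q = n" "t4 0 = 1" "r = 2 \<or> r = 3 \<or> r = 4"
        "outcome u k 2 p bs = outcome u (k - l) r q (drop (2 * n * l) bs)"
      unfolding I_def by blast
    define e where "e = rev (take n (drop (2 * n * l) bs))"
    define v where "v = take n (drop n (drop (2 * n * l) bs))"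
    have le: "2 * n * l + 2 * n \<le> 2 * n * k"
      using mult_le_mono2[of "Suc l" k "2 * n"] l by (simp add: algebra_simps)
    have len: "length e = n" "length v = n" using bs le by (auto simp: e_def v_def n_def)
    have n0: "0 < n" using u(3) by (simp add: n_def)
    have cs_e: "cs ! (2 * n * l + i) = (if e ! (n - Suc i) then 1 else 0)" if "i < n" for i
      using that le bs l nth_quants(1)[OF l that] by (simp add: cs_def e_def nth_cells rev_nth n_def)
    have cs_v: "cs ! (2 * n * l + n + i) = (if v ! i then 3 else 2)" if "i < n" for i
      using that le bs l nth_quants(2)[OF l that] by (simp add: cs_def v_def nth_cells n_def ac_simps)
    have out: "outcome u (k - l) r q (drop (2 * n * l) bs) =
        outcome u (k - Suc l) (judge u r q e v) (mark e v) (drop (2 * n * Suc l) bs)"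
    proof -
      obtain m where m: "k - l = Suc m" "k - Suc l = m" using l by (metis Suc_diff_Suc)
      show ?thesis unfolding m by (simp add: Let_def n_def e_def v_def add.commute)
    qed
    have pos: "2 * n * l + 2 * n = 2 * n * Suc l" by simp
    have jr: "judge u r q e v = 2 \<or> judge u r q e v = 3 \<or> judge u r q e v = 4"
      using inv(4) unfolding judge_def by presburger
    have lm: "length (mark e v) = n" using len by (simp add: mark_def)
    have step: "I (Suc l) (st7 x0 (n, tape_of u) (n, t2) (Suc (2 * n * l + 2 * n), tape_of cs) (0, t4)
        (reg (judge u r q e v)) (reg x))" if "holds_info (mark e v) t2" "t4 0 = 1" for t2 t4 x
      unfolding I_def pos using that jr lm trans[OF inv(5) out] by blast
    have B': "Suc (2 * n * l + 2 * length u) < B" using B le by (simp add: n_def)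
    have "wp 7 (\<lambda>h. h < B) level_body s (I (Suc l))"
      unfolding s
    proof (rule level_body[OF u, where e = e and p = q and v = v, folded n_def])
      show "2 * n * l + 2 * n \<le> length cs" using le lcs by simp
      show "\<And>t2 t4 x. holds_info (mark e v) t2 \<Longrightarrow> t4 0 = 1 \<Longrightarrow>
        I (Suc l) (st7 x0 (n, tape_of u) (n, t2) (Suc (2 * n * l + 2 * n), tape_of cs) (0, t4)
        (reg (judge u r q e v)) (reg x))" by (rule step)
    qed (use len inv(1-4) B(1) B' fst cs_e cs_v in \<open>simp_all add: n_def[symmetric] del: One_nat_def\<close>)
    moreover have "tape_of cs (Suc (2 * n * l)) \<noteq> 0" using lcs le n0 l by (simp add: tape_of_Suc)
    ultimately show "rd 7 s 3 \<noteq> 0 \<and> wp 7 (\<lambda>h. h < B) level_body s (I (Suc l))"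
      by (simp add: s rd_st7)
  qed
qed

definition home_loop :: com where
  "home_loop = While (\<lambda>r. r 1 \<noteq> 1) (Do (\<lambda>r. (idle r)(1 := (r 1, MoveLeft), 2 := (r 2, MoveLeft))))"

lemma home_loop:
  assumes "length u < B" "fst x0 < B" "fst x3 < B" "fst x4 < B" "fst x5 < B" "fst x6 < B"
    and Q: "Q (st7 x0 (0, tape_of u) (0, t2) x3 x4 x5 x6)"
  shows "wp 7 (\<lambda>h. h < B) home_loop (st7 x0 (length u, tape_of u) (length u, t2) x3 x4 x5 x6) Q"
  unfolding home_loop_def
  apply (rule wp_While_count[where n = "length u" and I = "\<lambda>i s. s =
      st7 x0 (length u - i, tape_of u) (length u - i, t2) x3 x4 x5 x6"])
  using assms apply (simp add: st7_simps)
  subgoal premises prems for i s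
  proof -
    obtain j where j: "length u - i = Suc j" "length u - Suc i = j" "j < length u"
      using drop_last_Suc[OF prems(1)] .
    show ?thesis using assms prems(2) j by (simp add: st7_simps tape_of_Suc)
  qed
  using assms apply (simp add: st7_simps)
  done

definition leaf :: com where
  "leaf = Seq (Do (\<lambda>r. (idle r)(3 := (r 3, MoveLeft))))
     (Seq rewind (Seq init_info (Seq level_loop home_loop)))"

lemma cells_update:
  assumes "length bs = length qs"
  shows "cells qs (bs[j := b]) = (cells qs bs)[j := (if qs ! j then 0 else 2) + (if b then 1 else 0)]"
proof (rule nth_equalityI)
  fix i assume "i < length (cells qs (bs[j := b]))"
  then have i: "i < length qs" using assms by simp
  show "cells qs (bs[j := b]) ! i = (cells qs bs)[j := (if qs ! j then 0 else 2) + (if b then 1 else 0)] ! i"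
    using i assms by (cases "i = j") (simp_all add: nth_cells)
qed simp

lemma leaf:
  assumes u: "parse u = Some [f]" "set u \<subseteq> {..<7}" "u \<noteq> []"
    and B: "Suc (length u) < B" "Suc (2 * length u * k) < B" and fst: "fst x0 < B"
    and bs: "length bs = 2 * length u * k"
    and t4: "t4 0 = 1"
    and Q: "\<And>t2 t4 x. t4 0 = 1 \<Longrightarrow>
      Q (st7 x0 (0, tape_of u) (0, t2) (Suc (2 * length u * k), tape_of (cells (quants (length u) k) bs))
         (0, t4) (reg (outcome u k 2 (root_info u) bs)) (reg x))"
  shows "wp 7 (\<lambda>h. h < B) leaf
    (st7 x0 (0, tape_of u) (0, t2) (Suc (2 * length u * k), tape_of (cells (quants (length u) k) bs)) (0, t4) (reg y) (reg x)) Q"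
proof -
  define cs where "cs = cells (quants (length u) k) bs"
  have lcs: "length cs = 2 * length u * k" using bs by (simp add: cs_def)
  have small: "\<forall>x \<in> set cs. x + 2 \<noteq> 1" by auto
  have 1: "1 < B" using B by simp
  show ?thesis
    unfolding leaf_def cs_def[symmetric]
    using B fst
    apply (simp add: wp_Seq wp_Do upd_st7 rd_st7 heads_in_st7 idle_def)
    apply (rule rewind)
    using lcs small apply simp_all
    apply (rule init_info[OF u(3)])
    using 1 B(1) apply simp_all
    apply (rule level_loop[OF u B fst bs, folded cs_def])
    using u(3) t4 apply (simp_all add: length_root_info)
    apply (rule home_loop)
    using Q apply (simp_all add: cs_def)
    done
qed

section \<open>Backtracking through the game tree\<close>

text \<open>If the first player has won the play, only another move of the opponent can matter;
  otherwise only another move of the first player can. The last such move that is still 0 gets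
  revised, and branches whose value is already settled are skipped.\<close>

definition flips :: "nat \<Rightarrow> nat \<Rightarrow> bool" where
  "flips x r \<longleftrightarrow> (if r = 3 then x = 4 else x = 2)"

definition seek :: com where
  "seek = While (\<lambda>r. r 3 \<noteq> 1 \<and> \<not> flips (r 3) (r 5)) (Do (\<lambda>r. (idle r)(3 := (r 3, MoveLeft))))"

lemma seek:
  assumes "fst x0 < B" "fst x1 < B" "fst x2 < B" "length cs < B" "fst x4 < B" "0 < B" "fst x6 < B"
    and Q: "\<And>h. \<lbrakk>h \<le> length cs; \<And>j. h \<le> j \<Longrightarrow> j < length cs \<Longrightarrow> \<not> flips (cs ! j + 2) y;
      h = 0 \<or> flips (cs ! (h - 1) + 2) y\<rbrakk> \<Longrightarrow> Q (st7 x0 x1 x2 (h, tape_of cs) x4 (reg y) x6)"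
  shows "wp 7 (\<lambda>h. h < B) seek (st7 x0 x1 x2 (length cs, tape_of cs) x4 (reg y) x6) Q"
  unfolding seek_def
proof (rule wp_While_wf[where r = "measure (\<lambda>s. fst (s 3))" and I = "\<lambda>s. \<exists>h. s = st7 x0 x1 x2 (h, tape_of cs) x4 (reg y) x6
    \<and> h \<le> length cs \<and> (\<forall>j. h \<le> j \<and> j < length cs \<longrightarrow> \<not> flips (cs ! j + 2) y)"], goal_cases)
  case (3 s)
  then obtain h where s: "s = st7 x0 x1 x2 (h, tape_of cs) x4 (reg y) x6" "h \<le> length cs"
      "\<forall>j. h \<le> j \<and> j < length cs \<longrightarrow> \<not> flips (cs ! j + 2) y" and g: "rd 7 s 3 \<noteq> 1" "\<not> flips (rd 7 s 3) (rd 7 s 5)"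
    by blast
  obtain i where h: "h = Suc i" using g s(1) by (cases h) (auto simp: rd_st7)
  have nf: "\<not> flips (cs ! i + 2) y" using g(2) s(1,2) h by (simp add: rd_st7 tape_of_Suc)
  have "\<not> flips (cs ! j + 2) y" if "i \<le> j" "j < length cs" for j
    using s(3) nf that h by (cases "i = j") auto
  then show ?case using assms s(2) h
    by (simp add: s(1) st7_simps) (simp add: st7_def)
next
  case (4 s)
  then obtain h where s: "s = st7 x0 x1 x2 (h, tape_of cs) x4 (reg y) x6" "h \<le> length cs"
      "\<forall>j. h \<le> j \<and> j < length cs \<longrightarrow> \<not> flips (cs ! j + 2) y" and g: "rd 7 s 3 = 1 \<or> flips (rd 7 s 3) (rd 7 s 5)"
    by blast
  have "h = 0 \<or> flips (cs ! (h - 1) + 2) y"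
    using g s(1,2) by (cases h) (auto simp: rd_st7 tape_of_Suc)
  then show ?case unfolding s(1) by (intro Q) (use s in auto)
qed auto

definition reset_sym :: "nat \<Rightarrow> nat" where
  "reset_sym x = (if x \<le> 3 then 2 else 4)"

definition reset_loop :: com where
  "reset_loop = While (\<lambda>r. r 3 \<noteq> 0) (Do (\<lambda>r. (idle r)(3 := (reset_sym (r 3), MoveRight))))"

lemma reset_loop:
  assumes fst: "fst x0 < B" "fst x1 < B" "fst x2 < B" "Suc (length qs) < B" "fst x4 < B" "fst x5 < B" "fst x6 < B"
    and bs: "length bs = length qs" "h \<le> length qs"
    and Q: "Q (st7 x0 x1 x2 (Suc (length qs), tape_of (cells qs (take h bs @ replicate (length qs - h) False))) x4 x5 x6)"
  shows "wp 7 (\<lambda>h. h < B) reset_loop (st7 x0 x1 x2 (Suc h, tape_of (cells qs bs)) x4 x5 x6) Q"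
proof -
  define I where "I i s \<longleftrightarrow> s = st7 x0 x1 x2 (Suc (h + i),
    tape_of (cells qs (take h bs @ replicate i False @ drop (h + i) bs))) x4 x5 x6" for i s
  show ?thesis unfolding reset_loop_def
  proof (rule wp_While_count[where n = "length qs - h" and I = I])
    show "I 0 (st7 x0 x1 x2 (Suc h, tape_of (cells qs bs)) x4 x5 x6)" by (simp add: I_def)
  next
    fix s assume "I (length qs - h) s"
    then show "\<not> rd 7 s 3 \<noteq> 0 \<and> Q s"
      using Q bs by (simp add: I_def rd_st7 tape_of_Suc)
  next
    fix i s assume i: "i < length qs - h" and I: "I i s"
    let ?b = "take h bs @ replicate i False @ drop (h + i) bs"
    let ?cs = "cells qs ?b"
    have lb: "length ?b = length qs" using bs i by simp
    have nb: "?b ! (h + i) = bs ! (h + i)" using bs i by (simp add: nth_append)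
    have c: "?cs ! (h + i) = (if qs ! (h + i) then 0 else 2) + (if bs ! (h + i) then 1 else 0)"
      using nth_cells[OF _ lb, of "h + i"] i nb by simp
    have rd: "tape_of ?cs (Suc (h + i)) = ?cs ! (h + i) + 2" using lb i by (simp add: tape_of_Suc)
    have b': "take h bs @ replicate (Suc i) False @ drop (Suc (h + i)) bs = ?b[h + i := False]"
      using bs i by (simp add: list_update_append Cons_nth_drop_Suc[symmetric] replicate_append_same[symmetric]
          del: replicate_append_same replicate_Suc) (simp add: replicate_append_same)
    have cs': "?cs[h + i := (if qs ! (h + i) then 0 else 2)] = cells qs (?b[h + i := False])"
      using cells_update[OF lb, of "h + i" False] by simp
    have upd: "(tape_of ?cs)(Suc (h + i) := reset_sym (tape_of ?cs (Suc (h + i)))) = tape_of (cells qs (?b[h + i := False]))"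
    proof -
      have "h + i < length ?cs" using lb i by simp
      from tape_of_update[OF this, of "if qs ! (h + i) then 0 else 2"] show ?thesis
        unfolding cs'[symmetric] rd c
        by (cases "qs ! (h + i)"; cases "bs ! (h + i)") (simp_all add: reset_sym_def numeral_eq_Suc)
    qed
    have nz: "tape_of ?cs (Suc (h + i)) \<noteq> 0" unfolding rd by simp
    have "I (Suc i) (st7 x0 x1 x2 (Suc (Suc (h + i)), tape_of (cells qs (?b[h + i := False]))) x4 x5 x6)"
      unfolding I_def b'[symmetric] by simp
    then show "rd 7 s 3 \<noteq> 0 \<and> wp 7 (\<lambda>h. h < B) (Do (\<lambda>r. (idle r)(3 := (reset_sym (r 3), MoveRight)))) s (I (Suc i))"
      using I nz upd fst i unfolding I_def by (simp add: st7_simps)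
  qed
qed

definition skip :: com where
  "skip = Do idle"

lemma wp_skip: "Q s \<Longrightarrow> heads_in k H s \<Longrightarrow> wp k H skip s Q"
  by (simp add: skip_def wp_Do)

definition flip_sym :: "nat \<Rightarrow> nat" where
  "flip_sym x = (if x = 2 then 3 else 5)"

definition advance :: com where
  "advance = Seq (Do (\<lambda>r. (idle r)(3 := (r 3, MoveLeft))))
     (Seq seek (Cond (\<lambda>r. r 3 \<noteq> 1)
        (Seq (Do (\<lambda>r. (idle r)(3 := (flip_sym (r 3), MoveRight)))) reset_loop) skip))"

text \<open>The next string after \<open>bs\<close> in the depth-first traversal flips position \<open>i\<close>.\<close>

definition next_at :: "bool list \<Rightarrow> bool list \<Rightarrow> bool \<Rightarrow> nat \<Rightarrow> bool" where
  "next_at qs bs v i \<longleftrightarrow> i < length qs \<and> \<not> bs ! i \<and> qs ! i \<noteq> v \<and>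
     (\<forall>j. i < j \<and> j < length qs \<longrightarrow> bs ! j \<or> qs ! j = v)"

definition exhausted :: "bool list \<Rightarrow> bool list \<Rightarrow> bool \<Rightarrow> bool" where
  "exhausted qs bs v \<longleftrightarrow> (\<forall>j < length qs. bs ! j \<or> qs ! j = v)"

lemma flips_cell:
  assumes "length bs = length qs" "j < length qs"
  shows "flips (cells qs bs ! j + 2) y \<longleftrightarrow> \<not> bs ! j \<and> qs ! j \<noteq> (y = 3)"
  using assms by (simp add: nth_cells flips_def)

lemma advance:
  assumes fst: "fst x0 < B" "fst x1 < B" "fst x2 < B" "Suc (length qs) < B" "fst x4 < B" "fst x6 < B"
    and bs: "length bs = length qs"
    and Q1: "\<And>i. next_at qs bs (y = 3) i \<Longrightarrow> Q (st7 x0 x1 x2 (Suc (length qs),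
      tape_of (cells qs (take i bs @ True # replicate (length qs - Suc i) False))) x4 (reg y) x6)"
    and Q2: "exhausted qs bs (y = 3) \<Longrightarrow> Q (st7 x0 x1 x2 (0, tape_of (cells qs bs)) x4 (reg y) x6)"
  shows "wp 7 (\<lambda>h. h < B) advance (st7 x0 x1 x2 (Suc (length qs), tape_of (cells qs bs)) x4 (reg y) x6) Q"
proof -
  define cs where "cs = cells qs bs"
  have lcs: "length cs = length qs" using bs by (simp add: cs_def)
  show ?thesis
    unfolding advance_def cs_def[symmetric] lcs[symmetric]
    using fst lcs
    apply (simp add: wp_Seq[of _ _ "Do f" for f] wp_Do upd_st7 rd_st7 heads_in_st7 idle_def)
    apply (subst wp_Seq)
    apply (rule seek[where cs = cs, unfolded lcs])
           apply simp_all[7]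
    subgoal premises prems for h
    proof (cases h)
      case 0
      have "exhausted qs bs (y = 3)"
        using prems 0 lcs flips_cell[OF bs] unfolding exhausted_def cs_def by auto
      then show ?thesis using Q2 0 fst
        by (auto simp: st7_simps cs_def intro!: wp_skip)
    next
      case (Suc i)
      have i: "i < length qs" "flips (cs ! i + 2) y" using prems Suc lcs by auto
      have "next_at qs bs (y = 3) i"
        using prems(8,9) Suc lcs i flips_cell[OF bs] unfolding next_at_def cs_def by (auto simp: Suc_le_eq)
      moreover have c: "cs ! i + 2 = (if qs ! i then 2 else 4)"
        using i flips_cell[OF bs i(1)] bs by (simp add: cs_def nth_cells)
      have rd: "tape_of cs (Suc i) = (if qs ! i then 2 else 4)" using c i lcs by (simp add: tape_of_Suc)
      have upd: "(tape_of cs)(Suc i := flip_sym (tape_of cs (Suc i))) = tape_of (cells qs (bs[i := True]))"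
        unfolding rd cells_update[OF bs] using i(1) lcs tape_of_update[of i cs "if qs ! i then 1 else 3"]
        by (simp add: flip_sym_def cs_def numeral_eq_Suc split: if_splits)
      have ne: "tape_of cs (Suc i) \<noteq> Suc 0" unfolding rd by simp
      have tk: "take (Suc i) (bs[i := True]) = take i bs @ [True]"
        using i bs by (simp add: take_Suc_conv_app_nth)
      have "wp 7 (\<lambda>h. h < B) reset_loop
          (st7 x0 x1 x2 (Suc (Suc i), tape_of (cells qs (bs[i := True]))) x4 (reg y) x6) Q"
        by (rule reset_loop) (use fst bs i Q1[of i] \<open>next_at qs bs (y = 3) i\<close> in \<open>simp_all add: tk\<close>)
      then show ?thesis using ne upd fst i lcs Suc by (simp add: st7_simps)
    qed
    done
qed

text \<open>Going back from the leaf, the value never changes. At a set bit the 0-branch turned out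
  neutral for its quantifier; at an unset bit the quantifier belongs to the winner of the play, for
  whom one good branch suffices.\<close>

lemma exhausted_value:
  assumes inv: "\<And>i. i < length qs \<Longrightarrow> bs ! i \<Longrightarrow>
      gval (drop (Suc i) qs) (\<lambda>z. P (take i bs @ False # z)) = (\<not> qs ! i)"
    and len: "length bs = length qs" and h: "h \<le> length qs"
    and stop: "\<forall>j. h \<le> j \<and> j < length qs \<longrightarrow> bs ! j \<or> qs ! j = P bs"
  shows "gval (drop h qs) (\<lambda>z. P (take h bs @ z)) = P bs"
  using h stop
proof (induction "length qs - h" arbitrary: h)
  case 0
  then show ?case using len by simp
next
  case (Suc d)
  then have h: "h < length qs" by simp
  have IH: "gval (drop (Suc h) qs) (\<lambda>z. P (take (Suc h) bs @ z)) = P bs"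
    using Suc by simp
  have d: "drop h qs = qs ! h # drop (Suc h) qs" using h by (simp add: Cons_nth_drop_Suc)
  have t: "take (Suc h) bs = take h bs @ [bs ! h]" using h len by (simp add: take_Suc_conv_app_nth)
  show ?case
  proof (cases "bs ! h")
    case True
    then show ?thesis using inv[OF h True] IH unfolding d t by simp
  next
    case False
    then have "qs ! h = P bs" using Suc.prems(2) h by blast
    then show ?thesis using IH False unfolding d t by auto
  qed
qed

text \<open>A set bit records that the 0-branch has been explored without settling the quantifier:
  it was false below an existential or true below a universal one.\<close>

definition visited :: "bool list \<Rightarrow> (bool list \<Rightarrow> bool) \<Rightarrow> bool list \<Rightarrow> bool" where
  "visited qs P bs \<longleftrightarrow> length bs = length qs \<and> (\<forall>i < length qs. bs ! i \<longrightarrow>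
     gval (drop (Suc i) qs) (\<lambda>z. P (take i bs @ False # z)) = (\<not> qs ! i))"

lemma visited_exhausted: "visited qs P bs \<Longrightarrow> exhausted qs bs (P bs) \<Longrightarrow> gval qs P = P bs"
  using exhausted_value[of qs bs P 0] by (simp add: visited_def exhausted_def)

lemma visited_next:
  assumes "visited qs P bs" "next_at qs bs (P bs) i"
  shows "visited qs P (take i bs @ True # replicate (length qs - Suc i) False)" (is "visited qs P ?b")
proof -
  have i: "i < length qs" "\<not> bs ! i" "qs ! i \<noteq> P bs" and len: "length bs = length qs"
    using assms by (auto simp: visited_def next_at_def)
  \<comment> \<open>The branch with 0 at \<open>i\<close> is finished with the value
    \<open>P bs\<close>, which is the value neutral for the quantifier at \<open>i\<close>, as
    \<open>qs ! i\<close> differs from it.\<close>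
  have val: "gval (drop (Suc i) qs) (\<lambda>z. P (take (Suc i) bs @ z)) = P bs"
    by (rule exhausted_value) (use assms len i(1) in \<open>auto simp: visited_def next_at_def\<close>)
  have t: "take (Suc i) bs = take i bs @ [False]" using i len by (simp add: take_Suc_conv_app_nth)
  have "gval (drop (Suc j) qs) (\<lambda>z. P (take j ?b @ False # z)) = (\<not> qs ! j)" if j: "j < length qs" "?b ! j" for j
  proof -
    consider "j < i" | "j = i" | "i < j" by linarith
    then show ?thesis
    proof cases
      case 1
      then have "bs ! j" "take j ?b = take j bs" using j(2) i len by (auto simp: nth_append)
      then show ?thesis using assms(1) j(1) by (simp add: visited_def)
    next
      case 2
      then show ?thesis using val i len unfolding t by auto
    next
      case 3
      then have "?b ! j = (True # replicate (length qs - Suc i) False) ! (j - i)" using i len by (simp add: nth_append)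
      also have "\<dots> = False" using 3 j(1) by (cases "j - i") auto
      finally show ?thesis using j(2) by simp
    qed
  qed
  then show ?thesis using i len by (simp add: visited_def)
qed

text \<open>Each string taken up by the search is larger than the previous one as a binary number,
  which makes the search terminate.\<close>

primrec bin :: "bool list \<Rightarrow> nat" where
  "bin [] = 0"
| "bin (b # bs) = (if b then 2 ^ length bs else 0) + bin bs"

lemma bin_less: "bin bs < 2 ^ length bs"
  by (induction bs) auto

lemma bin_append_less: "bin ys < bin zs \<Longrightarrow> length ys = length zs \<Longrightarrow> bin (xs @ ys) < bin (xs @ zs)"
  by (induction xs) auto

lemma bin_next:
  assumes "i < length qs" "\<not> bs ! i" "length bs = length qs"
  shows "bin bs < bin (take i bs @ True # replicate (length qs - Suc i) False)"
proof -
  have bs: "bs = take i bs @ False # drop (Suc i) bs" using assms id_take_nth_drop[of i bs] by simp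
  have "bin (take i bs @ False # drop (Suc i) bs) < bin (take i bs @ True # replicate (length qs - Suc i) False)"
    by (rule bin_append_less) (use bin_less[of "drop (Suc i) bs"] assms in \<open>auto intro: less_le_trans\<close>)
  then show ?thesis using bs by simp
qed

text \<open>The symbols for a set bit are 3 and 5, the odd ones of both players.\<close>

definition bits_of :: "nat \<Rightarrow> (nat \<Rightarrow> nat) \<Rightarrow> bool list" where
  "bits_of m t = map (\<lambda>j. odd (t (Suc j))) [0..<m]"

lemma bits_of_cells:
  assumes "length bs = length qs"
  shows "bits_of (length qs) (tape_of (cells qs bs)) = bs"
  by (rule nth_equalityI) (use assms in \<open>auto simp: bits_of_def tape_of_Suc nth_cells\<close>)

definition search :: com where
  "search = While (\<lambda>r. r 3 \<noteq> 1) (Seq leaf advance)"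

lemma search:
  assumes u: "parse u = Some [f]" "set u \<subseteq> {..<7}" "u \<noteq> []" "0 < k"
    and B: "Suc (length u) < B" "Suc (2 * length u * k) < B" and fst: "fst x0 < B"
    and t4: "t4 0 = 1"
    and Q: "\<And>s. rd 7 s 5 = 3 \<longleftrightarrow> wins u k (root_info u) \<Longrightarrow> Q s"
  shows "wp 7 (\<lambda>h. h < B) search (st7 x0 (0, tape_of u) (0, t2) (Suc (2 * length u * k), tape_of (fresh (length u) k))
     (0, t4) (reg y) (reg x)) Q"
proof -
  define m where "m = 2 * length u * k"
  define qs where "qs = quants (length u) k"
  define P where "P bs \<longleftrightarrow> outcome u k 2 (root_info u) bs = 3" for bs
  have lq: "length qs = m" by (simp add: qs_def m_def)
  have win: "gval qs P = wins u k (root_info u)"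
    unfolding qs_def P_def by (rule gval_outcome)
  define going where "going bs s \<longleftrightarrow> (\<exists>t2 t4 y x. s = st7 x0 (0, tape_of u) (0, t2) (Suc m, tape_of (cells qs bs))
     (0, t4) (reg y) (reg x) \<and> t4 0 = 1) \<and> visited qs P bs" for bs s
  define fin where "fin s \<longleftrightarrow> rd 7 s 3 = 1 \<and> fst (s 3) = 0 \<and> (rd 7 s 5 = 3 \<longleftrightarrow> gval qs P)" for s
  \<comment> \<open>Head 3 in cell 0 signals the end of the search and gets measure 0. A state with
    a pending play has positive measure, since the number of an \<open>m\<close>-bit string is below
    \<open>2 ^ m\<close>.\<close>
  define mu where "mu s = (if fst (s 3) = 0 then 0 else 2 ^ m - bin (bits_of m (snd (s 3))))" for s :: st
  have mu: "mu s = 2 ^ m - bin bs" if "going bs s" for bs s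
    using that bits_of_cells[of bs qs] lq unfolding going_def mu_def visited_def by (auto simp: st7_def)
  have step: "wp 7 (\<lambda>h. h < B) (Seq leaf advance) s (\<lambda>s'. (fin s' \<or> (\<exists>bs. going bs s')) \<and> mu s' < mu s)"
    if g: "going bs s" for bs s
  proof -
    from g obtain t2 t4 y x where s: "s = st7 x0 (0, tape_of u) (0, t2) (Suc m, tape_of (cells qs bs)) (0, t4) (reg y) (reg x)"
      and t4: "t4 0 = 1" and vis: "visited qs P bs" unfolding going_def by blast
    have len: "length bs = m" using vis lq by (simp add: visited_def)
    have mus: "mu s = 2 ^ m - bin bs" by (rule mu[OF g])
    have pos: "bin bs < 2 ^ m" using bin_less[of bs] len by simp
    define z where "z = outcome u k 2 (root_info u) bs"
    have z: "P bs = (z = 3)" by (simp add: P_def z_def)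
    have 0: "0 < B" using B by simp
    have adv: "wp 7 (\<lambda>h. h < B) advance (st7 x0 (0, tape_of u) (0, t2') (Suc m, tape_of (cells qs bs)) (0, t4') (reg z) (reg x'))
        (\<lambda>s'. (fin s' \<or> (\<exists>bs. going bs s')) \<and> mu s' < mu s)" if t4': "t4' 0 = 1" for t2' t4' x'
      unfolding lq[symmetric]
    proof (rule advance)
      fix i assume n: "next_at qs bs (z = 3) i"
      let ?b = "take i bs @ True # replicate (length qs - Suc i) False"
      let ?s = "st7 x0 (0, tape_of u) (0, t2') (Suc (length qs), tape_of (cells qs ?b)) (0, t4') (reg z) (reg x')"
      have "visited qs P ?b" by (rule visited_next) (use vis n z in auto)
      then have g': "going ?b ?s" unfolding going_def using t4' lq by blast
      moreover have "bin bs < bin ?b" by (rule bin_next) (use n len lq in \<open>auto simp: next_at_def\<close>)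
      ultimately show "(fin ?s \<or> (\<exists>bs. going bs ?s)) \<and> mu ?s < mu s"
        using mu[OF g'] mus pos by auto
    next
      assume "exhausted qs bs (z = 3)"
      then have "gval qs P = (z = 3)" using visited_exhausted[OF vis] z by simp
      then show "(fin (st7 x0 (0, tape_of u) (0, t2') (0, tape_of (cells qs bs)) (0, t4') (reg z) (reg x')) \<or>
         (\<exists>bs'. going bs' (st7 x0 (0, tape_of u) (0, t2') (0, tape_of (cells qs bs)) (0, t4') (reg z) (reg x')))) \<and>
         mu (st7 x0 (0, tape_of u) (0, t2') (0, tape_of (cells qs bs)) (0, t4') (reg z) (reg x')) < mu s"
        using mus pos by (simp add: fin_def rd_st7 mu_def) (simp add: st7_def)
    qed (use fst 0 B lq len in \<open>auto simp: m_def\<close>)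
    show ?thesis
      unfolding wp_Seq s m_def qs_def
      by (rule leaf[OF u(1-3) B fst])
        (use adv len t4 in \<open>simp_all add: m_def qs_def z_def s\<close>)
  qed
  have "wp 7 (\<lambda>h. h < B) search (st7 x0 (0, tape_of u) (0, t2) (Suc m, tape_of (cells qs (replicate m False)))
     (0, t4) (reg y) (reg x)) Q"
    unfolding search_def
  proof (rule wp_While_wf[where r = "measure mu" and I = "\<lambda>s. fin s \<or> (\<exists>bs. going bs s)"], goal_cases)
    case 2
    have "going (replicate m False) (st7 x0 (0, tape_of u) (0, t2) (Suc m, tape_of (cells qs (replicate m False)))
       (0, t4) (reg y) (reg x))"
      unfolding going_def visited_def using t4 lq by auto
    then show ?case by blast
  next
    case (3 s)
    then obtain bs where "going bs s" by (auto simp: fin_def)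
    from step[OF this] show ?case by simp
  next
    case (4 s)
    have "\<not> going bs s" for bs
    proof
      assume "going bs s"
      then have "rd 7 s 3 = tape_of (cells qs bs) (Suc m)" "length bs = m"
        using lq unfolding going_def visited_def by (auto simp: rd_st7)
      then show False using 4 lq by (simp add: tape_of_Suc)
    qed
    then have "fin s" using 4 by blast
    then show ?case using Q win by (simp add: fin_def)
  qed simp
  then show ?thesis by (simp add: fresh_cells m_def qs_def)
qed

section \<open>The decision procedure\<close>

definition decider :: com where
  "decider = Seq (Do (\<lambda>r. (idle r)(1 := (r 1, MoveRight))))
     (Seq (Do (\<lambda>r. (idle r)(0 := (r 0, MoveRight), 1 := (8, MoveRight))))
     (Seq copy_loop
     (Seq (Do (\<lambda>r. (idle r)(1 := (r 1, MoveLeft), 5 := (2, Stay))))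
     (Seq parse_loop
     (Seq (Do (\<lambda>r. (idle r)(4 := (r 4, MoveLeft))))
     (Seq (Do (\<lambda>r. (idle r)(5 := (if r 5 = 2 \<and> r 4 = 1 then 2 else 4, Stay))))
     (Cond (\<lambda>r. r 5 = 2)
       (Seq (Do (\<lambda>r. (idle r)(1 := (r 1, MoveRight), 3 := (r 3, MoveRight))))
       (Seq fill_levels (Seq (Do (\<lambda>r. (idle r)(1 := (r 1, MoveLeft)))) search)))
       skip)))))))"

text \<open>Nine symbols: the blank, the end marker and seven letters. The codes for moves,
  constraints, truth values and verdicts reuse them.\<close>

lemma wf_decider: "wf_com 7 9 decider"
  unfolding decider_def copy_loop_def parse_loop_def fill_levels_def fill_right_def fill_left_def
    search_def leaf_def advance_def rewind_def init_info_def init_info_loop_def level_loop_def level_body_def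
    eval_loop_def select_loop_def home_loop_def seek_def reset_loop_def skip_def
  by (simp add: idle_def val_sym_def info_sym_def verdict_sym_def select_sym_def select_flag_def
      win_sym_def flip_sym_def reset_sym_def)

lemma SAT_iff: "w \<in> SAT TYPE('w) \<longleftrightarrow> (\<exists>\<phi>. parse w = Some [\<phi>] \<and> satisfiable TYPE('w) \<phi>)"
  by (auto simp: SAT_def parse_single)

text \<open>The leading term of \<open>B\<close> is the string of moves: two moves of
  \<open>length u\<close> bits in each of \<open>length u\<close> rounds, where
  \<open>length u = Suc (length w)\<close>.\<close>

lemma decider:
  assumes inf: "infinite (UNIV :: 'w set)" and w: "w \<in> lists {..<7}"
    and B: "B = 2 * Suc (length w) * Suc (length w) + Suc (length w) + 3"
  shows "wp 7 (\<lambda>h. h < B) decider (init_st w) (\<lambda>s. rd 7 s 5 = 3 \<longleftrightarrow> w \<in> SAT TYPE('w))"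
proof -
  define u where "u = 6 # w"
  have u: "set u \<subseteq> {..<7}" "u \<noteq> []" "length u = Suc (length w)" using w by (auto simp: u_def)
  have pu: "parse u = Option.bind (parse w) (build 6)" by (simp add: u_def)
  have bounds: "0 < B" "1 < B" "2 < B" "3 < B" "Suc (length w) < B" "length w + 2 < B" "Suc (length u) < B" "length u < B"
      "Suc (2 * length u * length u) < B"
    using B u(3) by auto
  have 8: "(tape_of [])(Suc 0 := 8) = tape_of [6]" using tape_of_append[of "[]" 6] by simp
  have init: "init_st w = st7 (0, tape_of w) (0, tape_of []) (0, tape_of []) (0, tape_of [])
    (0, tape_of []) (reg 1) (reg 1)" by (simp add: init_st7 reg_init)
  have SAT: "w \<in> SAT TYPE('w) \<longleftrightarrow> (\<exists>\<phi>. parse u = Some [\<phi>]) \<and> wins u (length u) (root_info u)"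
  proof
    assume "w \<in> SAT TYPE('w)"
    then obtain \<phi> where p: "parse w = Some [\<phi>]" "satisfiable TYPE('w) \<phi>" by (auto simp: SAT_iff)
    then have "u = 6 # encode \<phi>" by (simp add: u_def parse_single)
    then show "(\<exists>\<phi>. parse u = Some [\<phi>]) \<and> wins u (length u) (root_info u)"
      using wins_iff_satisfiable[OF inf, of u \<phi>] p(2) unfolding pu p(1) by (simp add: build_def)
  next
    assume *: "(\<exists>\<phi>. parse u = Some [\<phi>]) \<and> wins u (length u) (root_info u)"
    then obtain \<psi> where "parse u = Some [\<psi>]" by blast
    then obtain \<phi> where p: "parse w = Some [\<phi>]"
      unfolding pu by (auto simp: build_def split: bind_splits list.splits)
    then have "u = 6 # encode \<phi>" by (simp add: u_def parse_single)
    then show "w \<in> SAT TYPE('w)" using wins_iff_satisfiable[OF inf] * p by (auto simp: SAT_iff)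
  qed
  define Q where "Q = (\<lambda>s. rd 7 s 5 = 3 \<longleftrightarrow> w \<in> SAT TYPE('w))"
  have main: "wp 7 (\<lambda>h. h < B)
     (Seq (Do (\<lambda>r. (idle r)(1 := (r 1, MoveRight), 3 := (r 3, MoveRight))))
       (Seq fill_levels (Seq (Do (\<lambda>r. (idle r)(1 := (r 1, MoveLeft)))) search)))
     (st7 (length u, tape_of w) (0, tape_of u) (0, tape_of []) (0, tape_of []) (0, tape_of []) (reg 2) (reg 1)) Q"
    if p: "parse u = Some [\<phi>]" for \<phi>
  proof -
    have Qs: "Q s" if "rd 7 s 5 = 3 \<longleftrightarrow> wins u (length u) (root_info u)" for s
      using that SAT p by (auto simp: Q_def)
    have srch: "wp 7 (\<lambda>h. h < B) search (st7 (0, tape_of w) (0, tape_of u) (0, tape_of [])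
        (Suc (2 * length u * length u), tape_of (fresh (length u) (length u))) (0, tape_of []) (reg 2) (reg 1)) Q"
      by (rule search[OF p u(1,2)]) (use u Qs bounds in auto)
    show ?thesis
      using bounds
      apply (simp add: st7_simps)
      apply (rule fill_levels)
      using u apply (simp_all add: tape_of_Suc)
      using srch apply (simp add: st7_simps u(3))
      done
  qed
  have check: "wp 7 (\<lambda>h. h < B) (Seq (Do (\<lambda>r. (idle r)(4 := (r 4, MoveLeft))))
     (Seq (Do (\<lambda>r. (idle r)(5 := (if r 5 = 2 \<and> r 4 = 1 then 2 else 4, Stay))))
     (Cond (\<lambda>r. r 5 = 2)
       (Seq (Do (\<lambda>r. (idle r)(1 := (r 1, MoveRight), 3 := (r 3, MoveRight))))
       (Seq fill_levels (Seq (Do (\<lambda>r. (idle r)(1 := (r 1, MoveLeft)))) search)))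
       skip)))
     (st7 (length u, tape_of w) (0, tape_of u) (0, tape_of []) (0, tape_of [])
       (h, tape_of []) (reg (if parse u = None then 4 else 2)) (reg 1)) Q"
    if h: "h \<le> length u" "\<And>fs. parse u = Some fs \<Longrightarrow> h = length fs" for h
  proof -
    \<comment> \<open>Head 4 stands at the height \<open>h\<close>, which is not 0 after a
      successful parse. So the marker is met one step to the left exactly when a single formula has
      been read.\<close>
    have t0: "tape_of [] (h - 1) = Suc 0 \<longleftrightarrow> h \<le> 1" by (simp add: tape_of_def)
    have "parse u \<noteq> Some []" unfolding pu by (auto simp: build_def split: bind_splits list.splits)
    then have one: "(\<exists>\<phi>. parse u = Some [\<phi>]) \<longleftrightarrow> parse u \<noteq> None \<and> h \<le> 1"
      using h(2) by (cases "parse u") (auto simp: length_Suc_conv le_Suc_eq)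
    show ?thesis
    proof (cases "\<exists>\<phi>. parse u = Some [\<phi>]")
      case True
      then obtain \<phi> where p: "parse u = Some [\<phi>]" by blast
      then have "h = 1" using h(2) by simp
      then show ?thesis using main[OF p] bounds p u
        by (simp add: wp_Seq[of _ _ "Do f" for f] wp_Do wp_Cond upd_st7 rd_st7 heads_in_st7 idle_def)
    next
      case False
      then have "Q s" if "rd 7 s 5 = 4" for s using SAT that by (auto simp: Q_def)
      moreover have "\<not> (parse u \<noteq> None \<and> h \<le> 1)" using False one by simp
      ultimately show ?thesis using bounds u h(1) t0
        by (cases "parse u") (auto simp: wp_Seq[of _ _ "Do f" for f] wp_Do wp_Cond upd_st7 rd_st7 heads_in_st7 idle_def
            intro!: wp_skip)
    qed
  qed
  show ?thesis
    unfolding decider_def Q_def[symmetric]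
    using bounds
    apply (simp add: wp_Seq[of _ _ "Do f" for f] wp_Do upd_st7 rd_st7 heads_in_st7 idle_def init 8)
    apply (subst wp_Seq)
    apply (rule copy_loop)
    using bounds apply simp_all
    apply (simp add: wp_Seq[of _ _ "Do f" for f] wp_Do upd_st7 rd_st7 heads_in_st7 idle_def)
    apply (subst wp_Seq)
    using check u apply (simp add: u_def[symmetric])
    apply (rule parse_loop[where u = u, unfolded u(3)])
    apply simp_all
    done
qed

theorem SAT_in_PSPACE:
  assumes inf: "infinite (UNIV :: 'w set)"
  shows "in_PSPACE 7 (SAT TYPE('w))"
proof -
  obtain M where M: "wf_tm M" "num_symbols M = 9"
    and res: "\<And>w t s' H. exec 7 H decider (init_st w) t s' \<Longrightarrow> H 0 \<Longrightarrow>
       config_at M w (Suc t) = (if rd 7 s' 5 = 3 then accept_state M else reject_state M, map s' [0..<7])"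
    and heads: "\<And>w t s' H i. exec 7 H decider (init_st w) t s' \<Longrightarrow> H 0 \<Longrightarrow>
       \<forall>(h, _) \<in> set (snd (config_at M w i)). H h"
  proof (rule compile[OF _ wf_decider, of "\<lambda>r. r 5 = 3"])
  qed (simp_all add: that)
  \<comment> \<open>The coefficients of \<open>2 * (n + 1) ^ 2 + (n + 1) + 3\<close>.\<close>
  define p :: "nat poly" where "p = [:6, 5, 2:]"
  have p: "poly p n = 2 * Suc n * Suc n + Suc n + 3" for n
    by (simp add: p_def algebra_simps)
  have "(\<exists>i. fst (config_at M w i) = (if w \<in> SAT TYPE('w) then accept_state M else reject_state M)) \<and>
        (\<forall>i. \<forall>(h, t) \<in> set (snd (config_at M w i)). h < poly p (length w))" if w: "w \<in> lists {..<7}" for w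
  proof -
    obtain t s' where ex: "exec 7 (\<lambda>h. h < poly p (length w)) decider (init_st w) t s'"
      and s': "rd 7 s' 5 = 3 \<longleftrightarrow> w \<in> SAT TYPE('w)"
      using decider[OF inf w p] unfolding wp_def by blast
    have 0: "0 < poly p (length w)" by (simp add: p)
    have "fst (config_at M w (Suc t)) = (if w \<in> SAT TYPE('w) then accept_state M else reject_state M)"
      unfolding res[OF ex 0] s' by simp
    then show ?thesis using heads[OF ex 0] by blast
  qed
  then have "decides_in_space M 7 (SAT TYPE('w)) (poly p)"
    using M by (auto simp: decides_in_space_def)
  moreover have "SAT TYPE('w) \<subseteq> lists {..<7}" using encode_lists by (auto simp: SAT_def)
  ultimately show ?thesis unfolding in_PSPACE_def by blast
qed

section \<open>Computations as modal formulas\<close>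

text \<open>A halting state is treated as a transition that rewrites the scanned symbols and stays,
  so the one-step condition needs no separate case for it.\<close>

definition nxt :: "tm \<Rightarrow> nat \<Rightarrow> nat list \<Rightarrow> nat \<times> (nat \<times> move) list" where
  "nxt M q xs = (if halting_state M q then (q, map (\<lambda>x. (x, Stay)) xs) else trans_fun M q xs)"

definition reads :: "tape list \<Rightarrow> nat list" where
  "reads ts = map (\<lambda>(h, t). t h) ts"

lemma step_nxt: "step M (q, ts) = (fst (nxt M q (reads ts)), map2 act (snd (nxt M q (reads ts))) ts)"
proof -
  have "map2 act (map (\<lambda>x. (x, Stay)) (reads ts)) ts = ts"
    by (rule nth_equalityI) (auto simp: reads_def split: prod.splits)
  then show ?thesis by (auto simp: nxt_def reads_def split: prod.splits)
qed

lemma nxt_wf: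
  assumes "wf_tm M" "q < num_states M" "length xs = num_tapes M" "set xs \<subseteq> {..<num_symbols M}"
  shows "fst (nxt M q xs) < num_states M" "length (snd (nxt M q xs)) = num_tapes M"
    "i < num_tapes M \<Longrightarrow> fst (snd (nxt M q xs) ! i) < num_symbols M"
proof -
  obtain q' acts where t: "trans_fun M q xs = (q', acts)" by (cases "trans_fun M q xs")
  have "\<forall>q < num_states M. \<forall>xs. length xs = num_tapes M \<and> set xs \<subseteq> {..<num_symbols M} \<longrightarrow>
      (case trans_fun M q xs of (q', acts) \<Rightarrow> q' < num_states M \<and> length acts = num_tapes M \<and>
      (\<forall>(s, d) \<in> set acts. s < num_symbols M))"
    using assms(1) unfolding wf_tm_def by (elim conjE)
  then have "case trans_fun M q xs of (q', acts) \<Rightarrow> q' < num_states M \<and> length acts = num_tapes M \<and>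
      (\<forall>(s, d) \<in> set acts. s < num_symbols M)"
    using assms(2-4) by simp
  then have *: "q' < num_states M" "length acts = num_tapes M" "\<forall>(s, d) \<in> set acts. s < num_symbols M"
    unfolding t by simp_all
  show "fst (nxt M q xs) < num_states M" "length (snd (nxt M q xs)) = num_tapes M"
    using assms(2,3) * by (simp_all add: nxt_def t)
  show "fst (snd (nxt M q xs) ! i) < num_symbols M" if i: "i < num_tapes M"
  proof (cases "halting_state M q")
    case True
    have "xs ! i < num_symbols M" using subsetD[OF assms(4) nth_mem[of i xs]] assms(3) i by simp
    then show ?thesis using True assms(3) i by (simp add: nxt_def)
  next
    case False
    have "acts ! i \<in> set acts" using *(2) i by simp
    from bspec[OF *(3) this] have "fst (acts ! i) < num_symbols M" by (simp add: case_prod_beta)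
    then show ?thesis using False by (simp add: nxt_def t)
  qed
qed

definition wf_config :: "tm \<Rightarrow> config \<Rightarrow> bool" where
  "wf_config M C \<longleftrightarrow> fst C < num_states M \<and> length (snd C) = num_tapes M \<and>
     (\<forall>i < num_tapes M. \<forall>j. snd (snd C ! i) j < num_symbols M)"

lemma reads_wf:
  assumes "wf_config M (q, ts)"
  shows "length (reads ts) = num_tapes M" "set (reads ts) \<subseteq> {..<num_symbols M}"
    "i < num_tapes M \<Longrightarrow> reads ts ! i = snd (ts ! i) (fst (ts ! i))"
proof -
  show l: "length (reads ts) = num_tapes M" using assms by (simp add: wf_config_def reads_def)
  show n: "i < num_tapes M \<Longrightarrow> reads ts ! i = snd (ts ! i) (fst (ts ! i))" for i
    using assms by (simp add: wf_config_def reads_def case_prod_beta)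
  show "set (reads ts) \<subseteq> {..<num_symbols M}"
    using assms n l by (auto simp: in_set_conv_nth wf_config_def)
qed

lemma snd_act: "snd (act a x) = (snd x)(fst x := fst a)"
  by (cases a; cases x) simp

lemma wf_config_step:
  assumes "wf_tm M" "wf_config M C"
  shows "wf_config M (step M C)"
proof -
  obtain q ts where C: "C = (q, ts)" by (cases C)
  have wf: "wf_config M (q, ts)" using assms C by simp
  then have q: "q < num_states M" by (simp add: wf_config_def)
  note nw = nxt_wf[OF assms(1) q reads_wf(1,2)[OF wf]]
  show ?thesis
    using nw wf by (auto simp: C step_nxt wf_config_def snd_act simp del: step.simps)
qed

lemma wf_config_at:
  assumes M: "wf_tm M" and n: "n + 2 \<le> num_symbols M" and w: "w \<in> lists {..<n}"
  shows "wf_config M (config_at M w i)"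
proof (induction i)
  case 0
  have t: "tape_of v j < num_symbols M" if "v \<in> lists {..<n}" for v j
  proof -
    have "v ! (j - 1) < n" if "0 < j" "j \<le> length v"
      using \<open>v \<in> lists {..<n}\<close> that nth_mem[of "j - 1" v] by auto
    then show ?thesis using n by (fastforce simp: tape_of_def)
  qed
  have k: "0 < num_tapes M" using M by (simp add: wf_tm_def)
  have "snd (snd (init_config M w) ! i) j < num_symbols M" if "i < num_tapes M" for i j
    using that t[OF w] t[of "[]"] by (cases i) (auto simp: init_config_def)
  then show ?case using M k by (auto simp: config_at_def wf_config_def wf_tm_def init_config_def)
next
  case (Suc i)
  then show ?case using wf_config_step[OF M] by (simp add: config_at_def)
qed

definition heads_below :: "tm \<Rightarrow> nat \<Rightarrow> config \<Rightarrow> bool" where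
  "heads_below M S C \<longleftrightarrow> (\<forall>i < num_tapes M. fst (snd C ! i) < S)"

lemma config_at_Suc: "config_at M w (Suc i) = step M (config_at M w i)"
  by (simp add: config_at_def)

lemma config_at_add: "config_at M w (i + d) = (step M ^^ d) (config_at M w i)"
  by (simp add: config_at_def funpow_add add.commute[of i])

text \<open>For the counting argument: the cells below \<open>S\<close>, the heads and the state
  determine a configuration of the run.\<close>

lemma unvisited:
  assumes wf: "\<And>i. wf_config M (config_at M w i)" "wf_tm M"
    and S: "\<And>i. heads_below M S (config_at M w i)" and \<tau>: "\<tau> < num_tapes M" and j: "S \<le> j"
  shows "snd (snd (config_at M w i) ! \<tau>) j = snd (snd (config_at M w 0) ! \<tau>) j"
proof (induction i)
  case (Suc i)
  obtain q ts where C: "config_at M w i = (q, ts)" by (cases "config_at M w i")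
  have wfC: "wf_config M (q, ts)" using wf(1)[of i] C by simp
  then have q: "q < num_states M" by (simp add: wf_config_def)
  have "snd (snd (config_at M w (Suc i)) ! \<tau>) = (snd (ts ! \<tau>))(fst (ts ! \<tau>) := fst (snd (nxt M q (reads ts)) ! \<tau>))"
    using nxt_wf(2)[OF wf(2) q reads_wf(1,2)[OF wfC]] wfC \<tau>
    by (simp add: config_at_Suc C step_nxt snd_act wf_config_def del: step.simps)
  moreover have "fst (ts ! \<tau>) \<noteq> j" using S[of i] \<tau> j C by (auto simp: heads_below_def)
  ultimately show ?case using Suc C by simp
qed simp

lemma config_at_halted:
  assumes "halting_state M (fst (config_at M w i))"
  shows "config_at M w (i + d) = config_at M w i"
proof (induction d)
  case (Suc d)
  then show ?case using assms by (cases "config_at M w i") (simp add: config_at_Suc)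
qed simp

text \<open>A configuration repeated before the first halt would yield an earlier halt, so the
  configurations up to then are distinct. The exponent is rounded up to a constant of the machine
  times \<open>Suc S\<close>, the form in which the levels can be printed by a loop.\<close>

lemma halts_early:
  assumes wf: "\<And>i. wf_config M (config_at M w i)" "wf_tm M"
    and S: "\<And>i. heads_below M S (config_at M w i)"
    and halt: "\<exists>i. halting_state M (fst (config_at M w i))"
  shows "\<exists>i \<le> 2 ^ ((num_states M + num_tapes M + num_tapes M * num_symbols M) * Suc S).
    halting_state M (fst (config_at M w i))"
proof -
  define Q where "Q = num_states M"
  define k where "k = num_tapes M"
  define G where "G = num_symbols M"
  define T where "T = (LEAST i. halting_state M (fst (config_at M w i)))"
  have T: "halting_state M (fst (config_at M w T))" unfolding T_def by (rule LeastI_ex[OF halt])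
  have least: "\<not> halting_state M (fst (config_at M w i))" if "i < T" for i
    using not_less_Least that unfolding T_def by blast
  define tp :: "tape \<Rightarrow> nat \<times> nat list" where "tp x = (fst x, map (snd x) [0..<S])" for x
  define f where "f i = (fst (config_at M w i), map tp (snd (config_at M w i)))" for i
  define X where "X = {..<Q} \<times> {l. set l \<subseteq> {..<S} \<times> {l. set l \<subseteq> {..<G} \<and> length l = S} \<and> length l = k}"
  have finL: "finite {l. set l \<subseteq> {..<G} \<and> length l = S}" by (rule finite_lists_length_eq) simp
  have cL: "card {l. set l \<subseteq> {..<G} \<and> length l = S} = G ^ S" by (simp add: card_lists_length_eq)
  have finX: "finite X" unfolding X_def by (intro finite_cartesian_product finite_lists_length_eq finL) auto
  have cX: "card X = Q * (S * G ^ S) ^ k"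
    unfolding X_def by (simp add: card_cartesian_product card_lists_length_eq finL cL)
  have inj: "inj_on f {..<T}"
  proof (rule linorder_inj_onI)
    fix i i' assume ii: "i < i'" "i \<in> {..<T}" "i' \<in> {..<T}"
    show "f i \<noteq> f i'"
    proof
      assume eq: "f i = f i'"
      have l: "length (snd (config_at M w i)) = k" for i using wf(1)[of i] by (simp add: wf_config_def k_def)
      have "snd (config_at M w i) ! \<tau> = snd (config_at M w i') ! \<tau>" if "\<tau> < k" for \<tau>
      proof (rule prod_eqI)
        have e: "tp (snd (config_at M w i) ! \<tau>) = tp (snd (config_at M w i') ! \<tau>)"
          using eq that l[of i] l[of i'] unfolding f_def prod.inject by (metis nth_map)
        then show "fst (snd (config_at M w i) ! \<tau>) = fst (snd (config_at M w i') ! \<tau>)" by (simp add: tp_def)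
        show "snd (snd (config_at M w i) ! \<tau>) = snd (snd (config_at M w i') ! \<tau>)"
        proof
          fix j show "snd (snd (config_at M w i) ! \<tau>) j = snd (snd (config_at M w i') ! \<tau>) j"
          proof (cases "j < S")
            case True
            then show ?thesis using e by (simp add: tp_def)
          next
            case False
            then have "S \<le> j" "\<tau> < num_tapes M" using that by (simp_all add: k_def)
            then show ?thesis using unvisited[OF wf S, of \<tau> j i] unvisited[OF wf S, of \<tau> j i'] by presburger
          qed
        qed
      qed
      then have "snd (config_at M w i) = snd (config_at M w i')"
        using l by (intro nth_equalityI) auto
      then have same: "config_at M w i = config_at M w i'" using eq by (simp add: f_def prod_eq_iff)
      have "config_at M w (i + (T - i')) = config_at M w (i' + (T - i'))"
        unfolding config_at_add same ..
      then have "halting_state M (fst (config_at M w (i + (T - i'))))" using T ii by simp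
      moreover have "i + (T - i') < T" using ii by simp
      ultimately show False using least by blast
    qed
  qed auto
  have ran: "f ` {..<T} \<subseteq> X"
  proof
    fix y assume "y \<in> f ` {..<T}"
    then obtain i where y: "y = f i" by blast
    have c: "wf_config M (config_at M w i)" "heads_below M S (config_at M w i)" using wf S by auto
    have "tp x \<in> {..<S} \<times> {l. set l \<subseteq> {..<G} \<and> length l = S}" if x: "x \<in> set (snd (config_at M w i))" for x
    proof -
      from x obtain \<tau> where "\<tau> < k" "x = snd (config_at M w i) ! \<tau>"
        using c(1) by (auto simp: in_set_conv_nth wf_config_def k_def)
      then show ?thesis using c by (auto simp: tp_def wf_config_def heads_below_def k_def G_def)
    qed
    then have "tp ` set (snd (config_at M w i)) \<subseteq> {..<S} \<times> {l. set l \<subseteq> {..<G} \<and> length l = S}"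
      by (rule image_subsetI)
    then show "y \<in> X" using c(1) unfolding y f_def X_def mem_Times_iff fst_conv snd_conv mem_Collect_eq
      set_map length_map by (simp add: wf_config_def Q_def k_def)
  qed
  have "T \<le> card X" using card_inj_on_le[OF inj ran finX] by simp
  \<comment> \<open>Each of the numbers \<open>Q\<close>, \<open>S\<close> and \<open>G\<close> is
    replaced by a power of 2 that exceeds it.\<close>
  also have "card X \<le> 2 ^ Q * (2 ^ S * (2 ^ G) ^ S) ^ k"
    unfolding cX by (intro mult_le_mono power_mono) (simp_all add: less_imp_le)
  also have "\<dots> = 2 ^ (Q + (S + G * S) * k)"
    by (simp add: power_add[symmetric] power_mult[symmetric])
  also have "\<dots> \<le> 2 ^ ((Q + k + k * G) * Suc S)"
    by (rule power_increasing) (simp_all add: algebra_simps)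
  finally show ?thesis using T unfolding Q_def k_def G_def by blast
qed

section \<open>One step of the machine as a local condition\<close>

text \<open>
  The one-step relation on a single tape in terms of its bits: \<open>as j a\<close> says that cell \<open>j\<close> holds the symbol
  \<open>a\<close> and \<open>ah j p\<close> that the head is at cell \<open>j\<close> in state \<open>p\<close>; \<open>bs\<close> and \<open>bh\<close> describe the next
  configuration.  Every conjunct concerns one cell or two neighbouring cells.
\<close>

definition tape_ok :: "nat \<Rightarrow> nat \<Rightarrow> nat \<Rightarrow> nat \<Rightarrow> nat \<Rightarrow> nat \<Rightarrow> nat \<times> move \<Rightarrow>
    (nat \<Rightarrow> nat \<Rightarrow> bool) \<Rightarrow> (nat \<Rightarrow> nat \<Rightarrow> bool) \<Rightarrow> (nat \<Rightarrow> nat \<Rightarrow> bool) \<Rightarrow> (nat \<Rightarrow> nat \<Rightarrow> bool) \<Rightarrow> bool" where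
  "tape_ok S G Q q q' x ac as ah bs bh \<longleftrightarrow>
     (\<forall>j\<le>S. (\<forall>p<Q. p \<noteq> q \<longrightarrow> \<not> ah j p) \<and> (\<forall>p<Q. p \<noteq> q' \<longrightarrow> \<not> bh j p) \<and>
        (ah j q \<longrightarrow> as j x) \<and>
        (\<forall>a<G. bs j a \<longleftrightarrow> (if ah j q then a = fst ac else as j a)) \<and>
        (snd ac = Stay \<longrightarrow> (bh j q' \<longleftrightarrow> ah j q))) \<and>
     (\<forall>j<S. snd ac = MoveLeft \<longrightarrow> (if j = 0 then bh 0 q' \<longleftrightarrow> ah 0 q \<or> ah (Suc 0) q else bh j q' \<longleftrightarrow> ah (Suc j) q)) \<and>
     (\<forall>j<S. snd ac = MoveRight \<longrightarrow> (bh (Suc j) q' \<longleftrightarrow> ah j q) \<and> (j = 0 \<longrightarrow> \<not> bh 0 q')) \<and>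
     \<not> bh S q'"

text \<open>The head need not be located to test a guess: every other state is excluded on every
  cell, and a head in the guessed state must stand on the guessed symbol. As there is a head below
  \<open>S\<close>, a wrong guess is caught.\<close>

lemma tape_ok_guess:
  assumes "tape_ok S G Q q q' x ac as ah bs bh" "h < S" "q0 < Q"
    and ah: "\<And>j p. j \<le> S \<Longrightarrow> p < Q \<Longrightarrow> ah j p \<longleftrightarrow> h = j \<and> q0 = p"
  shows "q = q0" "q0 < Q \<Longrightarrow> as h x"
proof -
  have *: "\<forall>p<Q. p \<noteq> q \<longrightarrow> \<not> ah h p" "ah h q \<longrightarrow> as h x"
    using assms(1,2) unfolding tape_ok_def by (meson less_imp_le)+
  show q: "q = q0" using *(1) ah[of h q0] assms(2,3) by auto
  show "as h x" using *(2) ah[of h q] assms(2,3) q by simp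
qed

text \<open>The head is below \<open>S\<close> before and after the step, so cell \<open>S\<close>
  is a guard that never carries a head. Conditions on the neighbours \<open>j\<close> and
  \<open>Suc j\<close> are needed for \<open>j < S\<close> only and stay within the described
  cells.\<close>

lemma tape_ok_iff:
  assumes h: "h < S" "fst (act ac (h, c)) < S" and q: "q < Q" "q' < Q"
    and as: "\<And>j a. j \<le> S \<Longrightarrow> a < G \<Longrightarrow> as j a \<longleftrightarrow> c j = a"
    and ah: "\<And>j p. j \<le> S \<Longrightarrow> p < Q \<Longrightarrow> ah j p \<longleftrightarrow> h = j \<and> q = p"
    and x: "c h < G" and s: "fst ac < G"
  shows "tape_ok S G Q q q' (c h) ac as ah bs bh \<longleftrightarrow>
    (\<forall>j\<le>S. (\<forall>a<G. bs j a \<longleftrightarrow> snd (act ac (h, c)) j = a) \<and> (\<forall>p<Q. bh j p \<longleftrightarrow> fst (act ac (h, c)) = j \<and> q' = p))"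
    (is "?L \<longleftrightarrow> ?R")
proof -
  obtain s d where ac: "ac = (s, d)" by (cases ac)
  define h' where "h' = fst (act ac (h, c))"
  have h': "h' = (case d of MoveLeft \<Rightarrow> h - 1 | Stay \<Rightarrow> h | MoveRight \<Rightarrow> h + 1)" "h' < S"
    using h by (simp_all add: h'_def ac)
  have ahq: "ah j q \<longleftrightarrow> h = j" if "j \<le> S" for j using ah[OF that q(1)] by simp
  have heads: "(\<forall>j\<le>S. d = Stay \<longrightarrow> (bh j q' \<longleftrightarrow> ah j q)) \<and>
     (\<forall>j<S. d = MoveLeft \<longrightarrow> (if j = 0 then bh 0 q' \<longleftrightarrow> ah 0 q \<or> ah (Suc 0) q else bh j q' \<longleftrightarrow> ah (Suc j) q)) \<and>
     (\<forall>j<S. d = MoveRight \<longrightarrow> (bh (Suc j) q' \<longleftrightarrow> ah j q) \<and> (j = 0 \<longrightarrow> \<not> bh 0 q')) \<and>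
     \<not> bh S q' \<longleftrightarrow> (\<forall>j\<le>S. bh j q' \<longleftrightarrow> h' = j)" (is "?H \<longleftrightarrow> ?H'")
  proof (cases d)
    case Stay
    then show ?thesis using h h' ahq by auto
  next
    case MoveLeft
    have "(if j = 0 then bh 0 q' \<longleftrightarrow> ah 0 q \<or> ah (Suc 0) q else bh j q' \<longleftrightarrow> ah (Suc j) q) \<longleftrightarrow> (bh j q' \<longleftrightarrow> h' = j)"
      if "j < S" for j
      using that h h' ahq MoveLeft by (auto simp: Suc_le_eq)
    then have "?H \<longleftrightarrow> (\<forall>j<S. bh j q' \<longleftrightarrow> h' = j) \<and> \<not> bh S q'" using MoveLeft by simp
    also have "\<dots> \<longleftrightarrow> ?H'" using h' by (auto simp: le_less)
    finally show ?thesis .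
  next
    case MoveRight
    have "?H \<longleftrightarrow> (\<forall>j<S. bh (Suc j) q' \<longleftrightarrow> h' = Suc j) \<and> \<not> bh 0 q' \<and> \<not> bh S q'"
      using MoveRight h h' ahq by auto
    also have "\<dots> \<longleftrightarrow> ?H'"
    proof
      assume *: "(\<forall>j<S. bh (Suc j) q' \<longleftrightarrow> h' = Suc j) \<and> \<not> bh 0 q' \<and> \<not> bh S q'"
      show ?H'
      proof (intro allI impI)
        fix j assume "j \<le> S"
        then show "bh j q' \<longleftrightarrow> h' = j" using * MoveRight h' by (cases j) auto
      qed
    next
      assume ?H'
      then show "(\<forall>j<S. bh (Suc j) q' \<longleftrightarrow> h' = Suc j) \<and> \<not> bh 0 q' \<and> \<not> bh S q'"
        using h' MoveRight by (auto simp: Suc_le_eq)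
    qed
    finally show ?thesis .
  qed
  have syms: "(\<forall>a<G. bs j a \<longleftrightarrow> (if ah j q then a = s else as j a)) \<longleftrightarrow>
      (\<forall>a<G. bs j a \<longleftrightarrow> snd (act ac (h, c)) j = a)" if "j \<le> S" for j
    using ahq[OF that] as[OF that] by (auto simp: ac)
  have triv: "(\<forall>p<Q. p \<noteq> q \<longrightarrow> \<not> ah j p) \<and> (ah j q \<longrightarrow> as j (c h))" if "j \<le> S" for j
    using ah[OF that] ahq[OF that] as[OF that x] by auto
  have others: "(\<forall>p<Q. p \<noteq> q' \<longrightarrow> \<not> bh j p) \<and> (bh j q' \<longleftrightarrow> h' = j) \<longleftrightarrow>
     (\<forall>p<Q. bh j p \<longleftrightarrow> h' = j \<and> q' = p)" for j
    using q(2) by auto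
  have "?L \<longleftrightarrow> (\<forall>j\<le>S. (\<forall>p<Q. p \<noteq> q' \<longrightarrow> \<not> bh j p) \<and>
      (\<forall>a<G. bs j a \<longleftrightarrow> (if ah j q then a = s else as j a))) \<and> ?H"
    unfolding tape_ok_def using triv by (auto simp: ac)
  also have "\<dots> \<longleftrightarrow> (\<forall>j\<le>S. (\<forall>p<Q. p \<noteq> q' \<longrightarrow> \<not> bh j p) \<and>
      (\<forall>a<G. bs j a \<longleftrightarrow> snd (act ac (h, c)) j = a)) \<and> ?H'"
    unfolding heads using syms by auto
  also have "\<dots> \<longleftrightarrow> ?R" unfolding h'_def[symmetric] using others by blast
  finally show ?thesis .
qed

definition width :: "tm \<Rightarrow> nat" where
  "width M = num_symbols M + num_states M"

definition sbit :: "tm \<Rightarrow> nat \<Rightarrow> nat \<Rightarrow> nat" where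
  "sbit M \<tau> a = \<tau> * width M + a"

definition hbit :: "tm \<Rightarrow> nat \<Rightarrow> nat \<Rightarrow> nat" where
  "hbit M \<tau> q = \<tau> * width M + (num_symbols M + q)"

text \<open>Each tape carries the control state at its own head, so that the state is visible to
  conditions that concern one tape and one cell.\<close>

definition bit :: "tm \<Rightarrow> config \<Rightarrow> nat \<Rightarrow> nat \<Rightarrow> bool" where
  "bit M C j b = (let \<tau> = b div width M; r = b mod width M in
     if r < num_symbols M then snd (snd C ! \<tau>) j = r
     else fst (snd C ! \<tau>) = j \<and> fst C = r - num_symbols M)"

lemma bit_simps:
  "a < num_symbols M \<Longrightarrow> bit M C j (sbit M \<tau> a) \<longleftrightarrow> snd (snd C ! \<tau>) j = a"
  "q < num_states M \<Longrightarrow> bit M C j (hbit M \<tau> q) \<longleftrightarrow> fst (snd C ! \<tau>) = j \<and> fst C = q"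
  by (auto simp: bit_def sbit_def hbit_def width_def)

lemma all_bits: "(\<forall>b < num_tapes M * width M. P b) \<longleftrightarrow>
  (\<forall>\<tau> < num_tapes M. (\<forall>a < num_symbols M. P (sbit M \<tau> a)) \<and> (\<forall>q < num_states M. P (hbit M \<tau> q)))"
proof
  have lt: "\<tau> * width M + r < num_tapes M * width M" if "\<tau> < num_tapes M" "r < width M" for \<tau> r
  proof -
    have "\<tau> * width M + r < Suc \<tau> * width M" using that by simp
    also have "\<dots> \<le> num_tapes M * width M" using that by (intro mult_le_mono) auto
    finally show ?thesis .
  qed
  assume "\<forall>b < num_tapes M * width M. P b"
  then show "\<forall>\<tau> < num_tapes M. (\<forall>a < num_symbols M. P (sbit M \<tau> a)) \<and> (\<forall>q < num_states M. P (hbit M \<tau> q))"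
    using lt by (auto simp: sbit_def hbit_def width_def)
next
  assume *: "\<forall>\<tau> < num_tapes M. (\<forall>a < num_symbols M. P (sbit M \<tau> a)) \<and> (\<forall>q < num_states M. P (hbit M \<tau> q))"
  show "\<forall>b < num_tapes M * width M. P b"
  proof (intro allI impI)
    fix b assume b: "b < num_tapes M * width M"
    define \<tau> where "\<tau> = b div width M"
    define r where "r = b mod width M"
    have w: "0 < width M" using b by (cases "width M") auto
    have \<tau>: "\<tau> < num_tapes M" using b by (simp add: \<tau>_def less_mult_imp_div_less)
    have r: "r < width M" using w by (simp add: r_def)
    have br: "b = \<tau> * width M + r" by (simp add: \<tau>_def r_def)
    show "P b"
    proof (cases "r < num_symbols M")
      case True
      then show ?thesis using * \<tau> br by (simp add: sbit_def)
    next
      case False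
      then have "b = hbit M \<tau> (r - num_symbols M)" "r - num_symbols M < num_states M"
        using br r by (auto simp: hbit_def width_def)
      then show ?thesis using * \<tau> by simp
    qed
  qed
qed

definition trans_ok :: "tm \<Rightarrow> nat \<Rightarrow> nat \<Rightarrow> nat list \<Rightarrow> (nat \<Rightarrow> nat \<Rightarrow> bool) \<Rightarrow> (nat \<Rightarrow> nat \<Rightarrow> bool) \<Rightarrow> bool" where
  "trans_ok M S q xs A B \<longleftrightarrow> (\<forall>\<tau> < num_tapes M.
     tape_ok S (num_symbols M) (num_states M) q (fst (nxt M q xs)) (xs ! \<tau>) (snd (nxt M q xs) ! \<tau>)
       (\<lambda>j a. A j (sbit M \<tau> a)) (\<lambda>j p. A j (hbit M \<tau> p)) (\<lambda>j a. B j (sbit M \<tau> a)) (\<lambda>j p. B j (hbit M \<tau> p)))"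

text \<open>The list depends on the machine only, so a disjunction over it has constant length in
  the reduction.\<close>

definition guesses :: "tm \<Rightarrow> (nat \<times> nat list) list" where
  "guesses M = List.product [0..<num_states M] (List.n_lists (num_tapes M) [0..<num_symbols M])"

lemma guesses: "(q, xs) \<in> set (guesses M) \<longleftrightarrow>
    q < num_states M \<and> length xs = num_tapes M \<and> set xs \<subseteq> {..<num_symbols M}"
  by (auto simp: guesses_def set_n_lists)

text \<open>All tapes share one guess, which makes them perform the same transition. A wrong guess
  fails on some tape; for the right one the local conditions determine every bit of the
  successor.\<close>

theorem trans_ok_iff:
  assumes M: "wf_tm M" and C: "wf_config M C" and S: "heads_below M S C" "heads_below M S (step M C)"
    and A: "\<And>j b. j \<le> S \<Longrightarrow> b < num_tapes M * width M \<Longrightarrow> A j b = bit M C j b"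
  shows "(\<exists>(q, xs) \<in> set (guesses M). trans_ok M S q xs A B) \<longleftrightarrow>
    (\<forall>j\<le>S. \<forall>b < num_tapes M * width M. B j b = bit M (step M C) j b)" (is "?L \<longleftrightarrow> ?R")
proof -
  obtain q ts where Cq: "C = (q, ts)" by (cases C)
  have wf: "wf_config M (q, ts)" using C Cq by simp
  then have q: "q < num_states M" and lts: "length ts = num_tapes M" by (auto simp: wf_config_def)
  have k: "0 < num_tapes M" using M by (simp add: wf_tm_def)
  let ?G = "num_symbols M" and ?Q = "num_states M" and ?xs = "reads ts"
  note rw = reads_wf[OF wf]
  note nw = nxt_wf[OF M q rw(1,2)]
  have ab: "(\<forall>b < num_tapes M * width M. A j b = bit M C j b)" if "j \<le> S" for j using A that by blast
  have As: "A j (sbit M \<tau> a) \<longleftrightarrow> snd (ts ! \<tau>) j = a" if "j \<le> S" "\<tau> < num_tapes M" "a < ?G" for j \<tau> a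
    using ab[OF that(1)] that(2,3) bit_simps(1)[OF that(3)] unfolding all_bits Cq by simp
  have Ah: "A j (hbit M \<tau> p) \<longleftrightarrow> fst (ts ! \<tau>) = j \<and> q = p" if "j \<le> S" "\<tau> < num_tapes M" "p < ?Q" for j \<tau> p
    using ab[OF that(1)] that(2,3) bit_simps(2)[OF that(3)] unfolding all_bits Cq by simp
  have hd: "fst (ts ! \<tau>) < S" if "\<tau> < num_tapes M" for \<tau> using S(1) that Cq by (simp add: heads_below_def)
  let ?q' = "fst (nxt M q ?xs)" and ?acts = "snd (nxt M q ?xs)"
  have st: "step M C = (?q', map2 act ?acts ts)" unfolding Cq by (rule step_nxt)
  have st\<tau>: "snd (step M C) ! \<tau> = act (?acts ! \<tau>) (ts ! \<tau>)" if "\<tau> < num_tapes M" for \<tau>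
    using that nw(2) lts by (simp add: st)
  have fst_st: "fst (step M C) = ?q'" unfolding st by simp
  have guess: "p = q \<and> xs = ?xs" if g: "(p, xs) \<in> set (guesses M)" "trans_ok M S p xs A B" for p xs
  proof -
    have tok: "tape_ok S ?G ?Q p (fst (nxt M p xs)) (xs ! \<tau>) (snd (nxt M p xs) ! \<tau>)
       (\<lambda>j a. A j (sbit M \<tau> a)) (\<lambda>j p. A j (hbit M \<tau> p)) (\<lambda>j a. B j (sbit M \<tau> a)) (\<lambda>j p. B j (hbit M \<tau> p))"
      if "\<tau> < num_tapes M" for \<tau> using g(2) that unfolding trans_ok_def by blast
    have lx: "length xs = num_tapes M" "set xs \<subseteq> {..<?G}" using g(1) guesses by auto
    have x: "xs ! \<tau> < ?G" if "\<tau> < num_tapes M" for \<tau>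
      using subsetD[OF lx(2) nth_mem[of \<tau> xs]] lx(1) that by simp
    have "p = q" by (rule tape_ok_guess(1)[OF tok[OF k] hd[OF k] q]) (rule Ah[OF _ k])
    moreover have "xs ! \<tau> = ?xs ! \<tau>" if \<tau>: "\<tau> < num_tapes M" for \<tau>
    proof -
      have "A (fst (ts ! \<tau>)) (sbit M \<tau> (xs ! \<tau>))"
        by (rule tape_ok_guess(2)[OF tok[OF \<tau>] hd[OF \<tau>] q _ q]) (rule Ah[OF _ \<tau>])
      then show ?thesis using As[OF less_imp_le[OF hd[OF \<tau>]] \<tau> x[OF \<tau>]] rw(3)[OF \<tau>] by simp
    qed
    ultimately show ?thesis using lx(1) rw(1) by (auto intro: nth_equalityI)
  qed
  have main: "trans_ok M S q ?xs A B \<longleftrightarrow> ?R"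
  proof -
    have "tape_ok S ?G ?Q q ?q' (?xs ! \<tau>) (?acts ! \<tau>)
       (\<lambda>j a. A j (sbit M \<tau> a)) (\<lambda>j p. A j (hbit M \<tau> p)) (\<lambda>j a. B j (sbit M \<tau> a)) (\<lambda>j p. B j (hbit M \<tau> p)) \<longleftrightarrow>
      (\<forall>j\<le>S. (\<forall>a<?G. B j (sbit M \<tau> a) = bit M (step M C) j (sbit M \<tau> a)) \<and>
        (\<forall>p<?Q. B j (hbit M \<tau> p) = bit M (step M C) j (hbit M \<tau> p)))" if \<tau>: "\<tau> < num_tapes M" for \<tau>
    proof -
      have cell: "snd (ts ! \<tau>) j < ?G" for j using wf \<tau> by (simp add: wf_config_def)
      have h2: "fst (act (?acts ! \<tau>) (fst (ts ! \<tau>), snd (ts ! \<tau>))) < S"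
      proof -
        have "fst (snd (step M C) ! \<tau>) < S" using S(2) \<tau> by (simp only: heads_below_def)
        then show ?thesis unfolding st\<tau>[OF \<tau>] by simp
      qed
      show ?thesis unfolding rw(3)[OF \<tau>]
        by (subst tape_ok_iff[OF hd[OF \<tau>] h2 q nw(1) As[OF _ \<tau>] Ah[OF _ \<tau>] cell nw(3)[OF \<tau>]])
           (simp_all add: bit_simps st\<tau>[OF \<tau>] fst_st del: step.simps)
    qed
    then show ?thesis unfolding trans_ok_def all_bits by blast
  qed
  have "(q, ?xs) \<in> set (guesses M)" using q rw(1,2) guesses by blast
  then show ?thesis using main guess by blast
qed

section \<open>Variables as depths of successors\<close>

primrec dias :: "nat \<Rightarrow> fm" where
  "dias 0 = Tru"
| "dias (Suc n) = Dia (dias n)"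

primrec boxes :: "nat \<Rightarrow> fm" where
  "boxes 0 = Fls"
| "boxes (Suc n) = Box (boxes n)"

lemma holds_boxes: "holds R v (boxes n) \<longleftrightarrow> \<not> holds R v (dias n)"
  by (induction n arbitrary: v) auto

definition var :: "nat \<Rightarrow> fm" where
  "var h = Dia (Conj (dias h) (boxes (Suc h)))"

definition cbits :: "tm \<Rightarrow> nat" where
  "cbits M = num_tapes M * width M"

text \<open>The column of a cell holds its bits in three configurations and one further slot, whose
  variable in column 0 tells left children from right ones.\<close>

definition colw :: "tm \<Rightarrow> nat" where
  "colw M = 3 * cbits M + 1"

text \<open>Roles of a configuration at a world: 0 = first, 1 = midpoint, 2 = last.\<close>

definition vindex :: "tm \<Rightarrow> nat \<Rightarrow> nat \<Rightarrow> nat" where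
  "vindex M X b = X * cbits M + b"

definition pv :: "tm \<Rightarrow> ('w \<times> 'w) set \<Rightarrow> 'w \<Rightarrow> nat \<Rightarrow> nat \<Rightarrow> nat \<Rightarrow> bool" where
  "pv M R v X j b = holds R v (var (j * colw M + vindex M X b))"

definition left_child :: "tm \<Rightarrow> ('w \<times> 'w) set \<Rightarrow> 'w \<Rightarrow> bool" where
  "left_child M R v = holds R v (var (3 * cbits M))"

text \<open>The columns 0 to \<open>S\<close> use exactly the indices below
  \<open>Suc S * colw M\<close>, so no chain attached for a variable reaches this depth.\<close>

definition deep :: "tm \<Rightarrow> nat \<Rightarrow> ('w \<times> 'w) set \<Rightarrow> 'w \<Rightarrow> bool" where
  "deep M S R v = holds R v (dias (Suc (Suc S * colw M)))"

definition encodes :: "tm \<Rightarrow> nat \<Rightarrow> ('w \<times> 'w) set \<Rightarrow> 'w \<Rightarrow> nat \<Rightarrow> config \<Rightarrow> bool" where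
  "encodes M S R v X C \<longleftrightarrow> (\<forall>j\<le>S. \<forall>b < cbits M. pv M R v X j b = bit M C j b)"

section \<open>Halving a computation\<close>

definition node_ok :: "tm \<Rightarrow> nat \<Rightarrow> ('w \<times> 'w) set \<Rightarrow> 'w \<Rightarrow> bool" where
  "node_ok M S R v \<longleftrightarrow>
     (\<exists>u. (v, u) \<in> R \<and> deep M S R u \<and> left_child M R u) \<and>
     (\<exists>u. (v, u) \<in> R \<and> deep M S R u \<and> \<not> left_child M R u) \<and>
     (\<forall>j\<le>S. \<forall>b < cbits M. \<forall>u. (v, u) \<in> R \<longrightarrow> deep M S R u \<longrightarrow>
        (if left_child M R u then pv M R u 0 j b = pv M R v 0 j b \<and> pv M R u 2 j b = pv M R v 1 j b
         else pv M R u 0 j b = pv M R v 1 j b \<and> pv M R u 2 j b = pv M R v 2 j b))"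

text \<open>An operator on predicates of worlds, so that stacking levels in the formula becomes
  iteration.\<close>

definition layer :: "tm \<Rightarrow> nat \<Rightarrow> ('w \<times> 'w) set \<Rightarrow> ('w \<Rightarrow> bool) \<Rightarrow> 'w \<Rightarrow> bool" where
  "layer M S R P v \<longleftrightarrow> node_ok M S R v \<and> (\<forall>u. (v, u) \<in> R \<longrightarrow> deep M S R u \<longrightarrow> P u)"

lemma savitch_sound:
  assumes leaf: "\<And>v i. P v \<Longrightarrow> encodes M S R v 0 (cfg i) \<Longrightarrow> encodes M S R v 2 (cfg (Suc i))"
  shows "(layer M S R ^^ l) P v \<Longrightarrow> encodes M S R v 0 (cfg i) \<Longrightarrow> encodes M S R v 2 (cfg (i + 2 ^ l))"
proof (induction l arbitrary: v i)
  case 0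
  then show ?case using leaf by simp
next
  case (Suc l)
  have node: "node_ok M S R v" and sub: "\<And>u. (v, u) \<in> R \<Longrightarrow> deep M S R u \<Longrightarrow> (layer M S R ^^ l) P u"
    using Suc.prems(1) by (auto simp: layer_def[of M S R "(layer M S R ^^ l) P"])
  obtain x y where x: "(v, x) \<in> R" "deep M S R x" "left_child M R x"
    and y: "(v, y) \<in> R" "deep M S R y" "\<not> left_child M R y"
    using node unfolding node_ok_def by blast
  have x2: "pv M R x 0 j b = pv M R v 0 j b" "pv M R x 2 j b = pv M R v 1 j b" if "j \<le> S" "b < cbits M" for j b
    using node x that unfolding node_ok_def by metis+
  have y2: "pv M R y 0 j b = pv M R v 1 j b" "pv M R y 2 j b = pv M R v 2 j b" if "j \<le> S" "b < cbits M" for j b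
    using node y that unfolding node_ok_def by metis+
  have "encodes M S R x 0 (cfg i)" using Suc.prems(2) x2 by (simp add: encodes_def)
  then have "encodes M S R x 2 (cfg (i + 2 ^ l))" using Suc.IH sub x by blast
  \<comment> \<open>The bits of the midpoint at \<open>v\<close> have become known through the left
    child, and the right child starts from them.\<close>
  then have "encodes M S R y 0 (cfg (i + 2 ^ l))" using x2 y2 by (simp add: encodes_def)
  then have "encodes M S R y 2 (cfg (i + 2 ^ l + 2 ^ l))" using Suc.IH sub y by blast
  then show ?case using y2 by (simp add: encodes_def mult_2 add.assoc)
qed

section \<open>The intended model\<close>

datatype world = Real nat nat bool | Chain nat

definition offset :: "nat \<Rightarrow> nat \<Rightarrow> nat" where
  "offset X l = (if X = 0 then 0 else if X = 1 then 2 ^ (l - 1) else 2 ^ l)"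

definition true_at :: "tm \<Rightarrow> (nat \<Rightarrow> config) \<Rightarrow> nat \<Rightarrow> nat \<Rightarrow> bool \<Rightarrow> nat \<Rightarrow> bool" where
  "true_at M cfg l i d h = (let j = h div colw M; r = h mod colw M in
     if r = 3 * cbits M then d else bit M (cfg (i + offset (r div cbits M) l)) j (r mod cbits M))"

text \<open>
  The world \<open>Real l i d\<close> stands for the subproblem of going from \<open>cfg i\<close> to \<open>cfg (i + 2 ^ l)\<close>; the pendant
  chains encode its bits, and one more chain makes it deeper than every chain.
\<close>

definition mrel :: "tm \<Rightarrow> nat \<Rightarrow> (nat \<Rightarrow> config) \<Rightarrow> (world \<times> world) set" where
  "mrel M S cfg = {(v, u). case v of
      Chain m \<Rightarrow> (\<exists>n. m = Suc n \<and> u = Chain n)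
    | Real l i d \<Rightarrow> (case u of
        Chain h \<Rightarrow> h = Suc S * colw M \<or> h < Suc S * colw M \<and> true_at M cfg l i d h
      | Real l' i' d' \<Rightarrow> l = Suc l' \<and> (i' = i \<and> d' \<or> i' = i + 2 ^ l' \<and> \<not> d'))}"

lemma dias_Chain: "holds (mrel M S cfg) (Chain m) (dias n) \<longleftrightarrow> n \<le> m"
proof (induction n arbitrary: m)
  case (Suc n)
  then show ?case by (cases m) (auto simp: mrel_def)
qed simp

lemma dias_Real:
  assumes "n \<le> Suc (Suc S * colw M)"
  shows "holds (mrel M S cfg) (Real l i d) (dias n)"
proof (cases n)
  case (Suc n')
  have "(Real l i d, Chain (Suc S * colw M)) \<in> mrel M S cfg" by (simp add: mrel_def)
  moreover have "holds (mrel M S cfg) (Chain (Suc S * colw M)) (dias n')"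
    unfolding dias_Chain using assms Suc by simp
  ultimately show ?thesis unfolding Suc dias.simps holds.simps by blast
qed simp

lemma var_Real:
  assumes h: "h < Suc S * colw M"
  shows "holds (mrel M S cfg) (Real l i d) (var h) = true_at M cfg l i d h"
proof -
  \<comment> \<open>Every genuine world has depth greater than \<open>h\<close>, so the chain of
    length \<open>h\<close> is the only world of depth exactly \<open>h\<close>.\<close>
  have *: "holds (mrel M S cfg) u (Conj (dias h) (boxes (Suc h))) \<longleftrightarrow> u = Chain h" for u
  proof (cases u)
    case (Real l i d)
    then show ?thesis using dias_Real[of "Suc h" S M cfg l i d] h
      unfolding holds.simps holds_boxes by simp
  next
    case (Chain m)
    show ?thesis unfolding Chain holds.simps(4) holds_boxes dias_Chain by auto
  qed
  have "holds (mrel M S cfg) (Real l i d) (var h) \<longleftrightarrow> (Real l i d, Chain h) \<in> mrel M S cfg"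
    unfolding var_def holds.simps(7) * by blast
  also have "\<dots> \<longleftrightarrow> true_at M cfg l i d h" using h by (simp add: mrel_def)
  finally show ?thesis .
qed

lemma pv_Real:
  assumes "j \<le> S" "b < cbits M" "X < 3"
  shows "pv M (mrel M S cfg) (Real l i d) X j b = bit M (cfg (i + offset X l)) j b"
proof -
  have le: "X * cbits M + b < 3 * cbits M"
  proof -
    have "X * cbits M + b < Suc X * cbits M" using assms by simp
    also have "\<dots> \<le> 3 * cbits M" using assms by (intro mult_le_mono) auto
    finally show ?thesis .
  qed
  have h: "j * colw M + vindex M X b < Suc S * colw M"
  proof -
    have "j * colw M + vindex M X b < Suc j * colw M" using le by (simp add: vindex_def colw_def)
    also have "\<dots> \<le> Suc S * colw M" using assms by (intro mult_le_mono) auto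
    finally show ?thesis .
  qed
  have "(j * colw M + vindex M X b) div colw M = j" "(j * colw M + vindex M X b) mod colw M = X * cbits M + b"
  proof -
    have "X * cbits M + b < colw M" using le by (simp add: colw_def)
    then show "(j * colw M + vindex M X b) div colw M = j" "(j * colw M + vindex M X b) mod colw M = X * cbits M + b"
      unfolding vindex_def by simp_all
  qed
  then show ?thesis unfolding pv_def var_Real[OF h]
    using le assms(2) by (simp add: true_at_def)
qed

lemma left_child_Real: "left_child M (mrel M S cfg) (Real l i d) = d"
proof -
  have h: "3 * cbits M < Suc S * colw M" by (simp add: colw_def)
  show ?thesis unfolding left_child_def var_Real[OF h] by (simp add: true_at_def colw_def)
qed

lemma deep_child:
  assumes "(Real l i d, u) \<in> mrel M S cfg"
  shows "deep M S (mrel M S cfg) u \<longleftrightarrow> (\<exists>l' i' d'. u = Real l' i' d')"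
proof (cases u)
  case (Chain m)
  \<comment> \<open>Even the longest chain attached to a genuine world, of length
    \<open>Suc S * colw M\<close>, falls one short of the depth demanded by
    \<open>deep\<close>.\<close>
  then show ?thesis using assms unfolding deep_def Chain dias_Chain by (auto simp: mrel_def)
next
  case (Real l' i' d')
  have "holds (mrel M S cfg) u (dias (Suc (Suc S * colw M)))"
    unfolding Real by (rule dias_Real) simp
  then show ?thesis unfolding deep_def using Real by blast
qed

lemma savitch_complete:
  assumes leaf: "\<And>i d. P (Real 0 i d)"
  shows "(layer M S (mrel M S cfg) ^^ l) P (Real l i d)"
proof (induction l arbitrary: i d)
  case (Suc l)
  let ?R = "mrel M S cfg"
  have ch: "(Real (Suc l) i d, u) \<in> ?R \<and> deep M S ?R u \<longleftrightarrow> u = Real l i True \<or> u = Real l (i + 2 ^ l) False" for u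
    using deep_child[of "Suc l" i d u M S cfg] by (cases u) (auto simp: mrel_def)
  have "node_ok M S ?R (Real (Suc l) i d)"
    unfolding node_ok_def
  proof (intro conjI allI impI)
    show "\<exists>u. (Real (Suc l) i d, u) \<in> ?R \<and> deep M S ?R u \<and> left_child M ?R u"
      using ch[of "Real l i True"] by (intro exI[of _ "Real l i True"]) (simp add: left_child_Real)
    show "\<exists>u. (Real (Suc l) i d, u) \<in> ?R \<and> deep M S ?R u \<and> \<not> left_child M ?R u"
      using ch[of "Real l (i + 2 ^ l) False"]
      by (intro exI[of _ "Real l (i + 2 ^ l) False"]) (simp add: left_child_Real)
    fix j b u assume "j \<le> S" "b < cbits M" "(Real (Suc l) i d, u) \<in> ?R" "deep M S ?R u"
    then show "if left_child M ?R u
       then pv M ?R u 0 j b = pv M ?R (Real (Suc l) i d) 0 j b \<and> pv M ?R u 2 j b = pv M ?R (Real (Suc l) i d) 1 j b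
       else pv M ?R u 0 j b = pv M ?R (Real (Suc l) i d) 1 j b \<and> pv M ?R u 2 j b = pv M ?R (Real (Suc l) i d) 2 j b"
      using ch[of u] by (auto simp: left_child_Real pv_Real offset_def mult_2 add.assoc)
  qed
  moreover have "(layer M S ?R ^^ l) P u" if "(Real (Suc l) i d, u) \<in> ?R" "deep M S ?R u" for u
    using ch[of u] that Suc.IH by auto
  ultimately show ?case by (simp add: layer_def[of M S ?R "(layer M S ?R ^^ l) P"])
qed (simp add: leaf)

lemma encodes_Real:
  "X < 3 \<Longrightarrow> encodes M S (mrel M S cfg) (Real l i d) X (cfg (i + offset X l))"
  by (simp add: encodes_def pv_Real)

section \<open>Printing formulas in polynomial time\<close>

datatype gen = Emit "nat list" | Then gen gen | Rep nat nat gen | Test nat nat gen gen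

text \<open>
  A tape serves as a counter through its head position, so a counter is zero iff its head sees the marker 1.
  \<open>Rep x y g\<close> counts \<open>x\<close> up from 0 while counting \<open>y\<close> down, and restores both at the end.
\<close>

primrec out :: "gen \<Rightarrow> (nat \<Rightarrow> nat list) \<Rightarrow> (nat \<Rightarrow> nat) \<Rightarrow> nat list" where
  "out (Emit ws) z e = ws"
| "out (Then g h) z e = out g z e @ out h z e"
| "out (Rep x y g) z e = concat (map (\<lambda>j. out g z (e(x := j, y := e y - j))) [0..<e y])"
| "out (Test x a g h) z e = (if tape_of (z x) (e x) = a then out g z e else out h z e)"

text \<open>The second loop of \<open>Rep\<close> runs until \<open>x\<close> sees the marker;
  \<open>e x = 0\<close> at the start is what makes it restore both counters.\<close>

primrec gok :: "nat \<Rightarrow> nat \<Rightarrow> gen \<Rightarrow> (nat \<Rightarrow> nat list) \<Rightarrow> (nat \<Rightarrow> nat) \<Rightarrow> bool" where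
  "gok k p (Emit ws) z e \<longleftrightarrow> True"
| "gok k p (Then g h) z e \<longleftrightarrow> gok k p g z e \<and> gok k p h z e"
| "gok k p (Rep x y g) z e \<longleftrightarrow> x < k \<and> y < k \<and> x \<noteq> y \<and> x \<noteq> p \<and> y \<noteq> p \<and> e x = 0 \<and>
     (\<forall>j < e y. gok k p g z (e(x := j, y := e y - j)))"
| "gok k p (Test x a g h) z e \<longleftrightarrow> x < k \<and> x \<noteq> p \<and>
     (if tape_of (z x) (e x) = a then gok k p g z e else gok k p h z e)"

primrec gcom :: "nat \<Rightarrow> gen \<Rightarrow> com" where
  "gcom p (Emit ws) = foldr (\<lambda>a. Seq (Do (\<lambda>r. (idle r)(p := (a + 2, MoveRight))))) ws skip"
| "gcom p (Then g h) = Seq (gcom p g) (gcom p h)"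
| "gcom p (Rep x y g) =
     Seq (While (\<lambda>r. r y \<noteq> 1) (Seq (gcom p g) (Do (\<lambda>r. (idle r)(x := (r x, MoveRight), y := (r y, MoveLeft))))))
         (While (\<lambda>r. r x \<noteq> 1) (Do (\<lambda>r. (idle r)(x := (r x, MoveLeft), y := (r y, MoveRight)))))"
| "gcom p (Test x a g h) = Cond (\<lambda>r. r x = a) (gcom p g) (gcom p h)"

text \<open>The argument of the polynomial bounds all counters. In a repetition, the 5 is 3 steps
  per round for counting up and 2 for counting down; the final 3 covers the ends of both loops and
  their sequencing. A test is charged for both branches.\<close>

primrec cost :: "gen \<Rightarrow> nat poly" where
  "cost (Emit ws) = [:2 * length ws + 1:]"
| "cost (Then g h) = cost g + cost h + 1"
| "cost (Rep x y g) = [:0, 1:] * (cost g + 5) + 3"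
| "cost (Test x a g h) = cost g + cost h + 1"

fun app :: "tape \<Rightarrow> nat list \<Rightarrow> tape" where
  "app tp [] = tp"
| "app tp (a # ws) = app (act (a + 2, MoveRight) tp) ws"

lemma app_append: "app tp (xs @ ys) = app (app tp xs) ys"
  by (induction xs arbitrary: tp) auto

lemma app_tape_of: "app (Suc (length xs), tape_of xs) ws = (Suc (length (xs @ ws)), tape_of (xs @ ws))"
proof (induction ws arbitrary: xs)
  case (Cons a ws)
  then show ?case using tape_of_append[of xs a] Cons[of "xs @ [a]"] by simp
qed simp

text \<open>During printing the other tapes keep their contents \<open>z\<close> and only their
  heads move.\<close>

definition st_of :: "(nat \<Rightarrow> nat) \<Rightarrow> (nat \<Rightarrow> nat list) \<Rightarrow> nat \<Rightarrow> tape \<Rightarrow> st" where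
  "st_of e z p tp = (\<lambda>i. if i = p then tp else (e i, tape_of (z i)))"

lemma tape_of_eq_1: "tape_of w j = Suc 0 \<longleftrightarrow> j = 0"
  by (simp add: tape_of_def)

lemma rd_st_of: "i < k \<Longrightarrow> i \<noteq> p \<Longrightarrow> rd k (st_of e z p tp) i = tape_of (z i) (e i)"
  by (simp add: rd_def st_of_def)

lemma upd_out:
  assumes "p < k"
  shows "upd k ((idle (rd k (st_of e z p tp)))(p := (a, MoveRight))) (st_of e z p tp) =
    st_of e z p (act (a, MoveRight) tp)"
  using assms by (auto simp: fun_eq_iff upd_def st_of_def idle_def rd_def)

lemma upd_move:
  assumes "x < k" "y < k" "x \<noteq> y" "x \<noteq> p" "y \<noteq> p"
  shows "upd k ((idle (rd k (st_of e z p tp)))(x := (rd k (st_of e z p tp) x, MoveRight), y := (rd k (st_of e z p tp) y, MoveLeft)))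
      (st_of e z p tp) = st_of (e(x := Suc (e x), y := e y - 1)) z p tp"
    "upd k ((idle (rd k (st_of e z p tp)))(x := (rd k (st_of e z p tp) x, MoveLeft), y := (rd k (st_of e z p tp) y, MoveRight)))
      (st_of e z p tp) = st_of (e(x := e x - 1, y := Suc (e y))) z p tp"
  using assms by (auto simp: fun_eq_iff upd_def st_of_def idle_def rd_def)

lemma exec_Do_True: "u = upd k (f (rd k s)) s \<Longrightarrow> exec k (\<lambda>_. True) (Do f) s 1 u"
  using exec.Do[of k "\<lambda>_. True" f s] by simp

lemma emit_exec:
  assumes "p < k"
  shows "exec k (\<lambda>_. True) (gcom p (Emit ws)) (st_of e z p tp) (2 * length ws + 1) (st_of e z p (app tp ws))"
proof (induction ws arbitrary: tp)
  case Nil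
  then show ?case using exec_Do_True[of "st_of e z p tp" k idle] by (simp add: skip_def)
next
  case (Cons a ws)
  have "exec k (\<lambda>_. True) (Do (\<lambda>r. (idle r)(p := (a + 2, MoveRight)))) (st_of e z p tp) 1
      (st_of e z p (act (a + 2, MoveRight) tp))"
    by (rule exec_Do_True) (simp only: upd_out[OF assms])
  from exec.Seq[OF this Cons.IH] show ?case by simp
qed

lemma gen_exec:
  assumes "gok k p g z e" "\<And>i. e i \<le> B" "p < k"
  shows "\<exists>t \<le> poly (cost g) B. exec k (\<lambda>_. True) (gcom p g) (st_of e z p tp) t (st_of e z p (app tp (out g z e)))"
  using assms
proof (induction g arbitrary: e tp)
  case (Emit ws)
  then show ?case using emit_exec[of p k ws e z tp] by auto
next
  case (Then g h)
  obtain t where t: "t \<le> poly (cost g) B"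
    "exec k (\<lambda>_. True) (gcom p g) (st_of e z p tp) t (st_of e z p (app tp (out g z e)))"
    using Then.IH(1)[of e tp] Then.prems by auto
  obtain t' where t': "t' \<le> poly (cost h) B"
    "exec k (\<lambda>_. True) (gcom p h) (st_of e z p (app tp (out g z e))) t' (st_of e z p (app (app tp (out g z e)) (out h z e)))"
    using Then.IH(2)[of e "app tp (out g z e)"] Then.prems by auto
  show ?case
    using exec.Seq[OF t(2) t'(2)] t(1) t'(1)
    by (intro exI[of _ "Suc (t + t')"]) (simp add: app_append)
next
  case (Test x a g h)
  have r: "rd k (st_of e z p tp) x = tape_of (z x) (e x)" using Test.prems by (simp add: rd_st_of)
  show ?case
  proof (cases "tape_of (z x) (e x) = a")
    case True
    obtain t where t: "t \<le> poly (cost g) B"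
      "exec k (\<lambda>_. True) (gcom p g) (st_of e z p tp) t (st_of e z p (app tp (out g z e)))"
      using Test.IH(1)[of e tp] Test.prems True by auto
    have "exec k (\<lambda>_. True) (gcom p (Test x a g h)) (st_of e z p tp) (Suc t) (st_of e z p (app tp (out g z e)))"
      unfolding gcom.simps by (rule exec.Cond) (simp add: r True t)
    then show ?thesis using t(1) True by (intro exI[of _ "Suc t"]) simp
  next
    case False
    obtain t where t: "t \<le> poly (cost h) B"
      "exec k (\<lambda>_. True) (gcom p h) (st_of e z p tp) t (st_of e z p (app tp (out h z e)))"
      using Test.IH(2)[of e tp] Test.prems False by auto
    have "exec k (\<lambda>_. True) (gcom p (Test x a g h)) (st_of e z p tp) (Suc t) (st_of e z p (app tp (out h z e)))"
      unfolding gcom.simps by (rule exec.Cond) (simp add: r False t)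
    then show ?thesis using t(1) False by (intro exI[of _ "Suc t"]) simp
  qed
next
  case (Rep x y g)
  have xy: "x < k" "y < k" "x \<noteq> y" "x \<noteq> p" "y \<noteq> p" "e x = 0" using Rep.prems by auto
  define v where "v = e y"
  define E where "E j = e(x := j, y := v - j)" for j
  define W where "W j = concat (map (\<lambda>j. out g z (E j)) [0..<j])" for j
  define c where "c = poly (cost g) B"
  have vB: "v \<le> B" using Rep.prems(2) by (simp add: v_def)
  \<comment> \<open>The two counters of a repetition always add up to the initial value of
    \<open>y\<close>, so the bound on the counters holds inside the loop as well.\<close>
  have EB: "E j i \<le> B" if "j \<le> v" for i j
  proof -
    have "j \<le> B" "v - j \<le> B" using that vB by auto
    then show ?thesis using Rep.prems(2)[of i] by (simp add: E_def)
  qed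
  define upc where "upc = While (\<lambda>r. r y \<noteq> 1) (Seq (gcom p g) (Do (\<lambda>r. (idle r)(x := (r x, MoveRight), y := (r y, MoveLeft)))))"
  define downc where "downc = While (\<lambda>r. r x \<noteq> 1) (Do (\<lambda>r. (idle r)(x := (r x, MoveLeft), y := (r y, MoveRight))))"
  have up: "\<exists>t \<le> d * (c + 3) + 1. exec k (\<lambda>_. True) upc (st_of (E (v - d)) z p (app tp (W (v - d)))) t
      (st_of (E v) z p (app tp (W v)))" if "d \<le> v" for d
    using that
  proof (induction d)
    case 0
    have "rd k (st_of (E v) z p (app tp (W v))) y = 1" using xy by (simp add: rd_st_of E_def)
    then have "exec k (\<lambda>_. True) upc (st_of (E v) z p (app tp (W v))) 1 (st_of (E v) z p (app tp (W v)))"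
      unfolding upc_def by (intro exec.While_end) simp
    then show ?case by auto
  next
    case (Suc d)
    let ?j = "v - Suc d"
    have j: "v - d = Suc ?j" "?j < v" "v - ?j = Suc d" using Suc.prems by auto
    obtain t where t: "t \<le> d * (c + 3) + 1"
      "exec k (\<lambda>_. True) upc (st_of (E (Suc ?j)) z p (app tp (W (Suc ?j)))) t (st_of (E v) z p (app tp (W v)))"
      using Suc j by auto
    have "\<forall>j < v. gok k p g z (E j)" using Rep.prems(1) by (simp add: E_def v_def)
    then have "gok k p g z (E ?j)" using j(2) by blast
    then obtain t' where t': "t' \<le> c"
      "exec k (\<lambda>_. True) (gcom p g) (st_of (E ?j) z p (app tp (W ?j))) t'
        (st_of (E ?j) z p (app (app tp (W ?j)) (out g z (E ?j))))"
      using Rep.IH[of "E ?j" "app tp (W ?j)"] EB[of ?j] Rep.prems(3) j by (auto simp: c_def)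
    have W: "app (app tp (W ?j)) (out g z (E ?j)) = app tp (W (Suc ?j))"
      by (simp add: W_def app_append)
    have mv: "exec k (\<lambda>_. True) (Do (\<lambda>r. (idle r)(x := (r x, MoveRight), y := (r y, MoveLeft))))
        (st_of (E ?j) z p (app tp (W (Suc ?j)))) 1 (st_of (E (Suc ?j)) z p (app tp (W (Suc ?j))))"
    proof (rule exec_Do_True, subst upd_move(1)[OF xy(1-5)])
      have "(E ?j)(x := Suc (E ?j x), y := E ?j y - 1) = E (Suc ?j)" using xy by (auto simp: E_def fun_eq_iff)
      then show "st_of (E (Suc ?j)) z p (app tp (W (Suc ?j))) =
        st_of ((E ?j)(x := Suc (E ?j x), y := E ?j y - 1)) z p (app tp (W (Suc ?j)))" by simp
    qed
    have "rd k (st_of (E ?j) z p (app tp (W ?j))) y \<noteq> 1"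
      using xy j(3) by (simp add: rd_st_of E_def tape_of_eq_1)
    from exec.While_step[OF this exec.Seq[OF t'(2)[unfolded W] mv] t(2)[unfolded upc_def]]
    have "exec k (\<lambda>_. True) upc (st_of (E ?j) z p (app tp (W ?j))) (Suc (Suc (t' + 1) + t))
        (st_of (E v) z p (app tp (W v)))" by (simp only: upc_def)
    then show ?case using t(1) t'(1) by (intro exI[of _ "Suc (Suc (t' + 1) + t)"]) simp
  qed
  have down: "exec k (\<lambda>_. True) downc (st_of (E j) z p tp') (2 * j + 1) (st_of (E 0) z p tp')" if "j \<le> v" for j tp'
    using that
  proof (induction j)
    case 0
    have "rd k (st_of (E 0) z p tp') x = 1" using xy by (simp add: rd_st_of E_def)
    then have "exec k (\<lambda>_. True) downc (st_of (E 0) z p tp') 1 (st_of (E 0) z p tp')"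
      unfolding downc_def by (intro exec.While_end) simp
    then show ?case by simp
  next
    case (Suc j)
    have mv: "exec k (\<lambda>_. True) (Do (\<lambda>r. (idle r)(x := (r x, MoveLeft), y := (r y, MoveRight))))
        (st_of (E (Suc j)) z p tp') 1 (st_of (E j) z p tp')"
    proof (rule exec_Do_True, subst upd_move(2)[OF xy(1-5)])
      have "(E (Suc j))(x := E (Suc j) x - 1, y := Suc (E (Suc j) y)) = E j"
        using xy Suc.prems by (auto simp: E_def fun_eq_iff)
      then show "st_of (E j) z p tp' = st_of ((E (Suc j))(x := E (Suc j) x - 1, y := Suc (E (Suc j) y))) z p tp'" by simp
    qed
    have "rd k (st_of (E (Suc j)) z p tp') x \<noteq> 1" using xy by (simp add: rd_st_of E_def tape_of_eq_1)
    from exec.While_step[OF this mv Suc.IH[unfolded downc_def]] Suc.prems show ?case by (simp add: downc_def)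
  qed
  have E0: "E 0 = e" using xy by (auto simp: E_def v_def fun_eq_iff)
  have Wv: "W v = out (Rep x y g) z e" by (simp add: W_def E_def v_def)
  obtain t where t: "t \<le> v * (c + 3) + 1"
    "exec k (\<lambda>_. True) upc (st_of e z p tp) t (st_of (E v) z p (app tp (W v)))"
    using up[of v] by (auto simp: E0 W_def)
  have dn: "exec k (\<lambda>_. True) downc (st_of (E v) z p (app tp (W v))) (2 * v + 1) (st_of (E 0) z p (app tp (W v)))"
    by (rule down) simp
  have "exec k (\<lambda>_. True) (gcom p (Rep x y g)) (st_of e z p tp) (Suc (t + (2 * v + 1)))
      (st_of e z p (app tp (out (Rep x y g) z e)))"
    unfolding gcom.simps upc_def[symmetric] downc_def[symmetric]
    using exec.Seq[OF t(2) dn] by (simp only: Wv E0)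
  moreover have "Suc (t + (2 * v + 1)) \<le> poly (cost (Rep x y g)) B"
  proof -
    have "Suc (t + (2 * v + 1)) \<le> v * (c + 5) + 3" using t(1) by (simp add: algebra_simps)
    also have "\<dots> \<le> B * (c + 5) + 3" using vB by simp
    finally show ?thesis by (simp add: c_def)
  qed
  ultimately show ?case by blast
qed

primrec glets :: "nat \<Rightarrow> gen \<Rightarrow> bool" where
  "glets G (Emit ws) \<longleftrightarrow> (\<forall>a \<in> set ws. a + 2 < G)"
| "glets G (Then g h) \<longleftrightarrow> glets G g \<and> glets G h"
| "glets G (Rep x y g) \<longleftrightarrow> glets G g"
| "glets G (Test x a g h) \<longleftrightarrow> glets G g \<and> glets G h"

lemma wf_gcom: "glets G g \<Longrightarrow> wf_com k G (gcom p g)"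
proof (induction g)
  case (Emit ws)
  then show ?case by (induction ws) (auto simp: skip_def idle_def)
qed (auto simp: idle_def)

section \<open>Formula schemata over counters\<close>

text \<open>A schema depends on the machine alone, and the input enters through the counters and
  tape contents. The printing program therefore has a fixed size for each machine.\<close>

datatype sch =
    STru | SFls | SNeg sch | SConj sch sch | SDisj sch sch | SBox sch | SDia sch
  | SVar nat nat nat
  | SDeep nat nat
  | SAll nat nat sch
  | STest nat nat sch sch
  | SPow nat nat nat sch sch sch

text \<open>
  \<open>SVar x w m\<close> is the variable of index \<open>w * x + m\<close> for the value of counter \<open>x\<close>, and \<open>SPow x y m a r s\<close> stacks
  \<open>m * y\<close> copies of \<open>\<lambda>\<phi>. a \<and> \<box> (r \<longrightarrow> \<phi>)\<close> on top of \<open>s\<close>.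
\<close>

primrec to_fm :: "sch \<Rightarrow> (nat \<Rightarrow> nat list) \<Rightarrow> (nat \<Rightarrow> nat) \<Rightarrow> fm" where
  "to_fm STru z e = Tru"
| "to_fm SFls z e = Fls"
| "to_fm (SNeg s) z e = Neg (to_fm s z e)"
| "to_fm (SConj s t) z e = Conj (to_fm s z e) (to_fm t z e)"
| "to_fm (SDisj s t) z e = Disj (to_fm s z e) (to_fm t z e)"
| "to_fm (SBox s) z e = Box (to_fm s z e)"
| "to_fm (SDia s) z e = Dia (to_fm s z e)"
| "to_fm (SVar x w m) z e = var (e x * w + m)"
| "to_fm (SDeep y w) z e = dias (Suc (e y * w))"
| "to_fm (SAll x y s) z e = foldr (\<lambda>j. Conj (to_fm s z (e(x := j, y := e y - j)))) [0..<e y] Tru"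
| "to_fm (STest x a s t) z e = (if tape_of (z x) (e x) = a then to_fm s z e else to_fm t z e)"
| "to_fm (SPow x y m a r s) z e = foldr (\<lambda>j. (\<lambda>\<phi>. Conj (to_fm a z (e(x := j, y := e y - j)))
      (Box (Disj (Neg (to_fm r z (e(x := j, y := e y - j)))) \<phi>))) ^^ m) [0..<e y] (to_fm s z e)"

text \<open>Prefix notation has no closing symbols, so the layers of \<open>SPow\<close> can be
  opened one after the other and the innermost formula simply follows. Counter 1 is the scratch
  partner with which the value of another counter is printed in unary and then restored.\<close>

primrec to_gen :: "sch \<Rightarrow> gen" where
  "to_gen STru = Emit [0]"
| "to_gen SFls = Emit [1]"
| "to_gen (SNeg s) = Then (Emit [2]) (to_gen s)"
| "to_gen (SConj s t) = Then (Emit [3]) (Then (to_gen s) (to_gen t))"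
| "to_gen (SDisj s t) = Then (Emit [4]) (Then (to_gen s) (to_gen t))"
| "to_gen (SBox s) = Then (Emit [5]) (to_gen s)"
| "to_gen (SDia s) = Then (Emit [6]) (to_gen s)"
| "to_gen (SVar x w m) = Then (Emit [6, 3]) (Then (Rep 1 x (Emit (replicate w 6))) (Then (Emit (replicate m 6 @ [0]))
     (Then (Rep 1 x (Emit (replicate w 5))) (Emit (replicate (Suc m) 5 @ [1])))))"
| "to_gen (SDeep y w) = Then (Rep 1 y (Emit (replicate w 6))) (Emit [6, 0])"
| "to_gen (SAll x y s) = Then (Rep x y (Then (Emit [3]) (to_gen s))) (Emit [0])"
| "to_gen (STest x a s t) = Test x a (to_gen s) (to_gen t)"
| "to_gen (SPow x y m a r s) = Then (Rep x y (foldr Then (replicate m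
      (Then (Emit [3]) (Then (to_gen a) (Then (Emit [5, 4, 2]) (to_gen r))))) (Emit []))) (to_gen s)"

primrec sok :: "nat \<Rightarrow> nat \<Rightarrow> sch \<Rightarrow> (nat \<Rightarrow> nat list) \<Rightarrow> (nat \<Rightarrow> nat) \<Rightarrow> bool" where
  "sok k p STru z e \<longleftrightarrow> True"
| "sok k p SFls z e \<longleftrightarrow> True"
| "sok k p (SNeg s) z e \<longleftrightarrow> sok k p s z e"
| "sok k p (SConj s t) z e \<longleftrightarrow> sok k p s z e \<and> sok k p t z e"
| "sok k p (SDisj s t) z e \<longleftrightarrow> sok k p s z e \<and> sok k p t z e"
| "sok k p (SBox s) z e \<longleftrightarrow> sok k p s z e"
| "sok k p (SDia s) z e \<longleftrightarrow> sok k p s z e"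
| "sok k p (SVar x w m) z e \<longleftrightarrow> x < k \<and> 1 < k \<and> x \<noteq> 1 \<and> x \<noteq> p \<and> 1 \<noteq> p \<and> e 1 = 0"
| "sok k p (SDeep y w) z e \<longleftrightarrow> y < k \<and> 1 < k \<and> y \<noteq> 1 \<and> y \<noteq> p \<and> 1 \<noteq> p \<and> e 1 = 0"
| "sok k p (SAll x y s) z e \<longleftrightarrow> x < k \<and> y < k \<and> x \<noteq> y \<and> x \<noteq> p \<and> y \<noteq> p \<and> e x = 0 \<and>
     (\<forall>j < e y. sok k p s z (e(x := j, y := e y - j)))"
| "sok k p (STest x a s t) z e \<longleftrightarrow> x < k \<and> x \<noteq> p \<and> sok k p s z e \<and> sok k p t z e"
| "sok k p (SPow x y m a r s) z e \<longleftrightarrow> x < k \<and> y < k \<and> x \<noteq> y \<and> x \<noteq> p \<and> y \<noteq> p \<and> e x = 0 \<and>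
     (\<forall>j < e y. sok k p a z (e(x := j, y := e y - j)) \<and> sok k p r z (e(x := j, y := e y - j))) \<and> sok k p s z e"

lemma concat_replicate': "concat (map (\<lambda>j. replicate w a) [0..<n]) = replicate (n * w) a"
  by (induction n) (auto simp: replicate_add[symmetric] add.commute)

lemma encode_dias: "encode (dias n) = replicate n 6 @ [0]"
  by (induction n) auto

lemma encode_boxes: "encode (boxes n) = replicate n 5 @ [1]"
  by (induction n) auto

lemma encode_foldr_Conj: "encode (foldr (\<lambda>j. Conj (f j)) js \<phi>) = concat (map (\<lambda>j. 3 # encode (f j)) js) @ encode \<phi>"
  by (induction js) auto

lemma encode_layers: "encode (((\<lambda>\<phi>. Conj a (Box (Disj (Neg r) \<phi>))) ^^ m) \<phi>) =
    concat (replicate m (3 # encode a @ [5, 4, 2] @ encode r)) @ encode \<phi>"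
  by (induction m) auto

lemma encode_foldr_layers: "encode (foldr (\<lambda>j. (\<lambda>\<phi>. Conj (f j) (Box (Disj (Neg (g j)) \<phi>))) ^^ m) js \<phi>) =
    concat (map (\<lambda>j. concat (replicate m (3 # encode (f j) @ [5, 4, 2] @ encode (g j)))) js) @ encode \<phi>"
  by (induction js) (simp_all add: encode_layers)

lemma out_foldr_Then: "out (foldr Then (replicate m g) (Emit [])) z e = concat (replicate m (out g z e))"
  by (induction m) auto

lemma gok_foldr_Then: "gok k p g z e \<Longrightarrow> gok k p (foldr Then (replicate m g) (Emit [])) z e"
  by (induction m) auto

lemma to_gen_correct: "sok k p s z e \<Longrightarrow> gok k p (to_gen s) z e \<and> out (to_gen s) z e = encode (to_fm s z e)"
proof (induction s arbitrary: e)
  case (SVar x w m)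
  then show ?case
    by (simp add: var_def concat_replicate' encode_dias encode_boxes replicate_add replicate_app_Cons_same)
next
  case (SDeep y w)
  then show ?case by (simp add: concat_replicate' encode_dias replicate_app_Cons_same)
next
  case (SAll x y s)
  have "concat (map (\<lambda>j. 3 # out (to_gen s) z (e(x := j, y := e y - j))) [0..<e y]) =
      concat (map (\<lambda>j. 3 # encode (to_fm s z (e(x := j, y := e y - j)))) [0..<e y])"
    by (intro arg_cong[where f = concat] map_cong) (use SAll in auto)
  moreover have "gok k p (to_gen s) z (e(x := j, y := e y - j))" if "j < e y" for j
  proof -
    have "sok k p s z (e(x := j, y := e y - j))" using SAll.prems that by simp
    then show ?thesis using SAll.IH by blast
  qed
  ultimately show ?case using SAll.prems by (simp add: encode_foldr_Conj)
next
  case (SPow x y m a r s)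
  have F: "gok k p (to_gen a) z (e(x := j, y := e y - j))" "gok k p (to_gen r) z (e(x := j, y := e y - j))"
      "out (to_gen a) z (e(x := j, y := e y - j)) = encode (to_fm a z (e(x := j, y := e y - j)))"
      "out (to_gen r) z (e(x := j, y := e y - j)) = encode (to_fm r z (e(x := j, y := e y - j)))"
    if "j < e y" for j
  proof -
    have "sok k p a z (e(x := j, y := e y - j))" "sok k p r z (e(x := j, y := e y - j))"
      using SPow.prems that by simp_all
    then show "gok k p (to_gen a) z (e(x := j, y := e y - j))" "gok k p (to_gen r) z (e(x := j, y := e y - j))"
      "out (to_gen a) z (e(x := j, y := e y - j)) = encode (to_fm a z (e(x := j, y := e y - j)))"
      "out (to_gen r) z (e(x := j, y := e y - j)) = encode (to_fm r z (e(x := j, y := e y - j)))"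
      using SPow.IH by blast+
  qed
  then have "concat (map (\<lambda>j. concat (replicate m (3 # out (to_gen a) z (e(x := j, y := e y - j)) @
        5 # 4 # 2 # out (to_gen r) z (e(x := j, y := e y - j))))) [0..<e y]) =
      concat (map (\<lambda>j. concat (replicate m (3 # encode (to_fm a z (e(x := j, y := e y - j))) @
        5 # 4 # 2 # encode (to_fm r z (e(x := j, y := e y - j)))))) [0..<e y])"
    by (intro arg_cong[where f = concat] map_cong) auto
  moreover have "gok k p (to_gen s) z e" "out (to_gen s) z e = encode (to_fm s z e)" using SPow by simp_all
  ultimately show ?case using SPow.prems F
    by (simp add: encode_foldr_layers out_foldr_Then gok_foldr_Then del: foldr_replicate)
qed auto

lemma glets_funpow_Then: "glets G g \<Longrightarrow> glets G ((Then g ^^ m) (Emit []))"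
  by (induction m) auto

lemma glets_to_gen: "9 \<le> G \<Longrightarrow> glets G (to_gen s)"
  by (induction s) (auto simp: glets_funpow_Then)

lemma holds_foldr_Conj: "holds R v (foldr (\<lambda>j. Conj (f j)) js \<phi>) \<longleftrightarrow> (\<forall>j \<in> set js. holds R v (f j)) \<and> holds R v \<phi>"
  by (induction js) auto

definition sconjs :: "sch list \<Rightarrow> sch" where
  "sconjs ss = foldr SConj ss STru"

definition sdisjs :: "sch list \<Rightarrow> sch" where
  "sdisjs ss = foldr SDisj ss SFls"

lemma sconjs_simps:
  "holds R v (to_fm (sconjs ss) z e) \<longleftrightarrow> (\<forall>s \<in> set ss. holds R v (to_fm s z e))"
  "sok k p (sconjs ss) z e \<longleftrightarrow> (\<forall>s \<in> set ss. sok k p s z e)"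
  by (induction ss) (auto simp: sconjs_def)

lemma sdisjs_simps:
  "holds R v (to_fm (sdisjs ss) z e) \<longleftrightarrow> (\<exists>s \<in> set ss. holds R v (to_fm s z e))"
  "sok k p (sdisjs ss) z e \<longleftrightarrow> (\<forall>s \<in> set ss. sok k p s z e)"
  by (induction ss) (auto simp: sdisjs_def)

section \<open>The formula of a machine and an input\<close>

text \<open>
  In the formula, counter 0 is the cell \<open>j\<close>, counter 1 is used for printing chains of modalities, counter 2
  for the levels; counters 3, 4 and 6 hold \<open>S + 1\<close> and counter 5 holds \<open>S\<close>, where \<open>S\<close> bounds the space.
\<close>

definition sv :: "tm \<Rightarrow> nat \<Rightarrow> nat \<Rightarrow> sch" where
  "sv M X b = SVar 0 (colw M) (vindex M X b)"

definition sv_next :: "tm \<Rightarrow> nat \<Rightarrow> nat \<Rightarrow> sch" where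
  "sv_next M X b = SVar 0 (colw M) (colw M + vindex M X b)"

definition sleft :: "tm \<Rightarrow> sch" where
  "sleft M = SVar 0 0 (3 * cbits M)"

text \<open>Counter 4 keeps the value \<open>Suc S\<close> while the loops over cells run counter 3
  down.\<close>

definition sdeep :: "tm \<Rightarrow> sch" where
  "sdeep M = SDeep 4 (colw M)"

definition sbox :: "tm \<Rightarrow> sch \<Rightarrow> sch" where
  "sbox M s = SBox (SDisj (SNeg (sdeep M)) s)"

definition sdia :: "tm \<Rightarrow> sch \<Rightarrow> sch" where
  "sdia M s = SDia (SConj (sdeep M) s)"

definition slit :: "bool \<Rightarrow> sch \<Rightarrow> sch" where
  "slit c s = (if c then s else SNeg s)"

definition siff :: "sch \<Rightarrow> sch \<Rightarrow> sch" where
  "siff s t = SDisj (SConj s t) (SConj (SNeg s) (SNeg t))"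

text \<open>The two bits belong to different worlds, so no equivalence evaluated at one world can
  compare them. Splitting on the bit at the parent leaves a literal to be imposed on the
  children.\<close>

definition spass :: "tm \<Rightarrow> nat \<Rightarrow> sch \<Rightarrow> nat \<Rightarrow> nat \<Rightarrow> sch" where
  "spass M X c Y b = SDisj (SConj (sv M X b) (sbox M (SDisj (SNeg c) (sv M Y b))))
     (SConj (SNeg (sv M X b)) (sbox M (SDisj (SNeg c) (SNeg (sv M Y b)))))"

definition snode :: "tm \<Rightarrow> sch" where
  "snode M = SConj (sdia M (sleft M)) (SConj (sdia M (SNeg (sleft M)))
     (SAll 0 3 (sconjs (map (\<lambda>b. sconjs [spass M 0 (sleft M) 0 b, spass M 1 (sleft M) 2 b,
        spass M 1 (SNeg (sleft M)) 0 b, spass M 2 (SNeg (sleft M)) 2 b]) [0..<cbits M]))))"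

definition scell :: "tm \<Rightarrow> nat \<Rightarrow> nat \<Rightarrow> nat \<Rightarrow> nat \<Rightarrow> nat \<times> move \<Rightarrow> sch" where
  "scell M \<tau> q q' x ac = sconjs
     (map (\<lambda>p. SNeg (sv M 0 (hbit M \<tau> p))) (filter (\<lambda>p. p \<noteq> q) [0..<num_states M])
    @ map (\<lambda>p. SNeg (sv M 2 (hbit M \<tau> p))) (filter (\<lambda>p. p \<noteq> q') [0..<num_states M])
    @ [SDisj (SNeg (sv M 0 (hbit M \<tau> q))) (sv M 0 (sbit M \<tau> x))]
    @ map (\<lambda>a. siff (sv M 2 (sbit M \<tau> a))
        (if a = fst ac then SDisj (sv M 0 (hbit M \<tau> q)) (sv M 0 (sbit M \<tau> a))
         else SConj (SNeg (sv M 0 (hbit M \<tau> q))) (sv M 0 (sbit M \<tau> a)))) [0..<num_symbols M]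
    @ (if snd ac = Stay then [siff (sv M 2 (hbit M \<tau> q')) (sv M 0 (hbit M \<tau> q))] else []))"

text \<open>\<open>STest 0 1\<close> asks whether the current cell is cell 0, since the input tape
  shows the marker there and nowhere else.\<close>

definition smove :: "tm \<Rightarrow> nat \<Rightarrow> nat \<Rightarrow> nat \<Rightarrow> move \<Rightarrow> sch" where
  "smove M \<tau> q q' d = (case d of
      Stay \<Rightarrow> STru
    | MoveLeft \<Rightarrow> siff (sv M 2 (hbit M \<tau> q'))
        (SDisj (STest 0 1 (sv M 0 (hbit M \<tau> q)) SFls) (sv_next M 0 (hbit M \<tau> q)))
    | MoveRight \<Rightarrow> SConj (siff (sv_next M 2 (hbit M \<tau> q')) (sv M 0 (hbit M \<tau> q)))
        (STest 0 1 (SNeg (sv M 2 (hbit M \<tau> q'))) STru))"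

text \<open>The loop for movements runs over counter 5, so that the right neighbour is still a
  described cell. Outside that loop the value of counter 5 addresses the guard cell
  \<open>S\<close>.\<close>

definition stape :: "tm \<Rightarrow> nat \<Rightarrow> nat \<Rightarrow> nat \<Rightarrow> nat \<Rightarrow> nat \<times> move \<Rightarrow> sch" where
  "stape M \<tau> q q' x ac = SConj (SAll 0 3 (scell M \<tau> q q' x ac))
     (SConj (SAll 0 5 (smove M \<tau> q q' (snd ac))) (SNeg (SVar 5 (colw M) (vindex M 2 (hbit M \<tau> q')))))"

definition sleaf :: "tm \<Rightarrow> sch" where
  "sleaf M = sdisjs (map (\<lambda>(q, xs). sconjs (map (\<lambda>\<tau>. stape M \<tau> q (fst (nxt M q xs)) (xs ! \<tau>) (snd (nxt M q xs) ! \<tau>))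
     [0..<num_tapes M])) (guesses M))"

text \<open>In the initial configuration the symbol \<open>a\<close> on the input tape determines the whole column of cells.\<close>

definition init_bit :: "tm \<Rightarrow> nat \<Rightarrow> nat \<Rightarrow> bool" where
  "init_bit M a b = (let \<tau> = b div width M; r = b mod width M in
     if r < num_symbols M then r = (if \<tau> = 0 then a else if a = 1 then 1 else 0)
     else a = 1 \<and> r - num_symbols M = start_state M)"

definition sinit :: "tm \<Rightarrow> sch" where
  "sinit M = SAll 0 3 (foldr (\<lambda>a. STest 0 a (sconjs (map (\<lambda>b. slit (init_bit M a b) (sv M 0 b)) [0..<cbits M])))
     [0..<num_symbols M] STru)"

text \<open>Excluding all other states is enough: the last configuration is forced to be the real
  one, whose head on tape 0 shows the state at some cell below \<open>S\<close>.\<close>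

definition sacc :: "tm \<Rightarrow> sch" where
  "sacc M = SAll 0 3 (sconjs (map (\<lambda>p. SNeg (sv M 2 (hbit M 0 p))) (filter (\<lambda>p. p \<noteq> accept_state M) [0..<num_states M])))"

definition sformula :: "tm \<Rightarrow> sch" where
  "sformula M = SConj (sinit M) (SConj (sacc M)
     (SPow 2 6 (num_states M + num_tapes M + num_tapes M * num_symbols M) (snode M) (sdeep M) (sleaf M)))"

text \<open>Counters 2 and 6 are left out, because \<open>SPow\<close> changes them while the layers
  printed inside rely on the values listed here.\<close>

definition sized :: "nat \<Rightarrow> (nat \<Rightarrow> nat) \<Rightarrow> bool" where
  "sized S e \<longleftrightarrow> e 0 = 0 \<and> e 1 = 0 \<and> e 3 = Suc S \<and> e 4 = Suc S \<and> e 5 = S"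

section \<open>Meaning of the schemata\<close>

lemma holds_sv: "holds R v (to_fm (sv M X b) z e) \<longleftrightarrow> pv M R v X (e 0) b"
  by (simp add: sv_def pv_def)

lemma holds_sv_next: "holds R v (to_fm (sv_next M X b) z e) \<longleftrightarrow> pv M R v X (Suc (e 0)) b"
  by (simp add: sv_next_def pv_def algebra_simps)

lemma holds_sleft: "holds R v (to_fm (sleft M) z e) \<longleftrightarrow> left_child M R v"
  by (simp add: sleft_def left_child_def)

lemma holds_sdeep: "e 4 = Suc S \<Longrightarrow> holds R v (to_fm (sdeep M) z e) \<longleftrightarrow> deep M S R v"
  by (simp add: sdeep_def deep_def)

lemma holds_sbox: "e 4 = Suc S \<Longrightarrow> holds R v (to_fm (sbox M s) z e) \<longleftrightarrow>
    (\<forall>u. (v, u) \<in> R \<longrightarrow> deep M S R u \<longrightarrow> holds R u (to_fm s z e))"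
  by (auto simp: sbox_def holds_sdeep)

lemma holds_sdia: "e 4 = Suc S \<Longrightarrow> holds R v (to_fm (sdia M s) z e) \<longleftrightarrow>
    (\<exists>u. (v, u) \<in> R \<and> deep M S R u \<and> holds R u (to_fm s z e))"
  by (auto simp: sdia_def holds_sdeep)

lemma holds_slit: "holds R v (to_fm (slit c s) z e) \<longleftrightarrow> holds R v (to_fm s z e) = c"
  by (simp add: slit_def)

lemma holds_siff: "holds R v (to_fm (siff s t) z e) \<longleftrightarrow> holds R v (to_fm s z e) = holds R v (to_fm t z e)"
  by (auto simp: siff_def)

lemma holds_SAll: "holds R v (to_fm (SAll x y s) z e) \<longleftrightarrow> (\<forall>j < e y. holds R v (to_fm s z (e(x := j, y := e y - j))))"
  by (simp add: holds_foldr_Conj Ball_def)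

lemma holds_spass: "e 4 = Suc S \<Longrightarrow> holds R v (to_fm (spass M X c Y b) z e) \<longleftrightarrow>
    (\<forall>u. (v, u) \<in> R \<longrightarrow> deep M S R u \<longrightarrow> holds R u (to_fm c z e) \<longrightarrow> pv M R u Y (e 0) b = pv M R v X (e 0) b)"
  by (auto simp: spass_def holds_sv holds_sbox)

lemma holds_snode:
  assumes "sized S e"
  shows "holds R v (to_fm (snode M) z e) \<longleftrightarrow> node_ok M S R v"
proof -
  have e: "e 3 = Suc S" "e 4 = Suc S" using assms by (auto simp: sized_def)
  have copies: "holds R v (to_fm (sconjs (map (\<lambda>b. sconjs [spass M 0 (sleft M) 0 b, spass M 1 (sleft M) 2 b,
        spass M 1 (SNeg (sleft M)) 0 b, spass M 2 (SNeg (sleft M)) 2 b]) [0..<cbits M])) z e') \<longleftrightarrow>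
      (\<forall>b < cbits M. \<forall>u. (v, u) \<in> R \<longrightarrow> deep M S R u \<longrightarrow>
        (if left_child M R u then pv M R u 0 (e' 0) b = pv M R v 0 (e' 0) b \<and> pv M R u 2 (e' 0) b = pv M R v 1 (e' 0) b
         else pv M R u 0 (e' 0) b = pv M R v 1 (e' 0) b \<and> pv M R u 2 (e' 0) b = pv M R v 2 (e' 0) b))"
    if e': "e' 4 = Suc S" for e'
  proof -
    have 4: "(\<forall>s \<in> set [s1, s2, s3, s4]. P s) \<longleftrightarrow> P s1 \<and> P s2 \<and> P s3 \<and> P s4" for s1 s2 s3 s4 :: sch and P
      by simp
    show ?thesis
      unfolding sconjs_simps set_map ball_simps set_upt 4 holds_spass[of e' S, OF e'] to_fm.simps(3) holds.simps(3) holds_sleft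
      by (simp only: atLeastLessThan_iff le0 simp_thms Ball_def) (intro iff_allI imp_cong refl, auto split: if_splits)
  qed
  have "holds R v (to_fm (sdia M (sleft M)) z e) \<longleftrightarrow> (\<exists>u. (v, u) \<in> R \<and> deep M S R u \<and> left_child M R u)"
    "holds R v (to_fm (sdia M (SNeg (sleft M))) z e) \<longleftrightarrow> (\<exists>u. (v, u) \<in> R \<and> deep M S R u \<and> \<not> left_child M R u)"
    by (simp_all only: holds_sdia[of e S, OF e(2)] holds_sleft to_fm.simps(3) holds.simps(3))
  moreover have "(e(0 := j, 3 := Suc S - j)) 4 = Suc S" "(e(0 := j, 3 := Suc S - j)) 0 = j" for j
    using e by simp_all
  ultimately show ?thesis
    unfolding snode_def node_ok_def to_fm.simps(4) holds.simps(4) holds_SAll e(1) less_Suc_eq_le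
    by (simp only: copies)
qed

lemma holds_stape:
  assumes "sized S e"
  shows "holds R v (to_fm (stape M \<tau> q q' x ac) z e) \<longleftrightarrow>
    tape_ok S (num_symbols M) (num_states M) q q' x ac
      (\<lambda>j a. pv M R v 0 j (sbit M \<tau> a)) (\<lambda>j p. pv M R v 0 j (hbit M \<tau> p))
      (\<lambda>j a. pv M R v 2 j (sbit M \<tau> a)) (\<lambda>j p. pv M R v 2 j (hbit M \<tau> p))"
proof -
  have e: "e 3 = Suc S" "e 5 = S" using assms by (auto simp: sized_def)
  define C where "C j \<longleftrightarrow> (\<forall>p<num_states M. p \<noteq> q \<longrightarrow> \<not> pv M R v 0 j (hbit M \<tau> p)) \<and>
        (\<forall>p<num_states M. p \<noteq> q' \<longrightarrow> \<not> pv M R v 2 j (hbit M \<tau> p)) \<and>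
        (pv M R v 0 j (hbit M \<tau> q) \<longrightarrow> pv M R v 0 j (sbit M \<tau> x)) \<and>
        (\<forall>a<num_symbols M. pv M R v 2 j (sbit M \<tau> a) \<longleftrightarrow>
           (if pv M R v 0 j (hbit M \<tau> q) then a = fst ac else pv M R v 0 j (sbit M \<tau> a))) \<and>
        (snd ac = Stay \<longrightarrow> (pv M R v 2 j (hbit M \<tau> q') \<longleftrightarrow> pv M R v 0 j (hbit M \<tau> q)))" for j
  define L where "L j \<longleftrightarrow> (snd ac = MoveLeft \<longrightarrow>
      (if j = 0 then pv M R v 2 0 (hbit M \<tau> q') \<longleftrightarrow> pv M R v 0 0 (hbit M \<tau> q) \<or> pv M R v 0 (Suc 0) (hbit M \<tau> q)
          else pv M R v 2 j (hbit M \<tau> q') \<longleftrightarrow> pv M R v 0 (Suc j) (hbit M \<tau> q)))" for j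
  define N where "N j \<longleftrightarrow> (snd ac = MoveRight \<longrightarrow> (pv M R v 2 (Suc j) (hbit M \<tau> q') \<longleftrightarrow> pv M R v 0 j (hbit M \<tau> q)) \<and>
          (j = 0 \<longrightarrow> \<not> pv M R v 2 0 (hbit M \<tau> q')))" for j
  have cell: "holds R v (to_fm (scell M \<tau> q q' x ac) z e') \<longleftrightarrow> C (e' 0)" for e'
    unfolding scell_def sconjs_simps C_def
    by (auto simp: holds_sv holds_siff ball_Un)
  have mv: "holds R v (to_fm (smove M \<tau> q q' (snd ac)) z e') \<longleftrightarrow> L (e' 0) \<and> N (e' 0)" for e'
    by (cases "snd ac") (auto simp: smove_def holds_sv holds_sv_next holds_siff tape_of_eq_1 L_def N_def)
  have last: "holds R v (to_fm (SVar 5 (colw M) (vindex M 2 (hbit M \<tau> q'))) z e) \<longleftrightarrow> pv M R v 2 S (hbit M \<tau> q')"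
    by (simp add: pv_def e)
  show ?thesis
    unfolding stape_def to_fm.simps(3,4) holds.simps(3,4) holds_SAll cell mv last tape_ok_def
      C_def[symmetric] L_def[symmetric] N_def[symmetric]
    by (auto simp: e less_Suc_eq_le)
qed

definition leaf_ok :: "tm \<Rightarrow> nat \<Rightarrow> ('w \<times> 'w) set \<Rightarrow> 'w \<Rightarrow> bool" where
  "leaf_ok M S R v \<longleftrightarrow> (\<exists>(q, xs) \<in> set (guesses M). trans_ok M S q xs (pv M R v 0) (pv M R v 2))"

lemma ball_upt: "(\<forall>x \<in> {0..<n}. P x) \<longleftrightarrow> (\<forall>x < n :: nat. P x)"
  by auto

lemma holds_sleaf:
  assumes "sized S e"
  shows "holds R v (to_fm (sleaf M) z e) \<longleftrightarrow> leaf_ok M S R v"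
  unfolding sleaf_def sdisjs_simps leaf_ok_def trans_ok_def
  by (simp add: sconjs_simps holds_stape[OF assms] case_prod_beta ball_upt)

lemma holds_icell:
  assumes "\<forall>a < G. holds R v (to_fm (f a) z e) = P a" "tape_of (z 0) (e 0) < G"
  shows "holds R v (to_fm (foldr (\<lambda>a. STest 0 a (f a)) [0..<G] STru) z e) \<longleftrightarrow> P (tape_of (z 0) (e 0))"
proof -
  have "holds R v (to_fm (foldr (\<lambda>a. STest 0 a (f a)) as STru) z e) \<longleftrightarrow>
    (tape_of (z 0) (e 0) \<in> set as \<longrightarrow> P (tape_of (z 0) (e 0)))" if "set as \<subseteq> {..<G}" for as
    using that assms(1) by (induction as) auto
  from this[of "[0..<G]"] show ?thesis using assms(2) by (simp add: lessThan_atLeast0)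
qed

lemma bit_init:
  assumes M: "wf_tm M" and b: "b < cbits M"
  shows "bit M (init_config M w) j b = init_bit M (tape_of w j) b"
proof -
  define \<tau> where "\<tau> = b div width M"
  have "\<tau> < num_tapes M" using b by (simp add: \<tau>_def cbits_def less_mult_imp_div_less)
  then have ts: "snd (init_config M w) ! \<tau> = (0, tape_of (if \<tau> = 0 then w else []))"
    by (cases \<tau>) (auto simp: init_config_def)
  have st: "fst (init_config M w) = start_state M" by (simp add: init_config_def)
  have z: "tape_of w j = Suc 0 \<longleftrightarrow> j = 0" "tape_of [] j = (if j = 0 then 1 else 0)" by (auto simp: tape_of_def)
  show ?thesis
    unfolding bit_def init_bit_def Let_def \<tau>_def[symmetric] ts st by (auto simp: z)
qed

lemma holds_sinit:
  assumes "sized S e" and M: "wf_tm M" and lt: "\<And>j. tape_of (z 0) j < num_symbols M"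
  shows "holds R v (to_fm (sinit M) z e) \<longleftrightarrow> encodes M S R v 0 (init_config M (z 0))"
proof -
  have e: "e 3 = Suc S" using assms by (auto simp: sized_def)
  have "holds R v (to_fm (foldr (\<lambda>a. STest 0 a (sconjs (map (\<lambda>b. slit (init_bit M a b) (sv M 0 b)) [0..<cbits M])))
     [0..<num_symbols M] STru) z e') \<longleftrightarrow> (\<forall>b < cbits M. pv M R v 0 (e' 0) b = init_bit M (tape_of (z 0) (e' 0)) b)" for e'
    by (rule holds_icell) (auto simp: sconjs_simps holds_slit holds_sv lt)
  then show ?thesis
    unfolding sinit_def holds_SAll encodes_def by (simp add: e less_Suc_eq_le bit_init[OF M])
qed

lemma holds_sacc:
  assumes "sized S e"
  shows "holds R v (to_fm (sacc M) z e) \<longleftrightarrow>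
    (\<forall>j\<le>S. \<forall>p < num_states M. p \<noteq> accept_state M \<longrightarrow> \<not> pv M R v 2 j (hbit M 0 p))"
  using assms unfolding sacc_def holds_SAll by (auto simp: sized_def sconjs_simps holds_sv less_Suc_eq_le)

lemma holds_layers:
  assumes "\<And>v. holds R v a = node_ok M S R v" "\<And>v. holds R v r = deep M S R v"
  shows "(\<lambda>v. holds R v (((\<lambda>\<phi>. Conj a (Box (Disj (Neg r) \<phi>))) ^^ m) \<phi>)) = (layer M S R ^^ m) (\<lambda>v. holds R v \<phi>)"
  by (induction m) (auto simp: assms layer_def fun_eq_iff)

lemma holds_foldr_layers:
  assumes "\<And>j v. holds R v (f j) = node_ok M S R v" "\<And>j v. holds R v (g j) = deep M S R v"
  shows "(\<lambda>v. holds R v (foldr (\<lambda>j. (\<lambda>\<phi>. Conj (f j) (Box (Disj (Neg (g j)) \<phi>))) ^^ m) js \<phi>)) =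
    (layer M S R ^^ (m * length js)) (\<lambda>v. holds R v \<phi>)"
proof (induction js)
  case (Cons j js)
  have "(layer M S R ^^ (m * length (j # js))) = (layer M S R ^^ m) \<circ> (layer M S R ^^ (m * length js))"
    by (simp add: funpow_add)
  then show ?case using holds_layers[of R "f j" M S "g j", OF assms] Cons.IH by simp
qed simp

lemma holds_SPow:
  assumes e: "sized S e" "e 6 = Suc S"
  shows "holds R v (to_fm (SPow 2 6 m (snode M) (sdeep M) s) z e) \<longleftrightarrow>
    (layer M S R ^^ (m * Suc S)) (\<lambda>v. holds R v (to_fm s z e)) v"
proof -
  have ok: "sized S (e(2 := j, 6 := x))" "(e(2 := j, 6 := x)) 4 = Suc S" for j x
    using e by (simp_all add: sized_def)
  have "(\<lambda>v. holds R v (foldr (\<lambda>j. (\<lambda>\<phi>. Conj (to_fm (snode M) z (e(2 := j, 6 := e 6 - j)))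
      (Box (Disj (Neg (to_fm (sdeep M) z (e(2 := j, 6 := e 6 - j)))) \<phi>))) ^^ m) js \<phi>)) =
      (layer M S R ^^ (m * length js)) (\<lambda>v. holds R v \<phi>)" for js \<phi>
    by (rule holds_foldr_layers) (rule holds_snode[OF ok(1)], rule holds_sdeep, rule ok(2))
  from fun_cong[OF this[of "[0..<Suc S]" "to_fm s z e"], of v] show ?thesis
    by (simp only: to_fm.simps e(2) length_upt diff_zero)
qed

lemma holds_sformula:
  assumes "sized S e" "e 6 = Suc S" "wf_tm M" "\<And>j. tape_of (z 0) j < num_symbols M"
  shows "holds R v (to_fm (sformula M) z e) \<longleftrightarrow>
    encodes M S R v 0 (init_config M (z 0)) \<and>
    (\<forall>j\<le>S. \<forall>p < num_states M. p \<noteq> accept_state M \<longrightarrow> \<not> pv M R v 2 j (hbit M 0 p)) \<and>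
    (layer M S R ^^ ((num_states M + num_tapes M + num_tapes M * num_symbols M) * Suc S))
      (leaf_ok M S R) v"
  unfolding sformula_def to_fm.simps(4) holds.simps(4) holds_sinit[of S e M z, OF assms(1,3,4)] holds_sacc[OF assms(1)]
    holds_SPow[OF assms(1,2)] holds_sleaf[OF assms(1)] ..

theorem sformula_satisfiable:
  assumes inf: "infinite (UNIV :: 'w set)"
    and M: "decides_in_space M n A s" and w: "w \<in> lists {..<n}" and S: "s (length w) \<le> S"
    and e: "sized S e" "e 6 = Suc S" and z: "z 0 = w"
  shows "satisfiable TYPE('w) (to_fm (sformula M) z e) \<longleftrightarrow> w \<in> A"
proof -
  define cfg where "cfg i = config_at M w i" for i
  define L where "L = (num_states M + num_tapes M + num_tapes M * num_symbols M) * Suc S"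
  have wfM: "wf_tm M" and nG: "n + 2 \<le> num_symbols M"
    and dec: "\<exists>i. fst (cfg i) = (if w \<in> A then accept_state M else reject_state M)"
    and spc: "\<And>i. \<forall>(h, t) \<in> set (snd (cfg i)). h < s (length w)"
    using M w unfolding decides_in_space_def cfg_def by blast+
  have wf: "wf_config M (cfg i)" for i unfolding cfg_def by (rule wf_config_at[OF wfM nG w])
  have hb: "heads_below M S (cfg i)" for i
    unfolding heads_below_def
  proof (intro allI impI)
    fix \<tau> assume "\<tau> < num_tapes M"
    then have "snd (cfg i) ! \<tau> \<in> set (snd (cfg i))" using wf[of i] by (simp add: wf_config_def)
    then have "fst (snd (cfg i) ! \<tau>) < s (length w)" using spc[of i] by (auto simp: case_prod_beta)
    then show "fst (snd (cfg i) ! \<tau>) < S" using S by simp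
  qed
  have k: "0 < num_tapes M" using wfM by (simp add: wf_tm_def)
  have Suc: "cfg (Suc i) = step M (cfg i)" for i by (simp add: cfg_def config_at_Suc)
  have G: "tape_of (z 0) j < num_symbols M" for j
  proof -
    have "snd (snd (cfg 0) ! 0) j < num_symbols M" using wf[of 0] k by (simp add: wf_config_def)
    then show ?thesis by (simp add: cfg_def config_at_def init_config_def z)
  qed
  \<comment> \<open>Needed in both directions: from left to right at the leaves of an arbitrary
    model, and from right to left at level 0 of the intended model.\<close>
  have step: "leaf_ok M S R v \<longleftrightarrow> encodes M S R v 2 (cfg (Suc i))"
    if "encodes M S R v 0 (cfg i)" for R :: "('v \<times> 'v) set" and v i
    unfolding leaf_ok_def encodes_def Suc cbits_def
    by (rule trans_ok_iff[OF wfM wf hb]) (use that hb[of "Suc i"] in \<open>simp_all add: Suc encodes_def cbits_def del: step.simps\<close>)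
  \<comment> \<open>The machine has halted by time \<open>2 ^ L\<close>, and halting configurations
    persist, so this moment shows the verdict.\<close>
  have final: "fst (cfg (2 ^ L)) = (if w \<in> A then accept_state M else reject_state M)"
  proof -
    obtain i where i: "fst (cfg i) = (if w \<in> A then accept_state M else reject_state M)" using dec by blast
    then have hi: "halting_state M (fst (config_at M w i))" by (auto simp: halting_state_def cfg_def)
    obtain T where T: "T \<le> 2 ^ L" "halting_state M (fst (config_at M w T))"
      using halts_early[of M w S] wf wfM hb hi unfolding cfg_def L_def by blast
    have "config_at M w (2 ^ L) = config_at M w T" using config_at_halted[OF T(2), of "2 ^ L - T"] T(1) by simp
    also have "\<dots> = config_at M w (T + i)" using config_at_halted[OF T(2), of i] by simp
    also have "\<dots> = config_at M w i" using config_at_halted[OF hi, of T] by (simp add: add.commute)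
    finally show ?thesis using i by (simp add: cfg_def)
  qed
  have init: "init_config M (z 0) = cfg 0" by (simp add: cfg_def config_at_def z)
  note F = holds_sformula[of S e M z, OF e wfM G, folded L_def, unfolded init]
  have bits: "pv M R v 2 j (hbit M 0 p) \<longleftrightarrow> fst (snd (cfg i) ! 0) = j \<and> fst (cfg i) = p"
    if "encodes M S R v 2 (cfg i)" "j \<le> S" "p < num_states M" for R :: "('v \<times> 'v) set" and v i j p
    using that k unfolding encodes_def cbits_def all_bits by (auto simp: bit_simps)
  show ?thesis
  proof
    assume "satisfiable TYPE('w) (to_fm (sformula M) z e)"
    then obtain R and v :: 'w where v: "holds R v (to_fm (sformula M) z e)" by (auto simp: satisfiable_def)
    have "encodes M S R v 2 (cfg (0 + 2 ^ L))"
      by (rule savitch_sound[where P = "leaf_ok M S R"]) (use v step[of R] in \<open>simp_all add: F\<close>)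
    then have enc: "encodes M S R v 2 (cfg (2 ^ L))" by simp
    have h: "fst (snd (cfg (2 ^ L)) ! 0) \<le> S" using hb[of "2 ^ L"] k by (simp add: heads_below_def less_imp_le)
    have q: "fst (cfg (2 ^ L)) < num_states M" using wf[of "2 ^ L"] by (simp add: wf_config_def)
    have "fst (cfg (2 ^ L)) = accept_state M" using v bits[OF enc h q] h q unfolding F by blast
    then show "w \<in> A" using final wfM by (auto simp: wf_tm_def split: if_splits)
  next
    assume wA: "w \<in> A"
    let ?R = "mrel M S cfg" and ?v = "Real L 0 True"
    have "encodes M S ?R ?v 0 (cfg 0)" "encodes M S ?R ?v 2 (cfg (2 ^ L))"
      using encodes_Real[of 0 M S cfg L 0 True] encodes_Real[of 2 M S cfg L 0 True] by (simp_all add: offset_def)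
    moreover have "leaf_ok M S ?R (Real 0 i d)" for i d
      using step[of ?R "Real 0 i d" i] encodes_Real[of 0 M S cfg 0 i d] encodes_Real[of 2 M S cfg 0 i d]
      by (simp add: offset_def)
    then have "(layer M S ?R ^^ L) (leaf_ok M S ?R) ?v" by (rule savitch_complete)
    ultimately have "holds ?R ?v (to_fm (sformula M) z e)"
      unfolding F using bits[of ?R ?v "2 ^ L"] final wA by auto
    then have "\<exists>w \<in> UNIV. holds ?R w (to_fm (sformula M) z e)" by blast
    then have "satisfiable TYPE(world) (to_fm (sformula M) z e)"
      unfolding satisfiable_def by (metis UNIV_Times_UNIV empty_not_UNIV top_greatest)
    then show "satisfiable TYPE('w) (to_fm (sformula M) z e)" by (rule satisfiable_infinite_type[OF inf])
  qed
qed

section \<open>Hardness for polynomial space\<close>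

text \<open>A bound of this shape is counted by \<open>d\<close> nested loops of
  \<open>Suc m\<close> rounds that print \<open>C\<close> letters inside.\<close>

lemma poly_nat_bound: "\<exists>C d. \<forall>m. poly (p :: nat poly) m \<le> C * Suc m ^ d"
proof (induction p)
  case (pCons a q)
  then obtain C d where q: "\<And>m. poly q m \<le> C * Suc m ^ d" by blast
  have "poly (pCons a q) m \<le> (a + C) * Suc m ^ Suc d" for m
  proof -
    have "poly (pCons a q) m \<le> a * 1 + Suc m * (C * Suc m ^ d)"
      using mult_le_mono[of m "Suc m", OF _ q[of m]] by simp
    also have "\<dots> \<le> a * Suc m ^ Suc d + Suc m * (C * Suc m ^ d)"
      by (intro add_mono mult_le_mono) (simp_all add: one_le_power del: power_Suc)
    finally show ?thesis by (simp add: algebra_simps)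
  qed
  then show ?case by blast
qed simp

section \<open>The reduction program\<close>

definition full :: "(nat \<Rightarrow> nat) \<Rightarrow> (nat \<Rightarrow> nat list) \<Rightarrow> st" where
  "full e z = (\<lambda>i. (e i, tape_of (z i)))"

definition runs :: "nat \<Rightarrow> com \<Rightarrow> st \<Rightarrow> nat \<Rightarrow> st \<Rightarrow> bool" where
  "runs k c s T s' \<longleftrightarrow> (\<exists>t\<le>T. exec k (\<lambda>_. True) c s t s')"

lemma runs_Seq:
  assumes "runs k a s T u" "runs k b u T' v"
  shows "runs k (Seq a b) s (T + T' + 1) v"
proof -
  obtain t t' where "t \<le> T" "exec k (\<lambda>_. True) a s t u" "t' \<le> T'" "exec k (\<lambda>_. True) b u t' v"
    using assms unfolding runs_def by blast
  then show ?thesis unfolding runs_def by (intro exI[of _ "Suc (t + t')"]) (auto intro: exec.Seq)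
qed

definition shift :: "(nat \<Rightarrow> move) \<Rightarrow> com" where
  "shift mv = Do (\<lambda>r i. (r i, mv i))"

definition moved :: "move \<Rightarrow> nat \<Rightarrow> nat" where
  "moved d h = (case d of MoveLeft \<Rightarrow> h - 1 | Stay \<Rightarrow> h | MoveRight \<Rightarrow> h + 1)"

lemma exec_shift:
  assumes "\<And>i. i < k \<Longrightarrow> e' i = moved (mv i) (e i)" "\<And>i. k \<le> i \<Longrightarrow> e' i = e i"
  shows "exec k (\<lambda>_. True) (shift mv) (full e z) 1 (full e' z)"
  unfolding shift_def
proof (rule exec_Do_True)
  show "full e' z = upd k (\<lambda>i. (rd k (full e z) i, mv i)) (full e z)"
    using assms by (auto simp: fun_eq_iff full_def upd_def rd_def moved_def not_less)
qed

lemma runs_shift: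
  assumes "\<And>i. i < k \<Longrightarrow> e' i = moved (mv i) (e i)" "\<And>i. k \<le> i \<Longrightarrow> e' i = e i"
  shows "runs k (shift mv) (full e z) 1 (full e' z)"
  unfolding runs_def using exec_shift[of k e' mv e z] assms by blast

lemma runs_loop:
  assumes "\<And>i. i < n \<Longrightarrow> p (rd k (\<sigma> i)) \<and> exec k (\<lambda>_. True) c (\<sigma> i) 1 (\<sigma> (Suc i))" "\<not> p (rd k (\<sigma> n))"
  shows "runs k (While p c) (\<sigma> 0) (2 * n + 1) (\<sigma> n)"
proof -
  have "exec k (\<lambda>_. True) (While p c) (\<sigma> (n - d)) (2 * d + 1) (\<sigma> n)" if "d \<le> n" for d
    using that
  proof (induction d)
    case 0
    show ?case using exec.While_end[of p k "\<sigma> n"] assms(2) by simp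
  next
    case (Suc d)
    have j: "n - Suc d < n" "Suc (n - Suc d) = n - d" using Suc.prems by auto
    have s: "p (rd k (\<sigma> (n - Suc d)))" "exec k (\<lambda>_. True) c (\<sigma> (n - Suc d)) 1 (\<sigma> (n - d))"
      using assms(1)[OF j(1)] unfolding j(2) by auto
    from exec.While_step[OF s Suc.IH] Suc.prems show ?case by simp
  qed
  from this[of n] show ?thesis unfolding runs_def by auto
qed

text \<open>The initial step to the right spares the marker in cell 0. On tapes 3 to 6 the printed
  word serves only to put the head at a prescribed position.\<close>

definition produce :: "nat \<Rightarrow> gen \<Rightarrow> com" where
  "produce y g = Seq (shift (\<lambda>i. if i = y then MoveRight else Stay)) (gcom y g)"

lemma runs_produce:
  assumes y: "y < k" "e y = 0" "z y = []" and g: "gok k y g z (e(y := 1))" and B: "\<And>i. e i \<le> B" "1 \<le> B"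
    and w: "out g z (e(y := 1)) = w"
  shows "runs k (produce y g) (full e z) (poly (cost g) B + 2) (full (e(y := Suc (length w))) (z(y := w)))"
proof -
  have a: "runs k (shift (\<lambda>i. if i = y then MoveRight else Stay)) (full e z) 1 (full (e(y := 1)) z)"
    by (rule runs_shift) (use y in \<open>auto simp: moved_def\<close>)
  have f: "full (e(y := 1)) z = st_of (e(y := 1)) z y (Suc (length ([] :: nat list)), tape_of [])"
    using y by (auto simp: full_def st_of_def fun_eq_iff)
  have f': "st_of (e(y := 1)) z y (app (Suc (length ([] :: nat list)), tape_of []) w) = full (e(y := Suc (length w))) (z(y := w))"
    unfolding app_tape_of by (auto simp: full_def st_of_def fun_eq_iff)
  have "\<And>i. (e(y := 1)) i \<le> B" using B by simp
  from gen_exec[OF g this y(1), of "(Suc (length ([] :: nat list)), tape_of [])"]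
  have b: "runs k (gcom y g) (full (e(y := 1)) z) (poly (cost g) B) (full (e(y := Suc (length w))) (z(y := w)))"
    unfolding runs_def f w f' .
  show ?thesis using runs_Seq[OF a b] by (simp add: produce_def)
qed

text \<open>The tapes 0 to 6 are taken by the formula schema. From 7 on, an odd tape holds the
  number of rounds of one loop and the next even tape is its partner.\<close>

primrec nest :: "nat \<Rightarrow> nat \<Rightarrow> gen" where
  "nest C 0 = Emit (replicate C 0)"
| "nest C (Suc i) = Rep (8 + 2 * i) (7 + 2 * i) (nest C i)"

lemma out_nest: "(\<And>i. i < d \<Longrightarrow> e (7 + 2 * i) = N) \<Longrightarrow> out (nest C d) z e = replicate (C * N ^ d) 0"
proof (induction d arbitrary: e)
  case (Suc d)
  have odd: "7 + 2 * i \<noteq> 8 + 2 * d" for i by presburger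
  have "out (nest C d) z (e(8 + 2 * d := j, 7 + 2 * d := x)) = replicate (C * N ^ d) 0" for j x
    by (rule Suc.IH) (use Suc.prems odd in auto)
  then show ?case using Suc.prems[of d] by (simp add: concat_replicate' algebra_simps)
qed simp

lemma gok_nest:
  "(\<And>i. i < d \<Longrightarrow> e (8 + 2 * i) = 0) \<Longrightarrow> 7 + 2 * d < k \<Longrightarrow> y < 7 \<Longrightarrow> gok k y (nest C d) z e"
proof (induction d arbitrary: e)
  case (Suc d)
  have odd: "8 + 2 * i \<noteq> 7 + 2 * d" for i by presburger
  have "gok k y (nest C d) z (e(8 + 2 * d := j, 7 + 2 * d := x))" for j x
    by (rule Suc.IH) (use Suc.prems odd in auto)
  then show ?case using Suc.prems by simp
qed simp

lemma glets_nest: "9 \<le> G \<Longrightarrow> glets G (nest C d)"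
  by (induction d) auto

lemma sok_snode:
  assumes "2 < k" "6 < k" "7 \<le> p" "e 0 = 0" "e 1 = 0"
  shows "sok k p (snode M) z e"
  using assms by (simp add: snode_def sdia_def sbox_def sdeep_def sleft_def sconjs_simps spass_def sv_def)

lemma sok_sleaf:
  assumes "6 < k" "7 \<le> p" "e 0 = 0" "e 1 = 0"
  shows "sok k p (sleaf M) z e"
proof -
  have sv: "sok k p (sv M X b) z e'" "sok k p (sv_next M X b) z e'" if "e' 1 = 0" for X b e'
    using assms that by (simp_all add: sv_def sv_next_def)
  have cell: "sok k p (scell M \<tau> q q' x ac) z e'" if "e' 1 = 0" for \<tau> q q' x ac e'
    using sv[of e', OF that] by (auto simp: scell_def sconjs_simps siff_def split: if_splits)
  have mv: "sok k p (smove M \<tau> q q' d) z e'" if "e' 1 = 0" for \<tau> q q' d e'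
    using sv[of e', OF that] assms by (cases d) (auto simp: smove_def siff_def)
  have "sok k p (stape M \<tau> q q' x ac) z e" for \<tau> q q' x ac
    using assms by (simp add: stape_def cell mv)
  then show ?thesis unfolding sleaf_def sdisjs_simps by (simp add: sconjs_simps case_prod_beta)
qed

lemma sok_sformula:
  assumes "6 < k" "7 \<le> p" "e 0 = 0" "e 1 = 0" "e 2 = 0"
  shows "sok k p (sformula M) z e"
proof -
  have sv: "sok k p (sv M X b) z e'" if "e' 1 = 0" for X b e'
    using assms that by (simp add: sv_def)
  have tests: "sok k p (foldr (\<lambda>a. STest 0 a (f a)) as STru) z e'" if "\<And>a. sok k p (f a) z e'" for f as e'
    using that assms by (induction as) auto
  have "sok k p (foldr (\<lambda>a. STest 0 a (sconjs (map (\<lambda>b. slit (init_bit M a b) (sv M 0 b)) [0..<cbits M])))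
     [0..<num_symbols M] STru) z (e(0 := j, 3 := e 3 - j))" for j
    by (rule tests) (use assms in \<open>auto simp: sconjs_simps slit_def sv\<close>)
  then have "sok k p (sinit M) z e" using assms by (simp add: sinit_def)
  moreover have "sok k p (sacc M) z e" using assms by (simp add: sacc_def sconjs_simps sv)
  moreover have "sok k p (snode M) z (e(2 := j, 6 := x))" for j x by (rule sok_snode) (use assms in auto)
  moreover have "sok k p (sdeep M) z (e(2 := j, 6 := x))" for j x using assms by (simp add: sdeep_def)
  ultimately show ?thesis using assms sok_sleaf[of k p e M z] by (simp add: sformula_def)
qed

definition counters :: "nat \<Rightarrow> nat \<Rightarrow> bool" where
  "counters d i \<longleftrightarrow> 7 \<le> i \<and> odd i \<and> i < 7 + 2 * d"

text \<open>The odd counters travel with the input head to position \<open>m + 1\<close>, where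
  \<open>m\<close> is the length of the input, and stay there while it returns. Printing
  \<open>S\<close> letters leaves heads 3 to 6 at \<open>S + 1\<close>, and one step back puts
  counter 5 at \<open>S\<close>.\<close>

definition reducer :: "nat \<Rightarrow> nat \<Rightarrow> tm \<Rightarrow> com" where
  "reducer C d M =
    Seq (While (\<lambda>r. r 0 \<noteq> 0) (shift (\<lambda>i. if i = 0 \<or> counters d i then MoveRight else Stay)))
    (Seq (While (\<lambda>r. r 0 \<noteq> 1) (shift (\<lambda>i. if i = 0 then MoveLeft else Stay)))
    (Seq (produce 3 (nest C d)) (Seq (produce 4 (nest C d)) (Seq (produce 5 (nest C d)) (Seq (produce 6 (nest C d))
    (Seq (shift (\<lambda>i. if i = 5 then MoveLeft else Stay)) (produce (7 + 2 * d) (to_gen (sformula M)))))))))"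

text \<open>Nine symbols suffice for the printed encoding; adding \<open>n\<close> makes room for
  the input alphabet.\<close>

lemma wf_reducer: "wf_com k (n + 9) (reducer C d M)"
  by (simp add: reducer_def produce_def shift_def wf_gcom glets_nest glets_to_gen)

definition red_env :: "nat \<Rightarrow> nat \<Rightarrow> nat list \<Rightarrow> nat \<Rightarrow> nat" where
  "red_env C d w = (\<lambda>i. if counters d i then Suc (length w) else 0)
     (3 := Suc (C * Suc (length w) ^ d), 4 := Suc (C * Suc (length w) ^ d),
      5 := C * Suc (length w) ^ d, 6 := Suc (C * Suc (length w) ^ d), 7 + 2 * d := 1)"

definition red_words :: "nat \<Rightarrow> nat \<Rightarrow> nat list \<Rightarrow> nat \<Rightarrow> nat list" where
  "red_words C d w = (let ws = replicate (C * Suc (length w) ^ d) 0 in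
     (\<lambda>i. if i = 0 then w else [])(3 := ws, 4 := ws, 5 := ws, 6 := ws))"

definition red_bound :: "nat \<Rightarrow> nat \<Rightarrow> nat poly" where
  "red_bound C d = [:C:] * [:1, 1:] ^ d + [:1, 1:]"

text \<open>The summands pay, up to a constant, for the two sweeps over the input, the four runs of
  \<open>nest\<close> and the printing of the formula. \<open>red_bound\<close> is
  \<open>S + (m + 1)\<close>, which bounds all counters.\<close>

definition red_time :: "nat \<Rightarrow> nat \<Rightarrow> tm \<Rightarrow> nat poly" where
  "red_time C d M = [:4, 4:] + [:20:] + [:4:] * pcompose (cost (nest C d)) (red_bound C d)
     + pcompose (cost (to_gen (sformula M))) (red_bound C d)"

lemma runs_reducer:
  assumes k: "k = 8 + 2 * d"
  shows "runs k (reducer C d M) (init_st w) (poly (red_time C d M) (length w))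
    (full ((red_env C d w)(7 + 2 * d := Suc (length (encode (to_fm (sformula M) (red_words C d w) (red_env C d w))))))
       ((red_words C d w)(7 + 2 * d := encode (to_fm (sformula M) (red_words C d w) (red_env C d w)))))"
proof -
  define m where "m = length w"
  define S where "S = C * Suc m ^ d"
  define B where "B = S + Suc m"
  define ws where "ws = replicate S (0::nat)"
  define p where "p = 7 + 2 * d"
  define z0 where "z0 = (\<lambda>i::nat. if i = 0 then w else [])"
  define e1 where "e1 = (\<lambda>i. if counters d i then Suc m else 0)"
  define T where "T = poly (cost (nest C d)) B"
  have cnt: "\<not> counters d i" if "i < 7" for i using that by (simp add: counters_def)
  have cp: "\<not> counters d p" by (simp add: counters_def p_def)
  have c7: "counters d (7 + 2 * i)" "\<not> counters d (8 + 2 * i)" if "i < d" for i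
    using that by (simp_all add: counters_def)
  have ck: "counters d i \<Longrightarrow> i < k" for i by (simp add: counters_def k)
  have i0: "init_st w = full (\<lambda>i. 0) z0"
    by (auto simp: init_st_def full_def z0_def fun_eq_iff)
  define \<sigma> where "\<sigma> j = full (\<lambda>i. if i = 0 \<or> counters d i then j else 0) z0" for j
  have rd0: "rd k (full e z) 0 = tape_of (z 0) (e 0)" for e z using k by (simp add: rd_def full_def)
  have r1: "runs k (While (\<lambda>r. r 0 \<noteq> 0) (shift (\<lambda>i. if i = 0 \<or> counters d i then MoveRight else Stay))) (\<sigma> 0)
      (2 * Suc m + 1) (\<sigma> (Suc m))"
  proof (rule runs_loop, intro conjI)
    fix j assume "j < Suc m"
    then show "rd k (\<sigma> j) 0 \<noteq> 0" by (cases j) (simp_all add: \<sigma>_def rd0 z0_def tape_of_Suc m_def)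
    show "exec k (\<lambda>_. True) (shift (\<lambda>i. if i = 0 \<or> counters d i then MoveRight else Stay)) (\<sigma> j) 1 (\<sigma> (Suc j))"
      unfolding \<sigma>_def by (rule exec_shift) (use ck k in \<open>auto simp: moved_def dest: ck\<close>)
  qed (simp add: \<sigma>_def rd0 z0_def tape_of_Suc m_def)
  define \<rho> where "\<rho> j = full (e1(0 := Suc m - j)) z0" for j
  have r2: "runs k (While (\<lambda>r. r 0 \<noteq> 1) (shift (\<lambda>i. if i = 0 then MoveLeft else Stay))) (\<rho> 0) (2 * Suc m + 1) (\<rho> (Suc m))"
  proof (rule runs_loop, intro conjI)
    fix j assume "j < Suc m"
    then show "rd k (\<rho> j) 0 \<noteq> 1" by (simp add: \<rho>_def rd0 tape_of_eq_1)
    show "exec k (\<lambda>_. True) (shift (\<lambda>i. if i = 0 then MoveLeft else Stay)) (\<rho> j) 1 (\<rho> (Suc j))"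
      unfolding \<rho>_def by (rule exec_shift) (auto simp: moved_def k)
  qed (simp add: \<rho>_def rd0)
  have \<sigma>\<rho>: "\<sigma> (Suc m) = \<rho> 0" "\<rho> (Suc m) = full e1 z0" "\<sigma> 0 = init_st w"
    using cnt[of 0] by (auto simp: \<sigma>_def \<rho>_def e1_def i0 intro!: arg_cong2[where f = full])
  have pr: "runs k (produce y (nest C d)) (full e z) (T + 2) (full (e(y := Suc S)) (z(y := ws)))"
    if y: "y < 7" "e y = 0" "z y = []" and e: "\<And>i. i < d \<Longrightarrow> e (7 + 2 * i) = Suc m \<and> e (8 + 2 * i) = 0" "\<And>i. e i \<le> B"
    for y e z
  proof -
    have "runs k (produce y (nest C d)) (full e z) (poly (cost (nest C d)) B + 2)
      (full (e(y := Suc (length ws))) (z(y := ws)))"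
    proof (rule runs_produce)
      show "gok k y (nest C d) z (e(y := 1))" by (rule gok_nest) (use y e k in auto)
      show "out (nest C d) z (e(y := 1)) = ws" unfolding ws_def S_def by (rule out_nest) (use y e in auto)
    qed (use y e k in \<open>auto simp: B_def\<close>)
    then show ?thesis by (simp add: T_def ws_def)
  qed
  let ?e3 = "e1(3 := Suc S)" and ?z3 = "z0(3 := ws)"
  let ?e4 = "?e3(4 := Suc S)" and ?z4 = "?z3(4 := ws)"
  let ?e5 = "?e4(5 := Suc S)" and ?z5 = "?z4(5 := ws)"
  let ?e6 = "?e5(6 := Suc S)" and ?z6 = "?z5(6 := ws)"
  have le: "e1 i \<le> B" "Suc S \<le> B" for i by (simp_all add: e1_def B_def)
  have e7: "e1 (7 + 2 * i) = Suc m" "e1 (8 + 2 * i) = 0" if "i < d" for i using c7[OF that] by (simp_all add: e1_def)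
  have small: "e1 3 = 0" "e1 4 = 0" "e1 5 = 0" "e1 6 = 0" "e1 0 = 0" "e1 1 = 0" "e1 2 = 0" "e1 p = 0"
    using cnt cp by (simp_all add: e1_def)
  have zs: "z0 3 = []" "z0 4 = []" "z0 5 = []" "z0 6 = []" "z0 p = []" "z0 0 = w" by (simp_all add: z0_def p_def)
  have r3: "runs k (produce 3 (nest C d)) (full e1 z0) (T + 2) (full ?e3 ?z3)"
    by (rule pr) (use e7 le small zs in auto)
  have r4: "runs k (produce 4 (nest C d)) (full ?e3 ?z3) (T + 2) (full ?e4 ?z4)"
    by (rule pr) (use e7 le small zs in auto)
  have r5: "runs k (produce 5 (nest C d)) (full ?e4 ?z4) (T + 2) (full ?e5 ?z5)"
    by (rule pr) (use e7 le small zs in auto)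
  have r6: "runs k (produce 6 (nest C d)) (full ?e5 ?z5) (T + 2) (full ?e6 ?z6)"
    by (rule pr) (use e7 le small zs in auto)
  have env: "red_env C d w = ?e6(5 := S, p := 1)" unfolding red_env_def e1_def S_def m_def p_def by (rule ext) simp
  define e where "e = (red_env C d w)(p := 0)"
  have e: "e = ?e6(5 := S)" "e(p := 1) = red_env C d w" unfolding e_def env using small by (auto simp: p_def fun_eq_iff)
  have words: "red_words C d w = ?z6" unfolding red_words_def Let_def z0_def ws_def S_def m_def by (rule ext) simp
  have r7: "runs k (shift (\<lambda>i. if i = 5 then MoveLeft else Stay)) (full ?e6 ?z6) 1 (full e (red_words C d w))"
    unfolding e words by (rule runs_shift) (auto simp: moved_def k)
  let ?f = "encode (to_fm (sformula M) (red_words C d w) (red_env C d w))"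
  have rp: "e p = 0" "red_words C d w p = []" "e i \<le> B" for i
    unfolding e words using small zs le by (auto simp: p_def)
  have r8: "runs k (produce p (to_gen (sformula M))) (full e (red_words C d w))
     (poly (cost (to_gen (sformula M))) B + 2) (full ((red_env C d w)(p := Suc (length ?f))) ((red_words C d w)(p := ?f)))"
  proof -
    have "sok k p (sformula M) (red_words C d w) (e(p := 1))"
      by (rule sok_sformula) (use k small in \<open>simp_all add: e(1) p_def\<close>)
    note g = to_gen_correct[OF this]
    have "runs k (produce p (to_gen (sformula M))) (full e (red_words C d w))
     (poly (cost (to_gen (sformula M))) B + 2) (full (e(p := Suc (length ?f))) ((red_words C d w)(p := ?f)))"
      by (rule runs_produce) (use g e(2) k rp in \<open>simp_all add: p_def B_def\<close>)
    moreover have "e(p := Suc (length ?f)) = (red_env C d w)(p := Suc (length ?f))" by (simp add: e_def)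
    ultimately show ?thesis by simp
  qed
  have B: "poly (red_bound C d) m = B" by (simp add: red_bound_def B_def S_def algebra_simps)
  note r = runs_Seq[OF r1 runs_Seq[OF r2[folded \<sigma>\<rho>(1)] runs_Seq[OF r3[folded \<sigma>\<rho>(2)] runs_Seq[OF r4 runs_Seq[OF r5 runs_Seq[OF r6 runs_Seq[OF r7 r8]]]]]]]
  show ?thesis
    using r unfolding \<sigma>\<rho> m_def[symmetric] reducer_def p_def[symmetric] runs_def
    by (rule ex_forward) (auto simp: red_time_def poly_pcompose B T_def algebra_simps)
qed

theorem SAT_hard:
  assumes inf: "infinite (UNIV :: 'w set)"
  shows "PSPACE_hard 7 (SAT TYPE('w))"
  unfolding PSPACE_hard_def
proof (intro allI impI)
  fix n A assume "in_PSPACE n A"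
  then obtain M and p :: "nat poly" where M: "decides_in_space M n A (poly p)" by (auto simp: in_PSPACE_def)
  obtain C d where Cd: "\<And>m. poly p m \<le> C * Suc m ^ d" using poly_nat_bound by blast
  define k where "k = 8 + 2 * d"
  define f where "f w = encode (to_fm (sformula M) (red_words C d w) (red_env C d w))" for w
  define fin where "fin w = full ((red_env C d w)(7 + 2 * d := Suc (length (f w)))) ((red_words C d w)(7 + 2 * d := f w))" for w
  have run: "runs k (reducer C d M) (init_st w) (poly (red_time C d M) (length w)) (fin w)" for w
    unfolding fin_def f_def by (rule runs_reducer) (simp add: k_def)
  obtain N where N: "wf_tm N" "num_symbols N = n + 9"
    and res: "\<And>w t s' H. exec k H (reducer C d M) (init_st w) t s' \<Longrightarrow> H 0 \<Longrightarrow>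
       config_at N w (Suc t) = (if True then accept_state N else reject_state N, map s' [0..<k])"
  proof (rule compile[OF _ wf_reducer[of k n C d M], of "\<lambda>_. True"])
  qed (simp_all add: that k_def)
  have out: "config_at N w (poly (red_time C d M + 1) (length w)) = (accept_state N, map (fin w) [0..<k])" for w
  proof -
    obtain t where t: "t \<le> poly (red_time C d M) (length w)" "exec k (\<lambda>_. True) (reducer C d M) (init_st w) t (fin w)"
      using run unfolding runs_def by blast
    have c: "config_at N w (Suc t) = (accept_state N, map (fin w) [0..<k])" using res[OF t(2)] by simp
    have "config_at N w (Suc t + (poly (red_time C d M) (length w) - t)) = config_at N w (Suc t)"
      by (rule config_at_halted) (simp add: c halting_state_def)
    then show ?thesis using t(1) c by simp
  qed
  have last: "snd (last (map (fin w) [0..<k])) = tape_of (f w)" for w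
  proof -
    have "last (map (fin w) [0..<k]) = fin w (7 + 2 * d)" by (simp add: k_def last_map)
    then show ?thesis by (simp add: fin_def full_def)
  qed
  \<comment> \<open>The additional step is the one that enters the accepting state.\<close>
  have "computes_in_time N n f (poly (red_time C d M + 1))"
    unfolding computes_in_time_def out using N last by (simp add: halting_state_def)
  moreover have "f w \<in> lists {..<7} \<and> (w \<in> A \<longleftrightarrow> f w \<in> SAT TYPE('w))" if w: "w \<in> lists {..<n}" for w
  proof
    show "f w \<in> lists {..<7}" unfolding f_def by (rule encode_lists)
    have "sized (C * Suc (length w) ^ d) (red_env C d w)" "red_env C d w 6 = Suc (C * Suc (length w) ^ d)"
      by (simp_all add: sized_def red_env_def counters_def)
    then have "satisfiable TYPE('w) (to_fm (sformula M) (red_words C d w) (red_env C d w)) \<longleftrightarrow> w \<in> A"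
      by (rule sformula_satisfiable[OF inf M w Cd]) (simp add: red_words_def Let_def)
    then show "w \<in> A \<longleftrightarrow> f w \<in> SAT TYPE('w)"
      unfolding f_def SAT_def using inj_encode by (auto dest: injD)
  qed
  ultimately show "poly_reducible n A 7 (SAT TYPE('w))" unfolding poly_reducible_def by blast
qed

theorem theorem12:
  assumes "infinite (UNIV :: 'w set)"
  shows "PSPACE_complete 7 (SAT TYPE('w))"
  using SAT_in_PSPACE[OF assms] SAT_hard[OF assms] by (simp add: PSPACE_complete_def)

end
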